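(* Let $L$ be an even lattice of signature $(n,2)$, $n>2$, which splits a hyperbolic plane, let $D=L'/L$, and let $\Gamma\subset\mathrm{O}(L)$ be a subgroup containing the discriminant kernel $\Delta(L)$; set $\Gamma^+=\Gamma\cap\mathrm{O}(L)^+$. Let $S\subset L$ be a splitting primitive isotropic plane of type $H$ with associated lattice $K$. Then the $1$-dimensional splitting cusps of $\Gamma^+\backslash\mathcal{H}$ of type $\mathrm{O}(D)H$ with associated lattice (isomorphic to) $K$ are represented by the primitive isotropic planes $\phi(S)$, where $\phi\in\mathrm{O}(L)$ ranges over a set of (lifts of) representatives of the double cosets $\overline{\Gamma}\backslash\mathrm{O}(D)/\overline{\mathrm{O}(L)_S^+}$; i.e. these cusps are parametrised by this double quotient.
   Context: $V=L\otimes\mathbb{Q}$; $\mathcal{H}$ is one component of $\{[z]\in P(V\otimes\mathbb{C}):(z,z)=0,(z,\bar z)<0\}$ and $\mathrm{O}(L)^+$ is the subgroup of $\mathrm{O}(L)$ preserving $\mathcal{H}$. $\Delta(L)$ is the kernel of $\mathrm{O}(L)\to\mathrm{O}(D)$, and $\overline{G}$ denotes the image in $\mathrm{O}(D)$ of a subgroup $G\subset\mathrm{O}(L)$. $\mathrm{O}(L)_S^+$ is the stabiliser of $S$ in $\mathrm{O}(L)^+$. The $1$-dimensional cusps of $\Gamma^+\backslash\mathcal{H}$ correspond to the $\Gamma^+$-orbits of $2$-dimensional isotropic subspaces $U\subset V$, equivalently of primitive isotropic planes $S=L\cap U$ (an isotropic plane in $L$ is identified with the subspace $S\otimes\mathbb{Q}$).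 For such $U$: its type is the isotropic subgroup $H=(L'\cap U)/(L\cap U)\subset D$; with $L^H=(L'\cap U)+L$, its associated lattice is $K=(L^H\cap U^\perp)/(L^H\cap U)$ (a positive-definite even lattice). $U$ splits if there is an isotropic subspace $U'\subset V$ dual to $U$ with $L=M\oplus(L\cap U+L\cap U')$ for some positive-definite even lattice $M$. The type of a cusp is the orbit $\mathrm{O}(D)H$ and its associated lattice is the isomorphism class of $K$, for any representing $U$; the cusp splits if $U$ does.
   Formalization: The lifts φ of the double coset representatives are taken in O(L)^+ rather than arbitrarily in O(L); for arbitrary lifts the claim can fail, e.g. L = E8+II(3)+II(3), Γ = Δ(L), where inequivalent representatives can have lifts 1 and σ with σ(S) = S. *)

theory Defs
  imports "HOL-Analysis.Analysis" "HOL-Algebra.Coset" "HOL-Algebra.Bij"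
begin

text \<open>
  A lattice \<open>L\<close> lives in its real span, the type \<open>'v\<close>, which thus plays the role of the real
  quadratic space of \<open>L\<close>; the rational space \<open>V\<close> is the rational span of \<open>L\<close> inside \<open>'v\<close>. Bilinearity
  and symmetry of the form \<open>B\<close> are part of \<open>even_lattice\<close>. The inner product that comes with the class
  \<^class>\<open>euclidean_space\<close> plays no role; the class only supplies finite dimension and the topology.
\<close>

section \<open>Lattices\<close>

definition qscale :: "rat \<Rightarrow> 'v::real_vector \<Rightarrow> 'v"
  where "qscale q x = of_rat q *\<^sub>R x"

definition zscale :: "int \<Rightarrow> 'v::real_vector \<Rightarrow> 'v"
  where "zscale k x = of_int k *\<^sub>R x"

global_interpretation qvec: vector_space "qscale :: rat \<Rightarrow> 'v \<Rightarrow> 'v::real_vector"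
  by standard (simp_all add: qscale_def algebra_simps of_rat_add of_rat_mult)

global_interpretation zmod: module "zscale :: int \<Rightarrow> 'v \<Rightarrow> 'v::real_vector"
  by standard (simp_all add: zscale_def algebra_simps)

definition is_lattice :: "'v::euclidean_space set \<Rightarrow> bool"
  where "is_lattice L \<longleftrightarrow> (\<exists>b. independent b \<and> span b = UNIV \<and> L = zmod.span b)"

definition even_on :: "('v \<Rightarrow> 'v \<Rightarrow> real) \<Rightarrow> 'v set \<Rightarrow> bool"
  where "even_on B M \<longleftrightarrow>
    (\<forall>x\<in>M. \<forall>y\<in>M. B x y \<in> \<int>) \<and> (\<forall>x\<in>M. B x x / 2 \<in> \<int>)"

definition even_lattice :: "('v \<Rightarrow> 'v \<Rightarrow> real) \<Rightarrow> 'v::euclidean_space set \<Rightarrow> bool"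
  where "even_lattice B L \<longleftrightarrow>
    bilinear B \<and> (\<forall>x y. B x y = B y x) \<and> is_lattice L \<and> even_on B L"

definition signature :: "('v \<Rightarrow> 'v \<Rightarrow> real) \<Rightarrow> nat \<Rightarrow> nat \<Rightarrow> 'v::euclidean_space itself \<Rightarrow> bool"
  where "signature B p q _ \<longleftrightarrow>
    (\<exists>P N :: 'v set. subspace P \<and> subspace N \<and> dim P = p \<and> dim N = q \<and>
       (\<forall>x\<in>P - {0}. B x x > 0) \<and> (\<forall>x\<in>N - {0}. B x x < 0) \<and>
       (\<forall>x\<in>P. \<forall>y\<in>N. B x y = 0) \<and> {x + y | x y. x \<in> P \<and> y \<in> N} = UNIV)"

definition orth_direct_sum ::
    "('v \<Rightarrow> 'v \<Rightarrow> real) \<Rightarrow> 'v set \<Rightarrow> 'v set \<Rightarrow> 'v::euclidean_space set \<Rightarrow> bool"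
  where "orth_direct_sum B L M N \<longleftrightarrow>
    zmod.subspace M \<and> zmod.subspace N \<and> M \<inter> N = {0} \<and> (\<forall>x\<in>M. \<forall>y\<in>N. B x y = 0) \<and>
    L = {x + y | x y. x \<in> M \<and> y \<in> N}"

text \<open>The hyperbolic plane is the even unimodular lattice of signature \<open>(1,1)\<close>.\<close>

definition splits_hyperbolic_plane ::
    "('v \<Rightarrow> 'v \<Rightarrow> real) \<Rightarrow> 'v::euclidean_space set \<Rightarrow> bool"
  where "splits_hyperbolic_plane B L \<longleftrightarrow>
    (\<exists>e f M. B e e = 0 \<and> B f f = 0 \<and> B e f = 1 \<and> orth_direct_sum B L (zmod.span {e, f}) M)"

definition ratspace :: "'v::euclidean_space set \<Rightarrow> 'v set"
  where "ratspace L = qvec.span L"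

definition dual_lattice :: "('v \<Rightarrow> 'v \<Rightarrow> real) \<Rightarrow> 'v::euclidean_space set \<Rightarrow> 'v set"
  where "dual_lattice B L = {x \<in> ratspace L. \<forall>y\<in>L. B x y \<in> \<int>}"

section \<open>Discriminant form and orthogonal groups\<close>

definition additive_grp :: "'v::ab_group_add set \<Rightarrow> 'v monoid"
  where "additive_grp A = \<lparr>carrier = A, mult = (+), one = 0\<rparr>"

definition disc_group :: "('v \<Rightarrow> 'v \<Rightarrow> real) \<Rightarrow> 'v::euclidean_space set \<Rightarrow> 'v set monoid"
  where "disc_group B L = additive_grp (dual_lattice B L) Mod L"

text \<open>The value \<open>(x,x)/2\<close> modulo \<open>1\<close> of the discriminant quadratic form, as a coset of the integers.\<close>

definition disc_q :: "('v \<Rightarrow> 'v \<Rightarrow> real) \<Rightarrow> 'v set \<Rightarrow> real set"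
  where "disc_q B X = {r. \<exists>x\<in>X. r - B x x / 2 \<in> \<int>}"

definition OD :: "('v \<Rightarrow> 'v \<Rightarrow> real) \<Rightarrow> 'v::euclidean_space set \<Rightarrow> ('v set \<Rightarrow> 'v set) monoid"
  where "OD B L = AutoGroup (disc_group B L)
    \<lparr>carrier := {f \<in> auto (disc_group B L).
                  \<forall>X\<in>carrier (disc_group B L). disc_q B (f X) = disc_q B X}\<rparr>"

text \<open>Isometries of \<open>L\<close> are represented by their linear extensions to \<open>'v\<close>.\<close>

definition OL :: "('v \<Rightarrow> 'v \<Rightarrow> real) \<Rightarrow> 'v::euclidean_space set \<Rightarrow> ('v \<Rightarrow> 'v) monoid"
  where "OL B L =
    \<lparr>carrier = {f. linear f \<and> (\<forall>x y. B (f x) (f y) = B x y) \<and> f ` L = L},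
     mult = (\<circ>), one = id\<rparr>"

definition red :: "('v \<Rightarrow> 'v \<Rightarrow> real) \<Rightarrow> 'v::euclidean_space set \<Rightarrow> ('v \<Rightarrow> 'v) \<Rightarrow> 'v set \<Rightarrow> 'v set"
  where "red B L f = (\<lambda>X\<in>carrier (disc_group B L). f ` X)"

definition disc_kernel :: "('v \<Rightarrow> 'v \<Rightarrow> real) \<Rightarrow> 'v::euclidean_space set \<Rightarrow> ('v \<Rightarrow> 'v) set"
  where "disc_kernel B L = kernel (OL B L) (OD B L) (red B L)"

section \<open>The symmetric domain\<close>

text \<open>A pair \<open>(x, y)\<close> stands for the vector \<open>x + \<i>y\<close> of the complexification of \<open>'v\<close>.\<close>

definition cscale :: "complex \<Rightarrow> 'v \<times> 'v \<Rightarrow> 'v \<times> 'v::euclidean_space"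
  where "cscale c z =
    (Re c *\<^sub>R fst z - Im c *\<^sub>R snd z, Re c *\<^sub>R snd z + Im c *\<^sub>R fst z)"

definition cconj :: "'v \<times> 'v \<Rightarrow> 'v \<times> 'v::euclidean_space"
  where "cconj z = (fst z, - snd z)"

definition cform :: "('v \<Rightarrow> 'v \<Rightarrow> real) \<Rightarrow> 'v \<times> 'v \<Rightarrow> 'v \<times> 'v \<Rightarrow> complex"
  where "cform B z w =
    Complex (B (fst z) (fst w) - B (snd z) (snd w)) (B (fst z) (snd w) + B (snd z) (fst w))"

definition cline :: "'v \<times> 'v \<Rightarrow> ('v \<times> 'v::euclidean_space) set"
  where "cline z = range (\<lambda>c. cscale c z)"

definition proj_space :: "('v \<times> 'v::euclidean_space) set set"
  where "proj_space = cline ` (UNIV - {0})"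

text \<open>The quotient topology of projective space.\<close>

definition proj_topology :: "('v \<times> 'v::euclidean_space) set topology"
  where "proj_topology =
    topology (\<lambda>W. W \<subseteq> proj_space \<and> open {z. z \<noteq> 0 \<and> cline z \<in> W})"

lemma openin_proj_topology:
  "openin proj_topology W \<longleftrightarrow> W \<subseteq> proj_space \<and> open {z. z \<noteq> 0 \<and> cline z \<in> W}"
proof -
  have "istopology (\<lambda>W. W \<subseteq> proj_space \<and> open {z :: 'a \<times> 'a. z \<noteq> 0 \<and> cline z \<in> W})"
    unfolding istopology_def
  proof (intro conjI allI impI; (elim conjE)?)
    fix S T :: "('a \<times> 'a) set set"
    assume "S \<subseteq> proj_space"
    then show "S \<inter> T \<subseteq> proj_space" by blast
  next
    fix S T :: "('a \<times> 'a) set set"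
    assume "open {z. z \<noteq> 0 \<and> cline z \<in> S}" "open {z. z \<noteq> 0 \<and> cline z \<in> T}"
    then have "open ({z. z \<noteq> 0 \<and> cline z \<in> S} \<inter> {z. z \<noteq> 0 \<and> cline z \<in> T})" by blast
    also have "\<dots> = {z. z \<noteq> 0 \<and> cline z \<in> S \<inter> T}" by blast
    finally show "open {z. z \<noteq> 0 \<and> cline z \<in> S \<inter> T}" .
  next
    fix K :: "('a \<times> 'a) set set set"
    assume "\<forall>W\<in>K. W \<subseteq> proj_space \<and> open {z. z \<noteq> 0 \<and> cline z \<in> W}"
    then have "open (\<Union>W\<in>K. {z. z \<noteq> 0 \<and> cline z \<in> W})" by blast
    also have "(\<Union>W\<in>K. {z. z \<noteq> 0 \<and> cline z \<in> W}) = {z. z \<noteq> 0 \<and> cline z \<in> \<Union>K}" by blast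
    finally show "open {z. z \<noteq> 0 \<and> cline z \<in> \<Union>K}" .
  qed blast
  then show ?thesis
    by (simp add: proj_topology_def topology_inverse')
qed

text \<open>For symmetric \<open>B\<close> the number \<open>cform B z (cconj z)\<close> is real.\<close>

definition period_domain :: "('v \<Rightarrow> 'v \<Rightarrow> real) \<Rightarrow> ('v \<times> 'v::euclidean_space) set set"
  where "period_domain B =
    {cline z | z. z \<noteq> 0 \<and> cform B z z = 0 \<and> Re (cform B z (cconj z)) < 0}"

definition period_components :: "('v \<Rightarrow> 'v \<Rightarrow> real) \<Rightarrow> ('v \<times> 'v::euclidean_space) set set set"
  where "period_components B =
    connected_components_of (subtopology proj_topology (period_domain B))"

definition OL_plus :: "('v \<Rightarrow> 'v \<Rightarrow> real) \<Rightarrow> 'v::euclidean_space set \<Rightarrow>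
    ('v \<times> 'v) set set \<Rightarrow> ('v \<Rightarrow> 'v) set"
  where "OL_plus B L \<H> =
    {f \<in> carrier (OL B L). (\<lambda>p. map_prod f f ` p) ` \<H> = \<H>}"

definition stab_plus :: "('v \<Rightarrow> 'v \<Rightarrow> real) \<Rightarrow> 'v::euclidean_space set \<Rightarrow>
    ('v \<times> 'v) set set \<Rightarrow> 'v set \<Rightarrow> ('v \<Rightarrow> 'v) set"
  where "stab_plus B L \<H> S = {f \<in> OL_plus B L \<H>. f ` S = S}"

section \<open>Isotropic planes\<close>

definition isotropic :: "('v \<Rightarrow> 'v \<Rightarrow> real) \<Rightarrow> 'v set \<Rightarrow> bool"
  where "isotropic B U \<longleftrightarrow> (\<forall>x\<in>U. \<forall>y\<in>U. B x y = 0)"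

definition isotropic_planes ::
    "('v \<Rightarrow> 'v \<Rightarrow> real) \<Rightarrow> 'v::euclidean_space set \<Rightarrow> 'v set set"
  where "isotropic_planes B L =
    {U. U \<subseteq> ratspace L \<and> qvec.subspace U \<and> qvec.dim U = 2 \<and> isotropic B U}"

text \<open>The plane of \<open>V\<close> belonging to a primitive isotropic plane \<open>S\<close> of \<open>L\<close> is \<open>qvec.span S\<close>.\<close>

definition primitive_isotropic_plane ::
    "('v \<Rightarrow> 'v \<Rightarrow> real) \<Rightarrow> 'v::euclidean_space set \<Rightarrow> 'v set \<Rightarrow> bool"
  where "primitive_isotropic_plane B L S \<longleftrightarrow> (\<exists>U\<in>isotropic_planes B L. S = L \<inter> U)"

definition plane_type ::
    "('v \<Rightarrow> 'v \<Rightarrow> real) \<Rightarrow> 'v::euclidean_space set \<Rightarrow> 'v set \<Rightarrow> 'v set set"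
  where "plane_type B L U =
    (\<lambda>x. L #>\<^bsub>additive_grp (dual_lattice B L)\<^esub> x) ` (dual_lattice B L \<inter> U)"

definition perp ::
    "('v \<Rightarrow> 'v \<Rightarrow> real) \<Rightarrow> 'v::euclidean_space set \<Rightarrow> 'v set \<Rightarrow> 'v set"
  where "perp B L U = {x \<in> ratspace L. \<forall>u\<in>U. B x u = 0}"

definition overlattice ::
    "('v \<Rightarrow> 'v \<Rightarrow> real) \<Rightarrow> 'v::euclidean_space set \<Rightarrow> 'v set \<Rightarrow> 'v set"
  where "overlattice B L U = {x + y | x y. x \<in> dual_lattice B L \<inter> U \<and> y \<in> L}"

definition assoc_lattice ::
    "('v \<Rightarrow> 'v \<Rightarrow> real) \<Rightarrow> 'v::euclidean_space set \<Rightarrow> 'v set \<Rightarrow> 'v set monoid"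
  where "assoc_lattice B L U =
    additive_grp (overlattice B L U \<inter> perp B L U) Mod (overlattice B L U \<inter> U)"

text \<open>
  The form induced on cosets by representatives; on \<open>assoc_lattice B L U\<close> it is well defined
  because \<open>U\<close> is orthogonal to the vectors that occur.
\<close>

definition coset_form :: "('v \<Rightarrow> 'v \<Rightarrow> real) \<Rightarrow> 'v set \<Rightarrow> 'v set \<Rightarrow> real"
  where "coset_form B X Y = (THE r. \<forall>x\<in>X. \<forall>y\<in>Y. B x y = r)"

definition lattice_isometric ::
    "('v \<Rightarrow> 'v \<Rightarrow> real) \<Rightarrow> 'v set monoid \<Rightarrow> 'v set monoid \<Rightarrow> bool"
  where "lattice_isometric B K1 K2 \<longleftrightarrow>
    (\<exists>h\<in>iso K1 K2. \<forall>X\<in>carrier K1. \<forall>Y\<in>carrier K1.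
       coset_form B (h X) (h Y) = coset_form B X Y)"

definition dual_subspaces :: "('v \<Rightarrow> 'v \<Rightarrow> real) \<Rightarrow> 'v::euclidean_space set \<Rightarrow> 'v set \<Rightarrow> bool"
  where "dual_subspaces B U U' \<longleftrightarrow>
    (\<forall>x\<in>U. (\<forall>y\<in>U'. B x y = 0) \<longrightarrow> x = 0) \<and> (\<forall>y\<in>U'. (\<forall>x\<in>U. B x y = 0) \<longrightarrow> y = 0)"

definition plane_splits ::
    "('v \<Rightarrow> 'v \<Rightarrow> real) \<Rightarrow> 'v::euclidean_space set \<Rightarrow> 'v set \<Rightarrow> bool"
  where "plane_splits B L U \<longleftrightarrow>
    (\<exists>U' M. U' \<subseteq> ratspace L \<and> qvec.subspace U' \<and> isotropic B U' \<and> dual_subspaces B U U' \<and>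
       even_on B M \<and> (\<forall>x\<in>M - {0}. B x x > 0) \<and>
       orth_direct_sum B L M {x + y | x y. x \<in> L \<inter> U \<and> y \<in> L \<inter> U'})"

section \<open>One-dimensional cusps\<close>

definition cusp_of :: "('v \<Rightarrow> 'v) set \<Rightarrow> 'v set \<Rightarrow> 'v set set"
  where "cusp_of G U = (\<lambda>f. f ` U) ` G"

definition cusps1 ::
    "('v \<Rightarrow> 'v \<Rightarrow> real) \<Rightarrow> 'v::euclidean_space set \<Rightarrow> ('v \<Rightarrow> 'v) set \<Rightarrow> 'v set set set"
  where "cusps1 B L G = cusp_of G ` isotropic_planes B L"

definition OD_orbit ::
    "('v \<Rightarrow> 'v \<Rightarrow> real) \<Rightarrow> 'v::euclidean_space set \<Rightarrow> 'v set set \<Rightarrow> 'v set set set"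
  where "OD_orbit B L H = (\<lambda>\<sigma>. \<sigma> ` H) ` carrier (OD B L)"

text \<open>The three conditions on \<open>U\<close> do not depend on the choice of \<open>U\<close> in the orbit \<open>c\<close>,
  since \<open>G\<close> will consist of isometries of \<open>L\<close>.\<close>

definition splitting_cusps :: "('v \<Rightarrow> 'v \<Rightarrow> real) \<Rightarrow> 'v::euclidean_space set \<Rightarrow> ('v \<Rightarrow> 'v) set \<Rightarrow>
    'v set set set \<Rightarrow> 'v set monoid \<Rightarrow> 'v set set set"
  where "splitting_cusps B L G T K =
    {c \<in> cusps1 B L G. \<forall>U\<in>c. plane_splits B L U \<and> OD_orbit B L (plane_type B L U) = T \<and>
       lattice_isometric B (assoc_lattice B L U) K}"

section \<open>Double cosets\<close>

definition double_coset :: "('g, 'm) monoid_scheme \<Rightarrow> 'g set \<Rightarrow> 'g set \<Rightarrow> 'g \<Rightarrow> 'g set"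
  where "double_coset G A C g = {a \<otimes>\<^bsub>G\<^esub> g \<otimes>\<^bsub>G\<^esub> c | a c. a \<in> A \<and> c \<in> C}"

definition double_quotient :: "('g, 'm) monoid_scheme \<Rightarrow> 'g set \<Rightarrow> 'g set \<Rightarrow> 'g set set"
  where "double_quotient G A C = double_coset G A C ` carrier G"

definition double_coset_reps :: "('g, 'm) monoid_scheme \<Rightarrow> 'g set \<Rightarrow> 'g set \<Rightarrow> 'g set \<Rightarrow> bool"
  where "double_coset_reps G A C R \<longleftrightarrow>
    R \<subseteq> carrier G \<and> bij_betw (double_coset G A C) R (double_quotient G A C)"

end

theory Submission
  imports Defs
begin

text \<open>
  All cusps of the given type and associated lattice are of the form \<open>\<phi>(S)\<close> with
  \<open>\<phi> \<in> O(L)\<^sup>+\<close>, since a splitting plane \<open>U\<close> determines \<open>L = K \<oplus> II(a) \<oplus> II(b)\<close>, where \<open>a | b\<close> are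
  the elementary divisors of the type, and the reflection in \<open>II(a)\<close> exchanges the two components
  while fixing \<open>U\<close>. What makes the double quotient of the whole of \<open>O(D)\<close> appear is the surjectivity
  of \<open>O(L) \<rightarrow> O(D)\<close>. Write \<open>L = II \<oplus> L1\<close> with \<open>L1\<close> of rank \<open>r\<close>. Gluing \<open>L\<close> and \<open>L1(-1)\<close> along
  \<open>\<sigma> \<in> O(D)\<close> gives an even unimodular lattice with a Lagrangian, so a sum of \<open>r + 1\<close> hyperbolic planes.
  Moving the basis vectors of \<open>L1(-1)\<close> one after the other by Eichler transformations shows that its
  primitive embedding is unique up to isometry. Comparing the embeddings for \<open>\<sigma>\<close> and for the identity and
  restricting to the orthogonal complement \<open>L\<close> of \<open>L1(-1)\<close> gives a lift of \<open>\<sigma>\<close>.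
\<close>

section \<open>Integral symmetric bilinear forms\<close>

text \<open>The obstacle is that an automorphism \<sigma> of \<open>L'/L\<close> does not tell where
  the vectors of \<open>L\<close> should go. Gluing trades it for two hyperbolic bases: the glued
  lattices for \<sigma> and for the identity lie in the same real space with the form
  \<open>bb\<close>, and in a suitable basis of each the vectors of \<open>L1(-1)\<close> have
  coordinates read off from their Gram matrix alone. Matching the bases therefore fixes
  \<open>L1(-1)\<close> pointwise, and a glue vector \<open>(y, y)\<close> goes to
  \<open>(g y, y)\<close>, which says that \<open>g\<close> induces \<sigma>. The hyperbolic plane
  in \<open>L\<close> enters through a count: the glued lattice has rank \<open>(r + 2) + r\<close>,
  and placing one of the \<open>r\<close> vectors by Eichler transformations uses its own plane
  together with one more. The same plane has a reflection that acts trivially on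
  \<open>L'/L\<close>, which allows lifts in \<open>OL_plus\<close>. The numbers
  \<open>a | b\<close> of a splitting plane are recovered from its type as its exponent
  \<open>b\<close> and its order \<open>a * b\<close>.\<close>

locale symmetric_bilinear =
  fixes b :: "'w::euclidean_space \<Rightarrow> 'w \<Rightarrow> real"
  assumes bilinear: "bilinear b" and sym: "b x y = b y x"
begin

lemma form_simps [simp]:
  "b (x + y) z = b x z + b y z" "b z (x + y) = b z x + b z y"
  "b (c *\<^sub>R x) z = c * b x z" "b z (c *\<^sub>R x) = c * b z x"
  "b (x - y) z = b x z - b y z" "b z (x - y) = b z x - b z y"
  "b (- x) z = - b x z" "b z (- x) = - b z x"
  "b 0 z = 0" "b z 0 = 0"
  using bilinear
  by (simp_all add: bilinear_ladd bilinear_radd bilinear_lmul bilinear_rmul bilinear_lsub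
      bilinear_rsub bilinear_lneg bilinear_rneg bilinear_lzero bilinear_rzero)

lemma linear_left: "linear (\<lambda>x. b x z)" and linear_right: "linear (b z)"
  by (auto intro!: linearI)

lemma form_sum: "b (sum f A) z = (\<Sum>i\<in>A. b (f i) z)" "b z (sum f A) = (\<Sum>i\<in>A. b z (f i))"
  by (rule linear_sum[OF linear_left], rule linear_sum[OF linear_right])

end

lemma zsub_scale:
  assumes "zmod.subspace A" "c \<in> \<int>" "x \<in> A"
  shows "c *\<^sub>R x \<in> A"
  using assms zmod.subspace_scale[of A x] unfolding zscale_def by (metis Ints_cases)

lemmas zsub_add = zmod.subspace_add and zsub_diff = zmod.subspace_diff and zsub_0 = zmod.subspace_0
  and zsub_minus = zmod.subspace_neg and zsub_sum = zmod.subspace_sum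

lemmas zsub_intros = zsub_scale zsub_add zsub_diff zsub_0 zsub_minus zsub_sum

lemma zsubI:
  assumes "0 \<in> A" "\<And>x y. x \<in> A \<Longrightarrow> y \<in> A \<Longrightarrow> x - y \<in> A"
  shows "zmod.subspace A"
proof -
  have neg: "- x \<in> A" if "x \<in> A" for x using assms(2)[OF assms(1) that] by simp
  have add: "x + y \<in> A" if "x \<in> A" "y \<in> A" for x y
    using assms(2)[OF that(1) neg[OF that(2)]] by simp
  have nat: "of_nat n *\<^sub>R x \<in> A" if "x \<in> A" for n x
    by (induction n) (auto simp: assms(1) scaleR_add_left intro: add that)
  have "of_int k *\<^sub>R x \<in> A" if "x \<in> A" for k x
  proof (cases "k \<ge> 0")
    case True
    then show ?thesis using nat[OF that, of "nat k"] by simp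
  next
    case False
    then show ?thesis using neg[OF nat[OF that, of "nat (-k)"]] by simp
  qed
  then show ?thesis unfolding zmod.subspace_def zscale_def using assms(1) add by auto
qed

text \<open>Division with remainder for a set of integers that need not be a group: in
  \<open>minimal_pairing\<close> it is the set of all values of a pairing. Divisibility of
  \<open>k\<close> is therefore claimed only when the differences \<open>k - q * d\<close> are known
  to lie in \<open>V\<close>; the remainder is one of them and is smaller than
  \<open>d\<close>.\<close>

lemma least_positive_value:
  fixes V :: "real set"
  assumes "V \<subseteq> \<int>" "\<And>v. v \<in> V \<Longrightarrow> - v \<in> V" "\<not> V \<subseteq> {0}"
  obtains d where "d \<in> V" "d > 0" "\<And>k. k \<in> \<int> \<Longrightarrow> (\<And>q. q \<in> \<int> \<Longrightarrow> k - q * d \<in> V) \<Longrightarrow> k / d \<in> \<int>"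
proof -
  obtain v where v: "v \<in> V" "v > 0" using assms(2,3) by (metis insertI1 linorder_neqE_linordered_idom neg_0_less_iff_less subsetI singletonD)
  obtain d where d: "d \<in> V" "d > 0" and lst: "\<And>w. w \<in> V \<and> w > 0 \<Longrightarrow> nat \<lfloor>d\<rfloor> \<le> nat \<lfloor>w\<rfloor>"
    using ex_has_least_nat[of "\<lambda>w. w \<in> V \<and> w > 0" v "\<lambda>w. nat \<lfloor>w\<rfloor>"] v by blast
  have least: "d \<le> w" if w: "w \<in> V" "w > 0" for w
  proof -
    obtain i j where "d = of_int i" "w = of_int j" using assms(1) d(1) w(1) by (blast elim: Ints_cases)
    then show ?thesis using lst[of w] w d(2) by simp
  qed
  have "k / d \<in> \<int>" if k: "\<And>q. q \<in> \<int> \<Longrightarrow> k - q * d \<in> V" for k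
  proof -
    have "k - of_int \<lfloor>k / d\<rfloor> * d = frac (k / d) * d" using d(2) by (simp add: frac_def field_simps)
    then have "frac (k / d) * d \<in> V" using k[of "of_int \<lfloor>k / d\<rfloor>"] by simp
    moreover have "frac (k / d) * d < d" using frac_lt_1[of "k / d"] d(2) by simp
    ultimately have "\<not> frac (k / d) * d > 0" using least by (metis not_le)
    then have "frac (k / d) = 0" using frac_ge_0[of "k / d"] d(2) by (simp add: zero_less_mult_iff)
    then show ?thesis by (simp add: frac_eq_0_iff)
  qed
  then show ?thesis using that d by blast
qed

lemma integral_functional_generator:
  fixes \<phi> :: "'w::real_vector \<Rightarrow> real"
  assumes Q: "zmod.subspace Q" and lin: "linear \<phi>"
    and int: "\<And>a. a \<in> Q \<Longrightarrow> \<phi> a \<in> \<int>" and nz: "\<exists>a\<in>Q. \<phi> a \<noteq> 0"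
  obtains a where "a \<in> Q" "\<phi> a > 0" "\<And>c. c \<in> Q \<Longrightarrow> \<phi> c / \<phi> a \<in> \<int>"
proof -
  have neg: "- v \<in> \<phi> ` Q" if "v \<in> \<phi> ` Q" for v
    using that zsub_minus[OF Q] linear_neg[OF lin] by (metis (no_types, lifting) imageE imageI)
  obtain d where d: "d \<in> \<phi> ` Q" "d > 0"
    "\<And>k. k \<in> \<int> \<Longrightarrow> (\<And>q. q \<in> \<int> \<Longrightarrow> k - q * d \<in> \<phi> ` Q) \<Longrightarrow> k / d \<in> \<int>"
    using least_positive_value[of "\<phi> ` Q"] neg int nz by blast
  then obtain a where a: "a \<in> Q" "d = \<phi> a" by blast
  have "\<phi> c / \<phi> a \<in> \<int>" if c: "c \<in> Q" for c
  proof (rule d(3)[unfolded a(2), OF int[OF c]])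
    fix q :: real assume "q \<in> \<int>"
    then have "c - q *\<^sub>R a \<in> Q" using c a(1) by (intro zsub_intros Q)
    then show "\<phi> c - q * \<phi> a \<in> \<phi> ` Q"
      using linear_diff[OF lin] linear_scale[OF lin] by (metis imageI real_scaleR_def)
  qed
  then show ?thesis using that a d(2) by blast
qed

context symmetric_bilinear
begin

text \<open>The fourth hypothesis stands in for unimodularity: if \<open>d\<close> divides all
  pairings of \<open>z\<close> with \<open>Q\<close>, then \<open>z\<close> is divisible by
  \<open>d\<close> in \<open>P\<close>. Dividing a nonzero \<open>z\<close> by the generator of its
  pairings gives \<open>x0\<close> and \<open>a0\<close> with pairing 1. Both groups split off these
  vectors, and the dimension of the real span of \<open>P\<close> drops. This serves for
  \<open>L1\<close> against its dual and for a Lagrangian in a glued lattice.\<close>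

lemma dual_bases:
  fixes P Q :: "'w set"
  assumes "zmod.subspace P" "zmod.subspace Q"
    and "\<And>x a. x \<in> P \<Longrightarrow> a \<in> Q \<Longrightarrow> b a x \<in> \<int>"
    and "\<And>z d. z \<in> P \<Longrightarrow> d > 0 \<Longrightarrow> (\<And>a. a \<in> Q \<Longrightarrow> b a z / d \<in> \<int>) \<Longrightarrow> (1/d) *\<^sub>R z \<in> P"
    and "\<And>z. z \<in> P \<Longrightarrow> (\<And>a. a \<in> Q \<Longrightarrow> b a z = 0) \<Longrightarrow> z = 0"
  shows "\<exists>(r::nat) x a. (\<forall>i<r. x i \<in> P \<and> a i \<in> Q) \<and>
    (\<forall>i<r. \<forall>j<r. b (a i) (x j) = (if i = j then 1 else 0)) \<and>
    (\<forall>z\<in>P. z = (\<Sum>i<r. b (a i) z *\<^sub>R x i))"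
  using assms
proof (induction "dim P" arbitrary: P Q rule: less_induct)
  case less
  note P = less.prems(1) and Q = less.prems(2) and int = less.prems(3)
    and sat = less.prems(4) and nd = less.prems(5)
  show ?case
  proof (cases "P \<subseteq> {0}")
    case True
    then show ?thesis by (intro exI[of _ 0]) auto
  next
    case False
    then obtain z where z: "z \<in> P" "z \<noteq> 0" by blast
    then obtain a0 where a0: "a0 \<in> Q" "b a0 z > 0" and dv: "\<And>c. c \<in> Q \<Longrightarrow> b c z / b a0 z \<in> \<int>"
      using integral_functional_generator[OF Q linear_left[of z]] int nd by metis
    define x0 where "x0 = (1 / b a0 z) *\<^sub>R z"
    have x0: "x0 \<in> P" unfolding x0_def by (rule sat[OF z(1) a0(2) dv])
    have one: "b a0 x0 = 1" unfolding x0_def using a0 by simp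
    define P1 Q1 where "P1 = {x\<in>P. b a0 x = 0}" and "Q1 = {a\<in>Q. b a x0 = 0}"
    have P1: "zmod.subspace P1" unfolding P1_def by (rule zsubI) (auto intro: P zsub_intros)
    have Q1: "zmod.subspace Q1" unfolding Q1_def by (rule zsubI) (auto intro: Q zsub_intros)
    have redQ: "a - b a x0 *\<^sub>R a0 \<in> Q1" if "a \<in> Q" for a
      unfolding Q1_def using that a0 one int[OF x0] by (auto intro!: zsub_intros Q)
    have redP: "z - b a0 z *\<^sub>R x0 \<in> P1" if "z \<in> P" for z
      unfolding P1_def using that x0 one int[OF _ a0(1)] by (auto intro!: zsub_intros P)
    have "dim P1 < dim P"
    proof -
      have "P1 \<subseteq> {x. b a0 x = 0}" by (auto simp: P1_def)
      moreover have "subspace {x. b a0 x = 0}" by (auto simp: subspace_def)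
      ultimately have "span P1 \<subseteq> {x. b a0 x = 0}" by (rule span_minimal)
      then have "x0 \<notin> span P1" using one by auto
      moreover have "span P1 \<subseteq> span P" "x0 \<in> span P"
        using x0 span_mono[of P1 P] by (auto simp: P1_def intro: span_base)
      ultimately show ?thesis by (intro dim_psubset) auto
    qed
    \<comment> \<open>Elements of \<open>P1\<close> are orthogonal to \<open>a0\<close>, so their
      pairings with \<open>a\<close> and with its reduction in \<open>Q1\<close> agree, and the
      hypotheses pass to the smaller pair.\<close>
    moreover have "(1/d) *\<^sub>R z \<in> P1" if zd: "z \<in> P1" "d > 0" "\<And>a. a \<in> Q1 \<Longrightarrow> b a z / d \<in> \<int>" for z d
    proof -
      have "b a z / d \<in> \<int>" if "a \<in> Q" for a
        using zd(3)[OF redQ[OF that]] zd(1) by (simp add: P1_def)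
      then show ?thesis using sat[of z d] zd by (auto simp: P1_def)
    qed
    moreover have "z = 0" if zd: "z \<in> P1" "\<And>a. a \<in> Q1 \<Longrightarrow> b a z = 0" for z
    proof -
      have "b a z = 0" if "a \<in> Q" for a
        using zd(2)[OF redQ[OF that]] zd(1) by (simp add: P1_def)
      then show ?thesis using nd[of z] zd by (auto simp: P1_def)
    qed
    ultimately obtain r x a where IH: "\<forall>i<r. x i \<in> P1 \<and> a i \<in> Q1"
      "\<forall>i<r. \<forall>j<r. b (a i) (x j) = (if i = j then 1 else 0)"
      "\<forall>z\<in>P1. z = (\<Sum>i<(r::nat). b (a i) z *\<^sub>R x i)"
      using less.hyps[of P1 Q1] P1 Q1 int unfolding P1_def Q1_def by auto
    define x' a' where "x' i = (if i = r then x0 else x i)" and "a' i = (if i = r then a0 else a i)" for i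
    have "\<forall>i<Suc r. x' i \<in> P \<and> a' i \<in> Q"
      using IH(1) x0 a0 by (auto simp: x'_def a'_def less_Suc_eq P1_def Q1_def)
    moreover have "\<forall>i<Suc r. \<forall>j<Suc r. b (a' i) (x' j) = (if i = j then 1 else 0)"
      using IH(1,2) one by (auto simp: x'_def a'_def less_Suc_eq P1_def Q1_def)
    moreover have "z = (\<Sum>i<Suc r. b (a' i) z *\<^sub>R x' i)" if "z \<in> P" for z
    proof -
      have "z - b a0 z *\<^sub>R x0 = (\<Sum>i<r. b (a i) (z - b a0 z *\<^sub>R x0) *\<^sub>R x i)"
        using IH(3) redP[OF that] by blast
      also have "\<dots> = (\<Sum>i<r. b (a' i) z *\<^sub>R x' i)"
        using IH(1) by (intro sum.cong) (auto simp: x'_def a'_def Q1_def)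
      finally show ?thesis by (simp add: x'_def a'_def algebra_simps)
    qed
    ultimately show ?thesis by blast
  qed
qed

text \<open>Both numbers are the trace of the identity.\<close>

lemma dual_bases_card:
  fixes m r :: nat
  assumes "\<And>i j. i < m \<Longrightarrow> j < m \<Longrightarrow> b (a i) (x j) = (if i = j then 1 else 0)"
    and "\<And>i j. i < r \<Longrightarrow> j < r \<Longrightarrow> b (c i) (y j) = (if i = j then 1 else 0)"
    and x: "\<And>i. i < m \<Longrightarrow> x i = (\<Sum>k<r. b (c k) (x i) *\<^sub>R y k)"
    and y: "\<And>k. k < r \<Longrightarrow> y k = (\<Sum>i<m. b (a i) (y k) *\<^sub>R x i)"
  shows "m = r"
proof -
  have "real m = (\<Sum>i<m. b (a i) (x i))" using assms(1) by simp
  also have "\<dots> = (\<Sum>i<m. \<Sum>k<r. b (c k) (x i) * b (a i) (y k))"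
  proof (rule sum.cong[OF refl])
    fix i assume "i \<in> {..<m}"
    then have "b (a i) (x i) = b (a i) (\<Sum>k<r. b (c k) (x i) *\<^sub>R y k)" using x by (metis lessThan_iff)
    then show "b (a i) (x i) = (\<Sum>k<r. b (c k) (x i) * b (a i) (y k))" by (simp add: form_sum)
  qed
  also have "\<dots> = (\<Sum>k<r. \<Sum>i<m. b (a i) (y k) * b (c k) (x i))"
    by (subst sum.swap) (simp add: mult.commute)
  also have "\<dots> = (\<Sum>k<r. b (c k) (y k))"
  proof (rule sum.cong[OF refl])
    fix k assume "k \<in> {..<r}"
    then have "b (c k) (y k) = b (c k) (\<Sum>i<m. b (a i) (y k) *\<^sub>R x i)" using y by (metis lessThan_iff)
    then show "(\<Sum>i<m. b (a i) (y k) * b (c k) (x i)) = b (c k) (y k)" by (simp add: form_sum)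
  qed
  also have "\<dots> = real r" using assms(2) by simp
  finally show ?thesis by simp
qed

end

section \<open>Eichler transformations\<close>

context symmetric_bilinear
begin

text \<open>The Eichler transvection of an isotropic \<open>u\<close> and a vector \<open>a\<close>
  orthogonal to \<open>u\<close>. The coefficient \<open>b a a / 2\<close> makes it an isometry, and
  evenness makes this coefficient integral.\<close>

definition eichler :: "'w \<Rightarrow> 'w \<Rightarrow> 'w \<Rightarrow> 'w" where
  "eichler u a x = x - b a x *\<^sub>R u + b u x *\<^sub>R a - (b a a / 2 * b u x) *\<^sub>R u"

lemma linear_eichler: "linear (eichler u a)"
  by (rule linearI) (simp_all add: eichler_def algebra_simps add_divide_distrib)

lemma eichler_isometry:
  assumes "b u u = 0" "b u a = 0"
  shows "b (eichler u a x) (eichler u a y) = b x y"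
  using assms sym[of a u] sym[of x u] sym[of x a] sym[of y u] sym[of y a]
  by (simp add: eichler_def algebra_simps)

lemma eichler_inverse:
  assumes "b u u = 0" "b u a = 0"
  shows "eichler u (- a) (eichler u a x) = x"
  using assms sym[of a u] by (simp add: eichler_def algebra_simps flip: scaleR_add_left)

text \<open>Bijectivity is required explicitly because \<open>b\<close> is not assumed to be
  nondegenerate.\<close>

definition lattice_isometries :: "'w set \<Rightarrow> 'w set \<Rightarrow> ('w \<Rightarrow> 'w) set" where
  "lattice_isometries \<Lambda> X =
    {g. linear g \<and> bij g \<and> (\<forall>x y. b (g x) (g y) = b x y) \<and> g ` \<Lambda> = \<Lambda> \<and> (\<forall>x\<in>X. g x = x)}"

lemma lattice_isometries_id: "id \<in> lattice_isometries \<Lambda> X"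
  by (simp add: lattice_isometries_def linear_id)

lemma lattice_isometries_comp:
  "g \<in> lattice_isometries \<Lambda> X \<Longrightarrow> h \<in> lattice_isometries \<Lambda> X \<Longrightarrow> g \<circ> h \<in> lattice_isometries \<Lambda> X"
  unfolding lattice_isometries_def mem_Collect_eq image_comp[symmetric]
  by (simp add: linear_compose bij_comp)

lemma lattice_isometries_inv:
  assumes "g \<in> lattice_isometries \<Lambda> X"
  shows "inv_into UNIV g \<in> lattice_isometries \<Lambda> X"
proof -
  have g: "linear g" "bij g" "\<And>x y. b (g x) (g y) = b x y" "g ` \<Lambda> = \<Lambda>" "\<And>x. x \<in> X \<Longrightarrow> g x = x"
    using assms by (auto simp: lattice_isometries_def)
  have gi: "g (inv_into UNIV g x) = x" "inv_into UNIV g (g x) = x" for x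
    using g(2) by (simp_all add: bij_is_surj surj_f_inv_f bij_is_inj)
  have "b (inv_into UNIV g x) (inv_into UNIV g y) = b x y" for x y using g(3)[of "inv_into UNIV g x" "inv_into UNIV g y"] gi by simp
  moreover have "inv_into UNIV g ` \<Lambda> = \<Lambda>"
    by (metis g(2,4) bij_is_inj image_inv_f_f)
  moreover have "inv_into UNIV g x = x" if "x \<in> X" for x using g(5)[OF that] gi(2)[of x] by simp
  moreover have "linear (inv_into UNIV g)" using g by (simp add: bij_is_inj bij_is_surj inj_linear_imp_inv_linear)
  ultimately show ?thesis using g(2) by (simp add: lattice_isometries_def bij_imp_bij_inv)
qed

end

text \<open>The group is not asked to span the space: a glued lattice lies in a proper subspace of
  \<open>'a \<times> 'a\<close>, its second components being orthogonal to a hyperbolic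
  plane.\<close>

locale even_group = symmetric_bilinear b for b :: "'w::euclidean_space \<Rightarrow> 'w \<Rightarrow> real" +
  fixes \<Lambda> :: "'w set"
  assumes group: "zmod.subspace \<Lambda>" and even: "even_on b \<Lambda>"
begin

lemma integral: "x \<in> \<Lambda> \<Longrightarrow> y \<in> \<Lambda> \<Longrightarrow> b x y \<in> \<int>" and half_integral: "x \<in> \<Lambda> \<Longrightarrow> b x x / 2 \<in> \<int>"
  using even by (auto simp: even_on_def)

definition perp_in :: "'w set \<Rightarrow> 'w set" where
  "perp_in X = {x\<in>\<Lambda>. \<forall>y\<in>X. b x y = 0}"

lemma perp_inD: "x \<in> perp_in X \<Longrightarrow> x \<in> \<Lambda>" "x \<in> perp_in X \<Longrightarrow> y \<in> X \<Longrightarrow> b x y = 0"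
  by (auto simp: perp_in_def)

lemma subspace_perp_in: "zmod.subspace (perp_in X)"
  unfolding perp_in_def by (rule zsubI) (auto intro: zsub_intros group)

lemma perp_in_scale: "x \<in> perp_in X \<Longrightarrow> c \<in> \<int> \<Longrightarrow> c *\<^sub>R x \<in> perp_in X"
  by (rule zsub_scale[OF subspace_perp_in])

lemma eichler_in_lattice:
  assumes "u \<in> \<Lambda>" "a \<in> \<Lambda>" "x \<in> \<Lambda>"
  shows "eichler u a x \<in> \<Lambda>"
  unfolding eichler_def using assms
  by (intro zsub_intros group Ints_mult integral half_integral)

lemma eichler_lattice_isometry:
  assumes "u \<in> perp_in X" "a \<in> perp_in X" "b u u = 0" "b u a = 0"
  shows "eichler u a \<in> lattice_isometries \<Lambda> X"
proof -
  have inv: "eichler u (- a) (eichler u a x) = x" "eichler u a (eichler u (- a) x) = x" for x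
    using eichler_inverse[of u a x] eichler_inverse[of u "-a" x] assms by auto
  have "bij (eichler u a)" by (rule o_bij[of "eichler u (-a)"]) (auto simp: fun_eq_iff inv)
  moreover have "eichler u a ` \<Lambda> = \<Lambda>"
  proof
    show "eichler u a ` \<Lambda> \<subseteq> \<Lambda>" using assms by (auto intro: eichler_in_lattice perp_inD)
    show "\<Lambda> \<subseteq> eichler u a ` \<Lambda>"
    proof
      fix x assume "x \<in> \<Lambda>"
      then have "eichler u (- a) x \<in> \<Lambda>"
        using assms by (intro eichler_in_lattice zsub_minus group) (auto dest: perp_inD)
      then show "x \<in> eichler u a ` \<Lambda>" using inv(2)[of x] by (metis imageI)
    qed
  qed
  moreover have "eichler u a x = x" if "x \<in> X" for x
    using perp_inD(2)[OF assms(1) that] perp_inD(2)[OF assms(2) that] by (simp add: eichler_def)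
  ultimately show ?thesis
    using linear_eichler eichler_isometry[OF assms(3,4)] by (simp add: lattice_isometries_def)
qed

definition orbit :: "'w set \<Rightarrow> 'w \<Rightarrow> 'w set" where
  "orbit X v = (\<lambda>g. g v) ` lattice_isometries \<Lambda> X"

lemma orbit_refl: "v \<in> orbit X v"
  unfolding orbit_def by (rule image_eqI[OF _ lattice_isometries_id]) simp

lemma orbit_trans: "w \<in> orbit X v \<Longrightarrow> z \<in> orbit X w \<Longrightarrow> z \<in> orbit X v"
  unfolding orbit_def using lattice_isometries_comp by (force simp: image_iff Bex_def)

lemma orbit_eichler:
  assumes "w \<in> orbit X v" "u \<in> perp_in X" "a \<in> perp_in X" "b u u = 0" "b u a = 0"
  shows "eichler u a w \<in> orbit X v"
  using eichler_lattice_isometry[OF assms(2-5)] assms(1)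
  by (intro orbit_trans[OF assms(1)]) (auto simp: orbit_def)

lemma orbit_in_lattice: "v \<in> \<Lambda> \<Longrightarrow> w \<in> orbit X v \<Longrightarrow> w \<in> \<Lambda>"
  by (auto simp: orbit_def lattice_isometries_def)

lemma orbit_form: "w \<in> orbit X v \<Longrightarrow> x \<in> X \<Longrightarrow> b w x = b v x" "w \<in> orbit X v \<Longrightarrow> b w w = b v v"
  by (auto simp: orbit_def lattice_isometries_def) metis

text \<open>
  By the Euclidean algorithm a nonzero pairing of \<open>f\<close> with the orbit of \<open>v\<close> that has least modulus
  divides all pairings of the orbit with \<open>perp_in X\<close>, hence is a unit.
\<close>

lemma least_pairing_dvd:
  assumes hyp: "e \<in> perp_in X" "f \<in> perp_in X" "g \<in> perp_in X" "h \<in> perp_in X"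
    "b f f = 0" "b h h = 0" "b e f = 1" "b g h = 1" "b g f = 0" "b h f = 0" "b e h = 0"
    and w: "w \<in> orbit X v" "b f w \<noteq> 0"
    and least: "\<And>z. z \<in> orbit X v \<Longrightarrow> b f z \<noteq> 0 \<Longrightarrow> \<bar>b f w\<bar> \<le> \<bar>b f z\<bar>"
  shows "b h w / b f w \<in> \<int>"
proof (rule ccontr)
  assume no: "b h w / b f w \<notin> \<int>"
  note symh = sym[of f e] sym[of h g] sym[of f g] sym[of f h] sym[of h e]
  define D k where "D = b f w" and "k = real_of_int \<lfloor>b h w / D\<rfloor>"
  \<comment> \<open>Since \<open>f\<close> is orthogonal to itself and to \<open>g\<close>, this
    move keeps the pairing \<open>D\<close> with \<open>f\<close>, while the pairing with
    \<open>h\<close> is reduced to its remainder \<open>r\<close> modulo \<open>D\<close>.\<close>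
  define w1 where "w1 = eichler f (- k *\<^sub>R g) w"
  define r where "r = b h w - k * D"
  have w1: "w1 \<in> orbit X v"
    unfolding w1_def k_def using hyp symh by (intro orbit_eichler w perp_in_scale) auto
  have w1v: "b f w1 = D" "b h w1 = r"
    using hyp symh by (simp_all add: w1_def eichler_def D_def r_def)
  have "r / D = b h w / D - k" using w(2) by (simp add: r_def D_def field_simps)
  then have "0 \<le> r / D" "r / D < 1" "r / D \<noteq> 0"
    using no frac_lt_1[of "b h w / D"] frac_eq_0_iff[of "b h w / D"]
    by (simp_all only: k_def D_def frac_def) simp_all
  then have "\<bar>r / D\<bar> < 1" and "r \<noteq> 0" and "D \<noteq> 0" by (linarith, auto)
  from this(1) have "\<bar>r\<bar> / \<bar>D\<bar> < 1" by (simp only: abs_divide)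
  with \<open>D \<noteq> 0\<close> \<open>r \<noteq> 0\<close> have r: "\<bar>r\<bar> < \<bar>D\<bar>" "r \<noteq> 0" by (simp_all add: divide_less_eq)
  \<comment> \<open>The roles are swapped: multiples of the remainder \<open>r\<close> are now added
    to \<open>D\<close>, and minimality bounds every nonzero result from below.\<close>
  have step: "\<bar>D\<bar> \<le> \<bar>D + j * r\<bar>" if "j \<in> \<int>" "D + j * r \<noteq> 0" for j
  proof -
    have "eichler h (j *\<^sub>R e) w1 \<in> orbit X v"
      using hyp symh that by (intro orbit_eichler w1 perp_in_scale) auto
    moreover have "b f (eichler h (j *\<^sub>R e) w1) = D + j * r"
      using hyp symh by (simp add: eichler_def w1v)
    ultimately show ?thesis using least that by (metis D_def)
  qed
  define j where "j = - real_of_int \<lfloor>D / r\<rfloor>"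
  have j: "j \<in> \<int>" by (simp add: j_def)
  have "D + j * r = (D / r - of_int \<lfloor>D / r\<rfloor>) * r" using r by (simp add: j_def field_simps)
  then have "\<bar>D + j * r\<bar> = frac (D / r) * \<bar>r\<bar>" by (simp add: abs_mult frac_def)
  also have "\<dots> < 1 * \<bar>r\<bar>" using r by (intro mult_strict_right_mono frac_lt_1) auto
  finally have "D + j * r = 0" using step[OF j] r(1) by force
  \<comment> \<open>The multiple \<open>j\<close> annihilates the pairing with \<open>f\<close>, so
    \<open>j + 1\<close> leaves \<open>r\<close> there, which is nonzero and smaller than
    \<open>D\<close> in modulus.\<close>
  then have "D + (j + 1) * r = r" by (simp add: algebra_simps)
  then show False using step[of "j + 1"] j r by auto
qed

lemma orbit_pairing_one:
  assumes hyp: "e \<in> perp_in X" "f \<in> perp_in X" "e2 \<in> perp_in X" "f2 \<in> perp_in X"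
    "b e e = 0" "b f f = 0" "b e2 e2 = 0" "b f2 f2 = 0" "b e f = 1" "b e2 f2 = 1"
    "b e e2 = 0" "b e f2 = 0" "b f e2 = 0" "b f f2 = 0"
    and v: "v \<in> \<Lambda>" and c: "c \<in> perp_in X" "b c v = 1"
  shows "\<exists>w\<in>orbit X v. b f w = 1"
proof -
  note symh = sym[of f e] sym[of f2 e2] sym[of e2 e] sym[of f2 e] sym[of e2 f] sym[of f2 f]
  have int: "b x w \<in> \<int>" if "w \<in> orbit X v" "x \<in> perp_in X" for x w
    using integral orbit_in_lattice[OF v that(1)] perp_inD(1)[OF that(2)] by blast
  have fe2: "eichler f (k *\<^sub>R e2) w \<in> orbit X v"
    and ff2: "eichler f (k *\<^sub>R f2) w \<in> orbit X v"
    and f2e: "eichler f2 (k *\<^sub>R e) w \<in> orbit X v"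
    and e2e: "eichler e2 (k *\<^sub>R e) w \<in> orbit X v" if "w \<in> orbit X v" "k \<in> \<int>" for w k
    using hyp symh that by (auto intro!: orbit_eichler perp_in_scale)
  have fa: "eichler f a w \<in> orbit X v" if "w \<in> orbit X v" "a \<in> perp_in X" "b f a = 0" for w a
    using hyp that by (auto intro!: orbit_eichler)
  have sim: "b f (eichler f (k *\<^sub>R e2) w) = b f w"
    "b f2 (eichler f (k *\<^sub>R e2) w) = b f2 w + k * b f w"
    "b f (eichler f (k *\<^sub>R f2) w) = b f w"
    "b e2 (eichler f (k *\<^sub>R f2) w) = b e2 w + k * b f w"
    "b f2 (eichler f (k *\<^sub>R f2) w) = b f2 w"
    "b e (eichler f (k *\<^sub>R f2) w) = b e w - k * b f2 w"
    "b f (eichler f2 (k *\<^sub>R e) w) = b f w + k * b f2 w"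
    "b f (eichler e2 (k *\<^sub>R e) w) = b f w + k * b e2 w"
    "b f2 (eichler e2 (k *\<^sub>R e) w) = b f2 w - k * b e w" for k w
    using hyp symh by (simp_all add: eichler_def)
  have simfa: "b e (eichler f a w) = b e w - b a w + b f w * b e a - b a a / 2 * b f w"
    if "b f a = 0" for a w
    using hyp symh that by (simp add: eichler_def)
  have split: "a - b a f *\<^sub>R e \<in> perp_in X" "b f (a - b a f *\<^sub>R e) = 0" if "a \<in> perp_in X" for a
  proof -
    have "b a f \<in> \<int>" using that hyp by (auto intro!: integral dest: perp_inD)
    then show "a - b a f *\<^sub>R e \<in> perp_in X" using that hyp by (intro zsub_intros subspace_perp_in)
    show "b f (a - b a f *\<^sub>R e) = 0" using symh hyp sym[of a f] by simp
  qed
  \<comment> \<open>If \<open>f\<close> pairs to 0 with the whole orbit, then comparing vectors with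
    their Eichler images gives the same for \<open>f2\<close>, then for \<open>e\<close>, and
    finally that \<open>v\<close> is orthogonal to all of \<open>perp_in X\<close>, against
    \<open>c\<close>.\<close>
  have "\<exists>w\<in>orbit X v. b f w \<noteq> 0"
  proof (rule ccontr)
    assume "\<not> ?thesis"
    then have z: "b f w = 0" if "w \<in> orbit X v" for w using that by blast
    have zf2: "b f2 w = 0" if "w \<in> orbit X v" for w
      using z[OF f2e[OF that, of 1]] z[OF that] sim(7)[of 1 w] by simp
    have ze: "b e w = 0" if "w \<in> orbit X v" for w
      using zf2[OF e2e[OF that, of 1]] zf2[OF that] sim(9)[of 1 w] by simp
    have "b a v = 0" if "a \<in> perp_in X" "b f a = 0" for a
      using ze[OF fa[OF orbit_refl that]] ze[OF orbit_refl] z[OF orbit_refl] simfa[OF that(2), of v]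
      by simp
    from this[OF split[OF c(1)]] have "b c v = 0" using ze[OF orbit_refl] by simp
    then show False using c by simp
  qed
  then obtain w where w: "w \<in> orbit X v" "b f w \<noteq> 0"
    and lst: "\<And>z. z \<in> orbit X v \<Longrightarrow> b f z \<noteq> 0 \<Longrightarrow> nat \<lfloor>\<bar>b f w\<bar>\<rfloor> \<le> nat \<lfloor>\<bar>b f z\<bar>\<rfloor>"
    using ex_has_least_nat[of "\<lambda>w. w \<in> orbit X v \<and> b f w \<noteq> 0" _ "\<lambda>w. nat \<lfloor>\<bar>b f w\<bar>\<rfloor>"] by blast
  have least: "\<bar>b f w\<bar> \<le> \<bar>b f z\<bar>" if z: "z \<in> orbit X v" "b f z \<noteq> 0" for z
  proof -
    obtain k l where "b f w = of_int k" "b f z = of_int l"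
      using int[OF w(1) hyp(2)] int[OF z(1) hyp(2)] by (auto elim!: Ints_cases)
    then show ?thesis using lst[OF z] by (simp flip: of_int_abs)
  qed
  define D where "D = b f w"
  have dv: "b f2 z / D \<in> \<int>" "b e2 z / D \<in> \<int>" if "z \<in> orbit X v" "b f z = D" for z
    using least_pairing_dvd[of e X f e2 f2 z v] least_pairing_dvd[of e X f f2 e2 z v]
      that w least hyp symh unfolding D_def by auto
  \<comment> \<open>As \<open>e\<close> is not orthogonal to \<open>f\<close>,
    \<open>least_pairing_dvd\<close> does not apply to it directly. Once the pairing with
    \<open>e2\<close> is cleared, the move along \<open>e2\<close> by \<open>e\<close> keeps
    \<open>D\<close> and subtracts the pairing with \<open>e\<close> from the one with
    \<open>f2\<close>, where divisibility is known.\<close>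
  have dve: "b e z / D \<in> \<int>" if z: "z \<in> orbit X v" "b f z = D" for z
  proof -
    define k where "k = - (b e2 z / D)"
    have k: "k \<in> \<int>" using dv[OF z] by (simp add: k_def)
    define z1 where "z1 = eichler f (k *\<^sub>R f2) z"
    define z2 where "z2 = eichler e2 (1 *\<^sub>R e) z1"
    have z1: "z1 \<in> orbit X v" "b f z1 = D" "b e2 z1 = 0" "b e z1 = b e z - k * b f2 z"
      using w by (simp_all add: z1_def ff2 z k sim) (simp add: k_def D_def)
    have z2: "z2 \<in> orbit X v" "b f z2 = D" "b f2 z2 = b f2 z1 - b e z1"
      unfolding z2_def by (rule e2e[OF z1(1)], simp) (simp_all only: sim z1, simp_all)
    have "b e z / D = b f2 z1 / D - b f2 z2 / D + k * (b f2 z / D)"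
      using z1(4) z2(3) w by (simp add: D_def field_simps)
    then show ?thesis
      using dv(1)[OF z] dv(1)[OF z1(1,2)] dv(1)[OF z2(1,2)] k by (auto simp del: times_divide_eq_right)
  qed
  \<comment> \<open>The move along \<open>f\<close> by \<open>a\<close> keeps \<open>D\<close> and
    subtracts \<open>b a w\<close> from the pairing with \<open>e\<close>, up to integral multiples
    of \<open>D\<close>.\<close>
  have dva: "b a w / D \<in> \<int>" if a: "a \<in> perp_in X" "b f a = 0" for a
  proof -
    have "b f (eichler f a w) = D" using a hyp by (simp add: eichler_def D_def)
    then have "b e (eichler f a w) / D \<in> \<int>" by (intro dve fa w a)
    moreover have "b e (eichler f a w) / D = b e w / D - b a w / D + b e a - b a a / 2"
      using w by (simp add: simfa[OF a(2)] D_def field_simps)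
    moreover have "b e w / D \<in> \<int>" by (intro dve w) (simp add: D_def)
    moreover have "b e a \<in> \<int>" "b a a / 2 \<in> \<int>"
      using a hyp by (auto intro!: integral half_integral dest: perp_inD)
    ultimately have "b e w / D + b e a - b a a / 2 - b e (eichler f a w) / D \<in> \<int>"
      "b e w / D + b e a - b a a / 2 - b e (eichler f a w) / D = b a w / D"
      by (auto intro!: Ints_diff Ints_add)
    then show ?thesis by simp
  qed
  have dall: "b a w / D \<in> \<int>" if a: "a \<in> perp_in X" for a
  proof -
    have "b a w / D = b (a - b a f *\<^sub>R e) w / D + b a f * (b e w / D)"
      using w by (simp add: D_def field_simps)
    moreover have "b e w / D \<in> \<int>" by (intro dve w) (simp add: D_def)
    moreover have "b a f \<in> \<int>" using a hyp by (auto intro!: integral dest: perp_inD)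
    ultimately show ?thesis using dva[OF split[OF a]]
      by (auto simp del: times_divide_eq_right)
  qed
  obtain g where g: "g \<in> lattice_isometries \<Lambda> X" "w = g v" using w by (auto simp: orbit_def)
  \<comment> \<open>Moving \<open>c\<close> along with \<open>v\<close> gives a vector of
    \<open>perp_in X\<close> that pairs to 1 with \<open>w\<close>, so \<open>D\<close> divides
    1.\<close>
  have "g c \<in> perp_in X" using c g unfolding perp_in_def lattice_isometries_def by auto metis
  moreover have "b (g c) w = 1" using g c by (auto simp: lattice_isometries_def)
  ultimately have "1 / D \<in> \<int>" using dall by metis
  moreover have "D \<in> \<int>" using int[OF w(1) hyp(2)] by (simp add: D_def)
  ultimately have "D = 1 \<or> D = - 1"
  proof -
    obtain k l where kl: "D = of_int k" "1 / D = of_int l" using \<open>1 / D \<in> \<int>\<close> \<open>D \<in> \<int>\<close>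
      by (auto elim!: Ints_cases)
    then have "real_of_int (k * l) = 1" using w by (simp add: D_def field_simps)
    then have "k * l = 1" by linarith
    then show ?thesis using kl zmult_eq_1_iff[of k l] by auto
  qed
  then show ?thesis
  proof
    assume "D = 1"
    then show ?thesis using w D_def by auto
  next
    assume D: "D = - 1"
    \<comment> \<open>The sign is repaired through the second plane: the pairing with
      \<open>f2\<close> is first made 1, and then twice it is added to -1.\<close>
    define w1 where "w1 = eichler f ((b f2 w - 1) *\<^sub>R e2) w"
    have w1: "w1 \<in> orbit X v" unfolding w1_def by (intro fe2 w Ints_diff int hyp) auto
    have "b f w1 = - 1" "b f2 w1 = 1" using D by (simp_all add: w1_def sim D_def)
    then have "b f (eichler f2 (2 *\<^sub>R e) w1) = 1" by (simp only: sim)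
    then show ?thesis using f2e[OF w1, of 2] by auto
  qed
qed

text \<open>Once the orbit contains \<open>w\<close> with \<open>b f w = 1\<close>, as holds for
  \<open>t\<close>, the difference \<open>t - w\<close> is orthogonal to \<open>f\<close> and to
  \<open>X\<close>. Up to a multiple of \<open>f\<close> it is the parameter of a transformation
  along \<open>f\<close> that carries \<open>w\<close> to \<open>t\<close>. The second hyperbolic
  plane is spent on reaching such a \<open>w\<close>.\<close>

lemma eichler_transitive:
  assumes hyp: "e \<in> perp_in X" "f \<in> perp_in X" "e2 \<in> perp_in X" "f2 \<in> perp_in X"
    "b e e = 0" "b f f = 0" "b e2 e2 = 0" "b f2 f2 = 0" "b e f = 1" "b e2 f2 = 1"
    "b e e2 = 0" "b e f2 = 0" "b f e2 = 0" "b f f2 = 0"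
    and v: "v \<in> \<Lambda>" and c: "c \<in> perp_in X" "b c v = 1"
    and t: "t \<in> \<Lambda>" "b f t = 1" "b t t = b v v" "\<And>x. x \<in> X \<Longrightarrow> b t x = b v x"
  shows "t \<in> orbit X v"
proof -
  obtain w where w: "w \<in> orbit X v" "b f w = 1"
    using orbit_pairing_one[OF hyp v c] by blast
  have wL: "w \<in> \<Lambda>" using orbit_in_lattice[OF v w(1)] .
  define a where "a = t - w - b (t - w) e *\<^sub>R f"
  have tw: "t - w \<in> perp_in X"
    using t wL orbit_form(1)[OF w(1)] by (auto simp: perp_in_def intro!: zsub_intros group)
  moreover have "b (t - w) e \<in> \<int>"
    using t wL hyp by (intro integral zsub_intros group) (auto dest: perp_inD)
  ultimately have a: "a \<in> perp_in X"
    unfolding a_def using hyp tw by (auto intro: zsub_diff[OF subspace_perp_in] perp_in_scale)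
  have fa: "b f a = 0" using hyp w t by (simp add: a_def)
  have z: "eichler f a w \<in> orbit X v" by (intro orbit_eichler w hyp a fa)
  define k where "k = - b (t - w) e - b a w - b a a / 2"
  have eq: "eichler f a w = t + k *\<^sub>R f"
    using w by (simp add: eichler_def k_def algebra_simps) (simp add: a_def algebra_simps)
  \<comment> \<open>The image can differ from \<open>t\<close> only by \<open>k\<close> times
    \<open>f\<close>, which changes the norm by \<open>2 * k\<close>; equal norms force
    \<open>k = 0\<close>.\<close>
  have "b (t + k *\<^sub>R f) (t + k *\<^sub>R f) = b t t"
    using orbit_form(2)[OF z] t eq by simp
  then have "k = 0" using hyp t sym[of t f] by simp
  then show ?thesis using z eq by simp
qed

end

section \<open>Hyperbolic bases\<close>

context even_group
begin

definition hyperbolic_basis :: "nat \<Rightarrow> (nat \<Rightarrow> 'w) \<Rightarrow> (nat \<Rightarrow> 'w) \<Rightarrow> bool" where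
  "hyperbolic_basis m e f \<longleftrightarrow>
    (\<forall>i<m. e i \<in> \<Lambda> \<and> f i \<in> \<Lambda>) \<and>
    (\<forall>i<m. \<forall>j<m. b (e i) (e j) = 0 \<and> b (f i) (f j) = 0 \<and> b (e i) (f j) = (if i = j then 1 else 0)) \<and>
    (\<forall>z\<in>\<Lambda>. z = (\<Sum>i<m. b z (f i) *\<^sub>R e i + b z (e i) *\<^sub>R f i))"

lemma hyperbolic_basisD:
  assumes "hyperbolic_basis m e f" "i < m"
  shows "e i \<in> \<Lambda>" "f i \<in> \<Lambda>"
    "j < m \<Longrightarrow> b (e i) (e j) = 0" "j < m \<Longrightarrow> b (f i) (f j) = 0"
    "j < m \<Longrightarrow> b (e i) (f j) = (if i = j then 1 else 0)"
    "j < m \<Longrightarrow> b (f i) (e j) = (if i = j then 1 else 0)"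
proof -
  show "e i \<in> \<Lambda>" "f i \<in> \<Lambda>" "j < m \<Longrightarrow> b (e i) (e j) = 0" "j < m \<Longrightarrow> b (f i) (f j) = 0"
    "j < m \<Longrightarrow> b (e i) (f j) = (if i = j then 1 else 0)"
    using assms unfolding hyperbolic_basis_def by blast+
  show "b (f i) (e j) = (if i = j then 1 else 0)" if "j < m"
  proof -
    have "b (e j) (f i) = (if j = i then 1 else 0)"
      using assms that unfolding hyperbolic_basis_def by blast
    then show ?thesis by (simp add: sym[of "f i"] eq_commute)
  qed
qed

lemma hyperbolic_basis_expand:
  "hyperbolic_basis m e f \<Longrightarrow> z \<in> \<Lambda> \<Longrightarrow> z = (\<Sum>i<m. b z (f i) *\<^sub>R e i + b z (e i) *\<^sub>R f i)"
  unfolding hyperbolic_basis_def by blast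

lemma hyperbolic_basis_image:
  assumes h: "hyperbolic_basis m e f" and g: "g \<in> lattice_isometries \<Lambda> X"
  shows "hyperbolic_basis m (g \<circ> e) (g \<circ> f)"
proof -
  have g': "linear g" "\<And>x y. b (g x) (g y) = b x y" "g ` \<Lambda> = \<Lambda>"
    using g by (auto simp: lattice_isometries_def)
  have exp: "z = (\<Sum>i<m. b z (g (f i)) *\<^sub>R g (e i) + b z (g (e i)) *\<^sub>R g (f i))" if "z \<in> \<Lambda>" for z
  proof -
    have "z \<in> g ` \<Lambda>" using that by (simp only: g'(3))
    then obtain y where y: "z = g y" "y \<in> \<Lambda>" by (rule imageE)
    have "g y = g (\<Sum>i<m. b y (f i) *\<^sub>R e i + b y (e i) *\<^sub>R f i)"
      by (rule arg_cong[OF hyperbolic_basis_expand[OF h y(2)], of g])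
    also have "\<dots> = (\<Sum>i<m. b y (f i) *\<^sub>R g (e i) + b y (e i) *\<^sub>R g (f i))"
      by (simp add: linear_sum[OF g'(1)] linear_add[OF g'(1)] linear_scale[OF g'(1)])
    finally show ?thesis unfolding y(1) g'(2) .
  qed
  have "g x \<in> \<Lambda>" if "x \<in> \<Lambda>" for x using imageI[OF that, of g] by (simp only: g'(3))
  then show ?thesis
    unfolding hyperbolic_basis_def comp_apply
    by (intro conjI allI impI ballI)
      ((simp only: hyperbolic_basisD[OF h] g'(2); fail)+, erule exp)
qed

text \<open>Unimodularity enters through \<open>max\<close> and \<open>sat\<close>. They yield a
  basis \<open>f\<close> of \<open>I\<close> with dual vectors \<open>a\<close>, whose mutual
  pairings are cleared by subtracting elements of \<open>I\<close>. As \<open>I\<close> is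
  isotropic, this does not disturb the pairings with \<open>f\<close>; evenness allows half a norm
  to be subtracted.\<close>

lemma lagrangian_hyperbolic_basis:
  assumes I: "I \<subseteq> \<Lambda>" "zmod.subspace I" and iso: "\<And>x y. x \<in> I \<Longrightarrow> y \<in> I \<Longrightarrow> b x y = 0"
    and max: "\<And>z. z \<in> \<Lambda> \<Longrightarrow> (\<And>x. x \<in> I \<Longrightarrow> b z x = 0) \<Longrightarrow> z \<in> I"
    and sat: "\<And>z d. z \<in> I \<Longrightarrow> d > 0 \<Longrightarrow> (\<And>a. a \<in> \<Lambda> \<Longrightarrow> b a z / d \<in> \<int>) \<Longrightarrow> (1/d) *\<^sub>R z \<in> I"
    and nd: "\<And>z. z \<in> I \<Longrightarrow> (\<And>a. a \<in> \<Lambda> \<Longrightarrow> b a z = 0) \<Longrightarrow> z = 0"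
  shows "\<exists>m e f. hyperbolic_basis m e f \<and> (\<forall>i<m. f i \<in> I)"
proof -
  have "b a x \<in> \<int>" if "x \<in> I" "a \<in> \<Lambda>" for x a using that I(1) integral by blast
  from dual_bases[OF I(2) group this sat nd]
  obtain m :: nat and f a where fa0: "\<forall>i<m. f i \<in> I \<and> a i \<in> \<Lambda>"
    "\<forall>i<m. \<forall>j<m. b (a i) (f j) = (if i = j then 1 else 0)"
    "\<forall>z\<in>I. z = (\<Sum>i<m. b (a i) z *\<^sub>R f i)" by blast
  then have fa: "\<And>i. i < m \<Longrightarrow> f i \<in> I" "\<And>i. i < m \<Longrightarrow> a i \<in> \<Lambda>"
    "\<And>i j. i < m \<Longrightarrow> j < m \<Longrightarrow> b (a i) (f j) = (if i = j then 1 else 0)"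
    "\<And>z. z \<in> I \<Longrightarrow> z = (\<Sum>i<m. b (a i) z *\<^sub>R f i)" by blast+
  define e where "e i = a i - (\<Sum>k<i. b (a i) (a k) *\<^sub>R f k) - (b (a i) (a i) / 2) *\<^sub>R f i" for i
  have ff: "b (f i) (f j) = 0" if "i < m" "j < m" for i j using iso fa(1) that by auto
  have ef: "b (e i) (f j) = (if i = j then 1 else 0)" if "i < m" "j < m" for i j
    using that by (simp add: e_def form_sum fa(3) ff)
  have eL: "e i \<in> \<Lambda>" if "i < m" for i
    unfolding e_def using that fa(1,2) I(1)
    by (intro zsub_intros group integral half_integral) auto
  have af: "b (f i) (a j) = (if i = j then 1 else 0)" if "i < m" "j < m" for i j
    using fa(3)[OF that(2,1)] sym by simp
  have ee': "b (e i) (e j) = 0" if "i < m" "j < i" for i j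
  proof -
    have "(\<Sum>k<j. b (a j) (a k) * b (a i) (f k)) = 0"
      using that fa(3) by (intro sum.neutral) auto
    moreover have "(\<Sum>k<i. b (a i) (a k) * b (f k) (a j)) = (\<Sum>k<i. if k = j then b (a i) (a j) else 0)"
      using that af by (intro sum.cong) auto
    ultimately show ?thesis
      using that by (simp add: e_def form_sum fa(3) af ff)
  qed
  have ee: "b (e i) (e j) = 0" if "i < m" "j < m" for i j
  proof (cases i j rule: linorder_cases)
    case equal
    have "b (e i) (e i) = 0"
      using that by (simp add: e_def form_sum fa(3) af ff)
    then show ?thesis using equal by simp
  qed (use that ee'[of i j] ee'[of j i] sym in auto)
  have fe: "b (f i) (e j) = (if i = j then 1 else 0)" if "i < m" "j < m" for i j
    using ef[OF that(2,1)] sym by simp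
  have exp: "z = (\<Sum>i<m. b z (f i) *\<^sub>R e i + b z (e i) *\<^sub>R f i)" if z: "z \<in> \<Lambda>" for z
  proof -
    \<comment> \<open>The remainder of the expansion is orthogonal to every \<open>e j\<close> and
      \<open>f j\<close>. It lies in \<open>I\<close> by maximality, and its coordinates there are
      pairings with the \<open>a i\<close>, which are combinations of the \<open>e j\<close> and
      \<open>f j\<close>.\<close>
    define y where "y = z - (\<Sum>i<m. b z (f i) *\<^sub>R e i + b z (e i) *\<^sub>R f i)"
    have yL: "y \<in> \<Lambda>"
      unfolding y_def using z eL fa(1) I(1) by (intro zsub_intros group integral) auto
    have ye: "b y (e j) = 0" and yf: "b y (f j) = 0" if "j < m" for j
      using that by (simp_all add: y_def form_sum ee ef fe ff if_distrib[of "(*) _"] cong: if_cong)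
    have "b y x = 0" if "x \<in> I" for x
      by (subst fa(4)[OF that]) (simp add: form_sum yf)
    then have yI: "y \<in> I" using max yL by blast
    have "b (a i) y = 0" if "i < m" for i
    proof -
      have "a i = e i + (\<Sum>k<i. b (a i) (a k) *\<^sub>R f k) + (b (a i) (a i) / 2) *\<^sub>R f i"
        by (simp add: e_def)
      then have "b (a i) y = b (e i + (\<Sum>k<i. b (a i) (a k) *\<^sub>R f k) + (b (a i) (a i) / 2) *\<^sub>R f i) y"
        by (rule arg_cong)
      also have "\<dots> = 0" using that ye yf sym[of _ y] by (simp add: form_sum)
      finally show ?thesis .
    qed
    then have "(\<Sum>i<m. b (a i) y *\<^sub>R f i) = 0" by simp
    then have "y = 0" using fa(4)[OF yI] by (rule trans[rotated])
    then show ?thesis by (simp add: y_def)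
  qed
  have "hyperbolic_basis m e f"
    unfolding hyperbolic_basis_def using eL fa(1) I(1) ee ef ff exp by blast
  then show ?thesis using fa(1) by blast
qed

text \<open>The coefficients are entries of the Gram matrix of \<open>x\<close>, so embeddings with
  the same Gram matrix get the same coordinates. The vectors stay put and the basis is moved.
  \<open>prim\<close> supplies the vector of pairing 1 that \<open>eichler_transitive\<close> asks
  for, and \<open>r < m\<close> leaves the plane of index \<open>j + 1\<close> as its second
  plane.\<close>

lemma primitive_normal_form:
  assumes h: "hyperbolic_basis m e0 f0" and rm: "r < m"
    and x: "\<And>i. i < r \<Longrightarrow> x i \<in> \<Lambda>"
    and prim: "\<And>i. i < r \<Longrightarrow> \<exists>a\<in>\<Lambda>. (\<forall>k<i. b a (x k) = 0) \<and> b a (x i) = 1"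
    and "j \<le> r"
  shows "\<exists>e f. hyperbolic_basis m e f \<and>
    (\<forall>i<j. x i = e i + (\<Sum>k<i. b (x i) (x k) *\<^sub>R f k) + (b (x i) (x i) / 2) *\<^sub>R f i)"
  using \<open>j \<le> r\<close>
proof (induction j)
  case 0
  then show ?case using h by auto
next
  case (Suc j)
  then obtain e f where h: "hyperbolic_basis m e f"
    and nf: "\<And>i. i < j \<Longrightarrow> x i = e i + (\<Sum>k<i. b (x i) (x k) *\<^sub>R f k) + (b (x i) (x i) / 2) *\<^sub>R f i"
    by auto
  note hD = hyperbolic_basisD[OF h]
  have j: "j < r" "Suc j < m" using Suc.prems rm by auto
  have fx: "b (f k) (x i) = (if k = i then 1 else 0)" if "i < j" "k < m" for i k
    using that j by (subst nf) (auto simp: form_sum hD)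
  have ex: "b (e k) (x i) = 0" if "i < j" "j \<le> k" "k < m" for i k
    using that j by (subst nf) (auto simp: form_sum hD)
  define X where "X = x ` {..<j}"
  \<comment> \<open>The target has the norm of \<open>x j\<close> and the same pairings with the
    vectors already placed, while its pairing with \<open>f j\<close> is 1.\<close>
  define t where "t = e j + (\<Sum>k<j. b (x j) (x k) *\<^sub>R f k) + (b (x j) (x j) / 2) *\<^sub>R f j"
  have perp: "e k \<in> perp_in X" "f k \<in> perp_in X" if "j \<le> k" "k < m" for k
    using that hD ex fx by (auto simp: perp_in_def X_def)
  obtain c where c: "c \<in> perp_in X" "b c (x j) = 1"
    using prim[OF j(1)] by (auto simp: perp_in_def X_def)
  have tL: "t \<in> \<Lambda>"
    unfolding t_def using hD j x by (intro zsub_intros group integral half_integral) auto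
  have ft: "b (f j) t = 1" using j by (simp add: t_def form_sum hD)
  have tt: "b t t = b (x j) (x j)" using j by (simp add: t_def form_sum hD)
  have tx: "b t (x i) = b (x j) (x i)" if "i < j" for i
    using that j by (simp add: t_def form_sum ex fx if_distrib[of "(*) _"] cong: if_cong)
  have "t \<in> orbit X (x j)"
    using j hD tx by (intro eichler_transitive[where c = c and e = "e j" and f = "f j" and ?e2.0 = "e (Suc j)"
        and ?f2.0 = "f (Suc j)"] perp x c tL ft tt) (auto simp: X_def)
  then obtain g where g: "g \<in> lattice_isometries \<Lambda> X" "t = g (x j)" by (auto simp: orbit_def)
  \<comment> \<open>\<open>g\<close> carries \<open>x j\<close> to the target and fixes the earlier
    vectors. Applying its inverse to the basis keeps their coordinates and gives \<open>x j\<close>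
    those of the target.\<close>
  define g' where "g' = inv_into UNIV g"
  have g': "g' \<in> lattice_isometries \<Lambda> X" unfolding g'_def by (rule lattice_isometries_inv[OF g(1)])
  have lin: "linear g'" and fix': "\<And>y. y \<in> X \<Longrightarrow> g' y = y" using g' by (auto simp: lattice_isometries_def)
  note gs = linear_sum[OF lin] linear_add[OF lin] linear_scale[OF lin]
  have "g' t = x j" using g by (simp add: g'_def lattice_isometries_def bij_is_inj)
  then have "x j = g' (e j) + (\<Sum>k<j. b (x j) (x k) *\<^sub>R g' (f k)) + (b (x j) (x j) / 2) *\<^sub>R g' (f j)"
    by (simp add: t_def gs)
  moreover have "x i = g' (e i) + (\<Sum>k<i. b (x i) (x k) *\<^sub>R g' (f k)) + (b (x i) (x i) / 2) *\<^sub>R g' (f i)"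
    if "i < j" for i
  proof -
    have "g' (x i) = g' (e i + (\<Sum>k<i. b (x i) (x k) *\<^sub>R f k) + (b (x i) (x i) / 2) *\<^sub>R f i)"
      by (rule arg_cong[OF nf[OF that], of g'])
    moreover have "g' (x i) = x i" using fix' that by (auto simp: X_def)
    ultimately show ?thesis by (simp add: gs)
  qed
  ultimately have "\<forall>i<Suc j. x i = (g' \<circ> e) i + (\<Sum>k<i. b (x i) (x k) *\<^sub>R (g' \<circ> f) k) +
      (b (x i) (x i) / 2) *\<^sub>R (g' \<circ> f) i"
    by (simp only: less_Suc_eq comp_apply) blast
  then show ?case using hyperbolic_basis_image[OF h g'] by blast
qed

end

section \<open>Nondegenerate even lattices\<close>

lemma q_independent: "independent S \<Longrightarrow> qvec.independent S"
proof
  assume S: "independent S" and "qvec.dependent S"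
  then obtain t u v where t: "finite t" "t \<subseteq> S" "(\<Sum>v\<in>t. qscale (u v) v) = 0" "v \<in> t" "u v \<noteq> 0"
    unfolding qvec.dependent_explicit by blast
  then have "(\<Sum>v\<in>t. of_rat (u v) *\<^sub>R v) = 0" by (simp add: qscale_def)
  then have "(of_rat (u v) :: real) = 0" by (rule independentD[OF S t(1,2) _ t(4)])
  then show False using t(5) by simp
qed

lemma zspan_subset_qspan: "zmod.span S \<subseteq> qvec.span S"
proof
  fix x assume "x \<in> zmod.span S"
  then show "x \<in> qvec.span S"
  proof (induction rule: zmod.span_induct_alt)
    case base
    then show ?case by (rule qvec.span_zero)
  next
    case (step c x y)
    have "zscale c x = qscale (of_int c) x" by (simp add: zscale_def qscale_def)
    then show ?case using step by (auto intro: qvec.span_add qvec.span_scale qvec.span_base)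
  qed
qed

lemma qspan_multiple:
  assumes "zmod.subspace A" "x \<in> qvec.span A"
  shows "\<exists>N>0. of_nat N *\<^sub>R x \<in> A"
  using assms(2)
proof (induction rule: qvec.span_induct_alt)
  case base
  then show ?case using zsub_0[OF assms(1)] by (auto intro: exI[of _ 1])
next
  case (step c x y)
  then obtain N where N: "N > 0" "of_nat N *\<^sub>R y \<in> A" by blast
  obtain p q where pq: "quotient_of c = (p, q)" by (cases "quotient_of c")
  then have c: "c = of_int p / of_int q" "q > 0"
    using quotient_of_div quotient_of_denom_pos by auto
  have "of_nat (N * nat q) *\<^sub>R (qscale c x + y) = of_int (int N * p) *\<^sub>R x + of_int q *\<^sub>R (of_nat N *\<^sub>R y)"
    using c by (simp add: qscale_def scaleR_add_right of_rat_divide)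
  moreover have "\<dots> \<in> A"
    by (rule zsub_add[OF assms(1) zsub_scale[OF assms(1) Ints_of_int step(1)] zsub_scale[OF assms(1) Ints_of_int N(2)]])
  ultimately have "of_nat (N * nat q) *\<^sub>R (qscale c x + y) \<in> A" by simp
  moreover have "N * nat q > 0" using N c by simp
  ultimately show ?case by blast
qed

locale nondegenerate_lattice = symmetric_bilinear B for B :: "'v::euclidean_space \<Rightarrow> 'v \<Rightarrow> real" +
  fixes L :: "'v set"
  assumes lat: "is_lattice L" and ev: "even_on B L"
    and nondegenerate: "\<And>x. (\<And>y. B x y = 0) \<Longrightarrow> x = 0"
begin

abbreviation "L' \<equiv> dual_lattice B L"

lemma L_subspace: "zmod.subspace L"
  using lat by (auto simp: is_lattice_def)

lemma span_L: "span L = UNIV"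
proof -
  obtain S where "span S = UNIV" "L = zmod.span S" using lat by (auto simp: is_lattice_def)
  then show ?thesis using span_mono[of S L] by (auto intro: zmod.span_base)
qed

sublocale L: even_group B L
  by standard (rule L_subspace, rule ev)

text \<open>\<open>dual_lattice\<close> is cut out of the rational span; here integral pairings with
  \<open>L\<close> are shown to force rationality. The Gram map \<open>T\<close> is injective by
  nondegeneracy and maps the rational span of the basis into itself, hence onto it by counting, so a
  vector with \<open>T x\<close> in \<open>L\<close> is rational.\<close>

lemma dual_vectors:
  obtains S where "finite S" "independent S" "L = zmod.span S" "span S = UNIV" "L' = {x. \<forall>y\<in>L. B x y \<in> \<int>}"
    "\<And>v. v \<in> S \<Longrightarrow> \<exists>a\<in>L'. \<forall>w\<in>S. B a w = (if w = v then 1 else 0)"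
proof -
  obtain S where S: "independent S" "span S = UNIV" "L = zmod.span S" using lat by (auto simp: is_lattice_def)
  have fin: "finite S" using S(1) by (rule independent_imp_finite)
  define T where "T x = (\<Sum>w\<in>S. B x w *\<^sub>R w)" for x
  have SL: "w \<in> L" if "w \<in> S" for w using S that by (auto intro: zmod.span_base)
  have linT: "linear T" by (rule linearI) (simp_all add: T_def sum.distrib scaleR_add_left scaleR_sum_right)
  have coef: "u w = u' w" if "(\<Sum>w\<in>S. u w *\<^sub>R w) = (\<Sum>w\<in>S. u' w *\<^sub>R w)" "w \<in> S" for u u' w
  proof -
    have "(\<Sum>w\<in>S. (u w - u' w) *\<^sub>R w) = 0" using that by (simp add: scaleR_diff_left sum_subtractf)
    then show ?thesis using independentD[OF S(1) fin subset_refl _ that(2)] by fastforce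
  qed
  have inj: "inj T"
  proof (subst linear_inj_iff_eq_0[OF linT], intro allI impI)
    fix x assume "T x = 0"
    then have "B x w = 0" if "w \<in> S" for w
      using coef[of "B x" "\<lambda>_. 0" w] that by (simp add: T_def)
    then have "B x y = 0" for y
      using linear_eq_0_on_span[OF linear_right[of x], of S y] S(2) by auto
    then show "x = 0" by (rule nondegenerate)
  qed
  have surj: "surj T" by (rule linear_inj_imp_surj[OF linT inj])
  have int: "B x y \<in> \<int>" if "x \<in> L" "y \<in> L" for x y using L.integral that .
  have TS: "T ` S \<subseteq> qvec.span S"
  proof -
    have "T x \<in> zmod.span S" if "x \<in> S" for x
      unfolding T_def S(3)[symmetric] using SL int that by (intro zsub_intros L_subspace) auto
    then show ?thesis using zspan_subset_qspan by blast
  qed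
  have "independent (T ` S)" by (rule linear_independent_injective_image[OF linT S(1)]) (use inj in \<open>auto simp: inj_on_def\<close>)
  then have indT: "qvec.independent (T ` S)" by (rule q_independent)
  have "card (T ` S) = card S" using inj by (auto intro: card_image inj_on_subset)
  \<comment> \<open>Otherwise a vector of \<open>S\<close> could be added to the image of
    \<open>S\<close> under \<open>T\<close>, giving more than \<open>card S\<close> rationally
    independent vectors in the rational span of \<open>S\<close>.\<close>
  have "S \<subseteq> qvec.span (T ` S)"
  proof (rule ccontr)
    assume "\<not> ?thesis"
    then obtain v where v: "v \<in> S" "v \<notin> qvec.span (T ` S)" by blast
    then have "qvec.independent (insert v (T ` S))" using indT by (simp add: qvec.independent_insertI)
    moreover have "insert v (T ` S) \<subseteq> qvec.span S" using v TS by (simp add: qvec.span_base)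
    ultimately have "card (insert v (T ` S)) \<le> card S" using qvec.independent_span_bound[OF fin] by blast
    moreover have "v \<notin> T ` S" using v by (auto intro: qvec.span_base)
    ultimately show False using \<open>card (T ` S) = card S\<close> fin by simp
  qed
  then have ST: "qvec.span S \<subseteq> qvec.span (T ` S)"
    by (simp add: qvec.span_minimal qvec.subspace_span)
  have rat: "x \<in> ratspace L" if x: "\<forall>y\<in>L. B x y \<in> \<int>" for x
  proof -
    have "T x \<in> L" unfolding T_def using x SL by (intro zsub_intros L_subspace) auto
    then have "T x \<in> qvec.span (T ` S)" using ST zspan_subset_qspan S(3) by blast
    then obtain u where "T x = (\<Sum>v\<in>T ` S. qscale (u v) v)"
      unfolding qvec.span_finite[OF finite_imageI[OF fin]] by blast
    also have "\<dots> = (\<Sum>w\<in>S. of_rat (u (T w)) *\<^sub>R T w)"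
      using inj by (subst sum.reindex) (auto simp: qscale_def intro: inj_on_subset)
    also have "\<dots> = T (\<Sum>w\<in>S. of_rat (u (T w)) *\<^sub>R w)"
      by (simp add: linear_sum[OF linT] linear_scale[OF linT])
    finally have "x = (\<Sum>w\<in>S. of_rat (u (T w)) *\<^sub>R w)" using inj by (simp add: inj_eq)
    also have "\<dots> = (\<Sum>w\<in>S. qscale (u (T w)) w)" by (simp add: qscale_def)
    also have "\<dots> \<in> ratspace L"
      unfolding ratspace_def using SL
      by (intro qvec.span_sum qvec.span_scale qvec.span_base)
    finally show ?thesis .
  qed
  have dual: "L' = {x. \<forall>y\<in>L. B x y \<in> \<int>}" using rat by (auto simp: dual_lattice_def)
  have "\<exists>a\<in>L'. \<forall>w\<in>S. B a w = (if w = v then 1 else 0)" if v: "v \<in> S" for v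
  proof -
    obtain a where a: "T a = v" using surj by (metis surjD)
    have "(\<Sum>w\<in>S. (if w = v then 1 else 0) *\<^sub>R w) = v"
      using v fin by (simp add: if_distrib[of "\<lambda>c. c *\<^sub>R _"] cong: if_cong)
    then have B: "B a w = (if w = v then 1 else 0)" if "w \<in> S" for w
      using coef[of "B a" "\<lambda>w. if w = v then 1 else 0" w] that a by (simp add: T_def)
    have "B a y \<in> \<int>" if "y \<in> L" for y
      using that unfolding S(3)
      by (induction rule: zmod.span_induct_alt) (auto simp: zscale_def B)
    then show ?thesis using B dual by blast
  qed
  then show ?thesis using that[of S] fin S dual by blast
qed

lemma dual_iff: "x \<in> L' \<longleftrightarrow> (\<forall>y\<in>L. B x y \<in> \<int>)"
  by (rule dual_vectors) blast

lemma dual_pairing: "x \<in> L' \<Longrightarrow> y \<in> L \<Longrightarrow> B x y \<in> \<int>" "x \<in> L \<Longrightarrow> y \<in> L' \<Longrightarrow> B x y \<in> \<int>"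
  using dual_iff sym by metis+

lemma L_sub_dual: "L \<subseteq> L'"
  using dual_iff L.integral by blast

lemma dual_subspace: "zmod.subspace L'"
  by (rule zsubI) (auto simp: dual_iff)

lemma double_dual:
  assumes "\<And>a. a \<in> L' \<Longrightarrow> B a x \<in> \<int>"
  shows "x \<in> L"
proof -
  obtain S where S: "finite S" "independent S" "L = zmod.span S" "span S = UNIV"
    "\<And>v. v \<in> S \<Longrightarrow> \<exists>a\<in>L'. \<forall>w\<in>S. B a w = (if w = v then 1 else 0)"
    by (rule dual_vectors) blast
  have "x \<in> span S" using S(4) by simp
  then obtain u where x: "x = (\<Sum>w\<in>S. u w *\<^sub>R w)" unfolding span_finite[OF S(1)] by auto
  have "u v \<in> \<int>" if v: "v \<in> S" for v
  proof -
    obtain a where a: "a \<in> L'" "\<forall>w\<in>S. B a w = (if w = v then 1 else 0)" using S(5)[OF v] by blast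
    have "B a x = (\<Sum>w\<in>S. if w = v then u w else 0)"
      unfolding x form_sum by (rule sum.cong) (auto simp: a)
    also have "\<dots> = u v" using v S(1) by simp
    finally show ?thesis using assms[OF a(1)] by simp
  qed
  moreover have "w \<in> L" if "w \<in> S" for w using S(3) that by (auto intro: zmod.span_base)
  ultimately show ?thesis unfolding x by (intro zsub_intros L_subspace) auto
qed

lemma linear_eq_on_L:
  assumes "linear g" "linear h" "\<And>x. x \<in> L \<Longrightarrow> g x = h x"
  shows "g = h"
  using linear_eq_on_span[OF assms(1,2), of L] assms(3) span_L by auto

lemma isometry_on_L:
  assumes g: "linear g" and iso: "\<And>x y. x \<in> L \<Longrightarrow> y \<in> L \<Longrightarrow> B (g x) (g y) = B x y"
  shows "B (g x) (g y) = B x y"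
proof -
  have "B (g x) (g y) = B x y" if "x \<in> L" for x y
    by (rule fun_cong[OF linear_eq_on_L[OF linear_compose[OF g linear_right, unfolded o_def] linear_right iso[OF that]]])
  then show ?thesis
    by (intro fun_cong[OF linear_eq_on_L[OF linear_compose[OF g linear_left, unfolded o_def] linear_left], of _ _ x])
qed

end

lemma signature_nondegenerate:
  assumes "symmetric_bilinear B" "signature B p q TYPE('v::euclidean_space)" "\<And>y. B (x::'v) y = 0"
  shows "x = 0"
proof -
  interpret symmetric_bilinear B by fact
  obtain P N where PN: "\<forall>x\<in>P - {0}. B x x > 0" "\<forall>x\<in>N - {0}. B x x < 0"
    "\<forall>x\<in>P. \<forall>y\<in>N. B x y = 0" "{x + y | x y. x \<in> P \<and> y \<in> N} = UNIV"
    using assms(2) unfolding signature_def by blast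
  obtain u v where uv: "x = u + v" "u \<in> P" "v \<in> N" using PN(4) by blast
  have "B u u = 0" "B v v = 0"
    using assms(3)[of u] assms(3)[of v] PN(3) uv sym[of v u] by simp_all
  then show ?thesis using PN(1,2) uv by (metis DiffI add.right_neutral less_irrefl singletonD)
qed

section \<open>Lifting isometries of the discriminant group\<close>

lemma if_scaleR: "(if P then a else b) *\<^sub>R (x::'a::real_vector) = (if P then a *\<^sub>R x else b *\<^sub>R x)"
  by simp

locale hyperbolic_lattice = nondegenerate_lattice +
  fixes e0 f0 :: 'a
  assumes e0_L: "e0 \<in> L" and f0_L: "f0 \<in> L"
    and ee0: "B e0 e0 = 0" and ff0: "B f0 f0 = 0" and ef0: "B e0 f0 = 1"
begin

lemma fe0: "B f0 e0 = 1"
  using ef0 sym by simp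

definition pr :: "'a \<Rightarrow> 'a" where
  "pr x = x - B x f0 *\<^sub>R e0 - B x e0 *\<^sub>R f0"

definition L1 :: "'a set" where "L1 = {x\<in>L. B x e0 = 0 \<and> B x f0 = 0}"
text \<open>The dual lattice of \<open>L1\<close>. A hyperbolic plane is unimodular, so projecting
  along it changes vectors of \<open>L'\<close> only by elements of \<open>L\<close>
  (\<open>pr_diff_L\<close>), and \<open>D1\<close> represents every class of
  \<open>L'/L\<close>.\<close>

definition D1 :: "'a set" where "D1 = {x\<in>L'. B x e0 = 0 \<and> B x f0 = 0}"

lemma pr_orth: "B (pr x) e0 = 0" "B (pr x) f0 = 0"
  by (simp_all add: pr_def ee0 ff0 ef0 fe0)

lemma pr_id: "B x e0 = 0 \<Longrightarrow> B x f0 = 0 \<Longrightarrow> pr x = x"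
  by (simp add: pr_def)

lemma linear_pr: "linear pr"
  by (rule linearI) (simp_all add: pr_def algebra_simps)

lemma pr_L: "x \<in> L \<Longrightarrow> pr x \<in> L1"
  using pr_orth[of x] unfolding L1_def pr_def
  by (auto intro!: zsub_intros L_subspace e0_L f0_L L.integral)

lemma pr_diff_L: "x \<in> L' \<Longrightarrow> x - pr x \<in> L"
  using dual_pairing(1)[of x] e0_L f0_L by (auto simp: pr_def intro!: zsub_intros L_subspace)

lemma pr_dual: "x \<in> L' \<Longrightarrow> pr x \<in> D1"
  using pr_orth[of x] zsub_diff[OF dual_subspace, of x "x - pr x"] pr_diff_L L_sub_dual
  by (auto simp: D1_def)

lemma B_pr: "B e0 y = 0 \<Longrightarrow> B f0 y = 0 \<Longrightarrow> B (pr x) y = B x y"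
  by (simp add: pr_def)

lemma orth_zero:
  assumes "B u e0 = 0" "B u f0 = 0" "\<And>w. w \<in> L1 \<Longrightarrow> B u w = 0"
  shows "u = 0"
proof (rule nondegenerate)
  have "B u w = 0" if "w \<in> L" for w
    using assms(3)[OF pr_L[OF that]] assms(1,2) by (simp add: pr_def)
  then show "B u y = 0" for y
    using linear_eq_0_on_span[OF linear_right[of u], of L y] span_L by auto
qed

lemma L1_dual_basis:
  "\<exists>(r::nat) l c. (\<forall>i<r. l i \<in> L1) \<and> (\<forall>i<r. c i \<in> D1) \<and>
    (\<forall>i<r. \<forall>j<r. B (c i) (l j) = (if i = j then 1 else 0)) \<and>
    (\<forall>x. B x e0 = 0 \<longrightarrow> B x f0 = 0 \<longrightarrow> x = (\<Sum>i<r. B (c i) x *\<^sub>R l i))"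
proof -
  have s1: "zmod.subspace L1" unfolding L1_def by (rule zsubI) (auto intro: zsub_intros L_subspace)
  have s2: "zmod.subspace D1" unfolding D1_def by (rule zsubI) (auto intro: zsub_intros dual_subspace)
  have s3: "B a x \<in> \<int>" if "x \<in> L1" "a \<in> D1" for x a
    using that dual_pairing by (auto simp: L1_def D1_def)
  have s4: "(1/d) *\<^sub>R z \<in> L1" if "z \<in> L1" "d > 0" "\<And>a. a \<in> D1 \<Longrightarrow> B a z / d \<in> \<int>" for z d
  proof -
    have "B a ((1/d) *\<^sub>R z) \<in> \<int>" if "a \<in> L'" for a
    proof -
      have "B (pr a) z = B a z" using \<open>z \<in> L1\<close> sym[of _ z] by (intro B_pr) (auto simp: L1_def)
      then show ?thesis using \<open>\<And>a. a \<in> D1 \<Longrightarrow> B a z / d \<in> \<int>\<close>[OF pr_dual[OF that]] by simp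
    qed
    then show ?thesis using that double_dual by (auto simp: L1_def)
  qed
  have s5: "z = 0" if "z \<in> L1" "\<And>a. a \<in> D1 \<Longrightarrow> B a z = 0" for z
  proof (rule orth_zero)
    show "B z w = 0" if "w \<in> L1" for w
      using that \<open>\<And>a. a \<in> D1 \<Longrightarrow> B a z = 0\<close>[of w] L_sub_dual sym by (auto simp: L1_def D1_def)
  qed (use that in \<open>auto simp: L1_def\<close>)
  from dual_bases[OF s1 s2 s3 s4 s5]
  obtain r :: nat and l c where lc: "\<forall>i<r. l i \<in> L1 \<and> c i \<in> D1"
    "\<forall>i<r. \<forall>j<r. B (c i) (l j) = (if i = j then 1 else 0)"
    "\<forall>z\<in>L1. z = (\<Sum>i<r. B (c i) z *\<^sub>R l i)"
    by blast
  \<comment> \<open>Both sides are linear and agree on \<open>L\<close>, which spans. This extends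
    the expansion from \<open>L1\<close> to all real vectors orthogonal to the plane.\<close>
  have "pr = (\<lambda>x. \<Sum>i<r. B (c i) (pr x) *\<^sub>R l i)"
  proof (rule linear_eq_on_L[OF linear_pr])
    show "linear (\<lambda>x. \<Sum>i<r. B (c i) (pr x) *\<^sub>R l i)"
      by (rule linearI)
        (simp_all add: linear_add[OF linear_pr] linear_scale[OF linear_pr] scaleR_add_left sum.distrib scaleR_sum_right)
    show "pr x = (\<Sum>i<r. B (c i) (pr x) *\<^sub>R l i)" if "x \<in> L" for x
      using lc(3) pr_L[OF that] by blast
  qed
  then have exp: "pr x = (\<Sum>i<r. B (c i) (pr x) *\<^sub>R l i)" for x by (rule fun_cong)
  have "x = (\<Sum>i<r. B (c i) x *\<^sub>R l i)" if "B x e0 = 0" "B x f0 = 0" for x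
    using exp[of x] unfolding pr_id[OF that] .
  then have "\<forall>x. B x e0 = 0 \<longrightarrow> B x f0 = 0 \<longrightarrow> x = (\<Sum>i<r. B (c i) x *\<^sub>R l i)"
    by (intro allI impI)
  moreover have "\<forall>i<r. l i \<in> L1" "\<forall>i<r. c i \<in> D1" using lc(1) by auto
  ultimately show ?thesis using lc(2)
    by (intro exI[of _ r] exI[of _ l] exI[of _ c] conjI)
qed

section \<open>Even unimodular lattices glued from \<open>L\<close> and
  \<open>L1(-1)\<close>\<close>

definition bb :: "'a \<times> 'a \<Rightarrow> 'a \<times> 'a \<Rightarrow> real" where
  "bb z w = B (fst z) (fst w) - B (snd z) (snd w)"

sublocale pair: symmetric_bilinear bb
proof
  show "bilinear bb"
    unfolding bilinear_def by (auto intro!: linearI simp: bb_def algebra_simps)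
  show "bb x y = bb y x" for x y using sym by (simp add: bb_def)
qed

text \<open>
  \<open>glue G\<close> describes the preimage in \<open>L' \<times> L'\<close> of the graph of an isometry of \<open>L'/L\<close>; then \<open>glued G\<close>
  is an even unimodular overlattice of \<open>L \<oplus> L1(-1)\<close>.
\<close>

definition glue :: "('a \<times> 'a) set \<Rightarrow> bool" where
  "glue G \<longleftrightarrow> zmod.subspace G \<and> G \<subseteq> L' \<times> L' \<and> L \<times> L \<subseteq> G \<and> (\<forall>z\<in>G. bb z z / 2 \<in> \<int>) \<and>
    (\<forall>y\<in>L'. \<exists>x. (x, y) \<in> G) \<and> (\<forall>x\<in>L'. \<exists>y. (x, y) \<in> G) \<and> (\<forall>x. (x, 0) \<in> G \<longrightarrow> x \<in> L)"

definition glued :: "('a \<times> 'a) set \<Rightarrow> ('a \<times> 'a) set" where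
  "glued G = {z\<in>G. B (snd z) e0 = 0 \<and> B (snd z) f0 = 0}"

lemma glue_diagonal: "glue {(x, y). x \<in> L' \<and> y \<in> L' \<and> x - y \<in> L}" (is "glue ?G")
proof -
  have half: "bb z z / 2 \<in> \<int>" if zG: "z \<in> ?G" for z
  proof -
    obtain x y where z: "z = (x, y)" "x \<in> L'" "y \<in> L'" "x - y \<in> L" using zG by blast
    have "bb z z / 2 = B (x - y) (x - y) / 2 + B y (x - y)"
      using sym[of x y] by (simp add: z bb_def field_simps)
    moreover have "B (x - y) (x - y) / 2 \<in> \<int>" "B y (x - y) \<in> \<int>"
      using L.half_integral[OF z(4)] dual_pairing(1)[OF z(3,4)] .
    ultimately show ?thesis by (simp only: Ints_add)
  qed
  have "zmod.subspace ?G"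
  proof (rule zsubI)
    show "0 \<in> ?G" using zsub_0[OF dual_subspace] zsub_0[OF L_subspace] by (auto simp: zero_prod_def)
    fix z w assume "z \<in> ?G" "w \<in> ?G"
    then obtain x y x' y' where zw: "z = (x, y)" "w = (x', y')" "x \<in> L'" "y \<in> L'" "x - y \<in> L"
      "x' \<in> L'" "y' \<in> L'" "x' - y' \<in> L" by auto
    have "(x - x') - (y - y') = (x - y) - (x' - y')" by simp
    then have "(x - x') - (y - y') \<in> L" using zw zsub_diff[OF L_subspace] by metis
    then show "z - w \<in> ?G" using zw zsub_diff[OF dual_subspace] by auto
  qed
  moreover have "L \<times> L \<subseteq> ?G" using L_sub_dual zsub_diff[OF L_subspace] by auto
  moreover have "(y, y) \<in> ?G" if "y \<in> L'" for y using that zsub_0[OF L_subspace] by simp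
  then have "\<forall>y\<in>L'. \<exists>x. (x, y) \<in> ?G" "\<forall>x\<in>L'. \<exists>y. (x, y) \<in> ?G" by blast+
  moreover have "?G \<subseteq> L' \<times> L'" "\<forall>x. (x, 0) \<in> ?G \<longrightarrow> x \<in> L" by auto
  moreover have "\<forall>z\<in>?G. bb z z / 2 \<in> \<int>" using half by (rule ballI)
  ultimately show ?thesis unfolding glue_def by (intro conjI) assumption+
qed

lemma glued_even_group:
  assumes "glue G"
  shows "even_group bb (glued G)"
proof
  have G: "zmod.subspace G" "\<And>z. z \<in> G \<Longrightarrow> bb z z / 2 \<in> \<int>" using assms by (auto simp: glue_def)
  show "zmod.subspace (glued G)"
    unfolding glued_def by (rule zsubI) (auto intro: zsub_intros G)
  have "bb z w \<in> \<int>" if "z \<in> G" "w \<in> G" for z w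
  proof -
    have "bb z w = bb (z + w) (z + w) / 2 - bb z z / 2 - bb w w / 2"
      using pair.sym[of w z] by (simp add: field_simps)
    then show ?thesis using G(2)[OF zsub_add[OF G(1) that]] G(2)[OF that(1)] G(2)[OF that(2)]
      by (simp only: Ints_diff)
  qed
  then show "even_on bb (glued G)" using G(2) by (auto simp: even_on_def glued_def)
qed

text \<open>Whatever the gluing, the vectors \<open>(x + t *\<^sub>R e0, x)\<close> with
  \<open>x\<close> orthogonal to the plane form an isotropic real subspace of dimension
  \<open>r + 1\<close>, since the two copies of the space of \<open>L1\<close> carry opposite forms.
  Its intersection with the glued lattice is the Lagrangian.\<close>

lemma glued_basis:
  fixes r :: nat
  assumes G: "glue G"
    and l: "\<And>i. i < r \<Longrightarrow> l i \<in> L1" and c: "\<And>i. i < r \<Longrightarrow> c i \<in> D1"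
    and cl: "\<And>i j. i < r \<Longrightarrow> j < r \<Longrightarrow> B (c i) (l j) = (if i = j then 1 else 0)"
    and expand: "\<And>x. B x e0 = 0 \<Longrightarrow> B x f0 = 0 \<Longrightarrow> x = (\<Sum>i<r. B (c i) x *\<^sub>R l i)"
  shows "\<exists>e f. even_group.hyperbolic_basis bb (glued G) (Suc r) e f \<and>
    (\<forall>i<r. (0, l i) = e i + (\<Sum>k<i. bb (0, l i) (0, l k) *\<^sub>R f k) + (bb (0, l i) (0, l i) / 2) *\<^sub>R f i)"
proof -
  interpret E: even_group bb "glued G" by (rule glued_even_group[OF G])
  have G1: "zmod.subspace G" "G \<subseteq> L' \<times> L'" "L \<times> L \<subseteq> G"
    "\<And>y. y \<in> L' \<Longrightarrow> \<exists>x. (x, y) \<in> G" "\<And>x. x \<in> L' \<Longrightarrow> \<exists>y. (x, y) \<in> G"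
    using G by (auto simp: glue_def)
  have LG: "(x, y) \<in> glued G" if "x \<in> L" "y \<in> L1" for x y
    using that G1(3) by (auto simp: glued_def L1_def)
  have L1_0: "0 \<in> L1" using zsub_0[OF L_subspace] by (simp add: L1_def)
  have L0: "0 \<in> L" using zsub_0[OF L_subspace] .
  define I where "I = {z\<in>glued G. \<exists>t. fst z = snd z + t *\<^sub>R e0}"
  have II: "bb z w = 0" if zw: "z \<in> I" "w \<in> I" for z w
  proof -
    obtain s t where st: "fst z = snd z + s *\<^sub>R e0" "fst w = snd w + t *\<^sub>R e0"
      "B (snd z) e0 = 0" "B (snd w) e0 = 0"
      using zw by (auto simp: I_def glued_def)
    show ?thesis unfolding bb_def st(1,2) using st(3,4) ee0 sym[of e0 "snd w"] by simp
  qed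
  have e0I: "(e0, 0) \<in> I" using LG[OF e0_L L1_0] by (auto simp: I_def intro: exI[of _ 1])
  have lI: "(x, x) \<in> I" if "x \<in> L1" for x
    using LG[of x x] that by (auto simp: I_def L1_def intro: exI[of _ 0])
  have "\<exists>m e f. E.hyperbolic_basis m e f \<and> (\<forall>i<m. f i \<in> I)"
  proof (rule E.lagrangian_hyperbolic_basis)
    show "I \<subseteq> glued G" by (auto simp: I_def)
    show "zmod.subspace I"
    proof (rule zsubI)
      show "0 \<in> I" using zsub_0[OF E.group] by (auto simp: I_def intro: exI[of _ 0])
      fix z w assume "z \<in> I" "w \<in> I"
      then obtain s t where st: "fst z = snd z + s *\<^sub>R e0" "fst w = snd w + t *\<^sub>R e0"
        "z \<in> glued G" "w \<in> glued G" by (auto simp: I_def)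
      then have "fst (z - w) = snd (z - w) + (s - t) *\<^sub>R e0" by (simp add: algebra_simps)
      then show "z - w \<in> I" using zsub_diff[OF E.group st(3,4)] by (auto simp: I_def)
    qed
    show "z \<in> I" if z: "z \<in> glued G" "\<And>x. x \<in> I \<Longrightarrow> bb z x = 0" for z
    proof -
      obtain x y where xy: "z = (x, y)" by (cases z)
      have y: "B y e0 = 0" "B y f0 = 0" using z by (auto simp: xy glued_def)
      have xe: "B x e0 = 0" using z(2)[OF e0I] by (simp add: xy bb_def)
      \<comment> \<open>Pairing with the diagonal vectors shows that \<open>x - y\<close> is
        orthogonal to \<open>L1\<close>, so it lies in the plane of \<open>e0\<close> and
        \<open>f0\<close>; orthogonality to \<open>(e0, 0)\<close> leaves only a multiple of
        \<open>e0\<close>.\<close>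
      have "x - y - B x f0 *\<^sub>R e0 = 0"
      proof (rule orth_zero)
        show "B (x - y - B x f0 *\<^sub>R e0) w = 0" if "w \<in> L1" for w
          using z(2)[OF lI[OF that]] that sym[of e0 w] by (simp add: xy bb_def L1_def)
      qed (simp_all add: y xe ee0 ef0)
      then have "x = y + B x f0 *\<^sub>R e0" by (simp add: algebra_simps)
      then show ?thesis using z(1) unfolding I_def xy by auto
    qed
    show "(1/d) *\<^sub>R z \<in> I" if z: "z \<in> I" "d > 0" "\<And>a. a \<in> glued G \<Longrightarrow> bb a z / d \<in> \<int>" for z d
    proof -
      obtain p y t where py: "z = (p, y)" "(p, y) \<in> glued G" "p = y + t *\<^sub>R e0"
        using z(1) by (cases z) (auto simp: I_def)
      then have G': "(p, y) \<in> G" and y: "B y e0 = 0" "B y f0 = 0" by (auto simp: glued_def)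
      have "B p w / d \<in> \<int>" if "w \<in> L" for w
        using z(3)[OF LG[OF that L1_0]] by (simp add: py bb_def sym)
      then have p': "(1/d) *\<^sub>R p \<in> L'" by (simp add: dual_iff)
      have "B y w / d \<in> \<int>" if "w \<in> L" for w
      proof -
        have "- B (pr w) y / d \<in> \<int>" using z(3)[OF LG[OF L0 pr_L[OF that]]] by (simp add: py bb_def)
        moreover have "B (pr w) y = B y w" using y B_pr[of y w] by (simp add: sym[of y])
        ultimately show ?thesis by simp
      qed
      then have y': "(1/d) *\<^sub>R y \<in> L'" by (simp add: dual_iff)
      \<comment> \<open>This is the unimodularity argument: \<open>q\<close> is a partner of the
        second component, and since every \<open>a\<close> in \<open>L'\<close> occurs as a first
        component in \<open>G\<close>, double duality puts the difference of the first components in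
        \<open>L\<close>.\<close>
      obtain q where q: "(q, (1/d) *\<^sub>R y) \<in> G" using G1(4)[OF y'] by blast
      then have qd: "(q, (1/d) *\<^sub>R y) \<in> glued G" using y by (simp add: glued_def)
      have "(1/d) *\<^sub>R p - q \<in> L"
      proof (rule double_dual)
        fix a assume a: "a \<in> L'"
        obtain y0 where "(a, y0) \<in> G" using G1(5)[OF a] by blast
        moreover have "y0 \<in> L'" using \<open>(a, y0) \<in> G\<close> G1(2) by blast
        then have "(0, y0 - pr y0) \<in> G" using pr_diff_L L0 G1(3) by blast
        ultimately have "(a, y0) - (0, y0 - pr y0) \<in> G" by (rule zsub_diff[OF G1(1)])
        then have ay: "(a, pr y0) \<in> glued G" using pr_orth by (simp add: glued_def)
        have "B a ((1/d) *\<^sub>R p - q) = bb (a, pr y0) z / d - bb (a, pr y0) (q, (1/d) *\<^sub>R y)"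
          by (simp add: bb_def py diff_divide_distrib)
        then show "B a ((1/d) *\<^sub>R p - q) \<in> \<int>"
          using z(3)[OF ay] E.integral[OF ay qd] by simp
      qed
      then have "((1/d) *\<^sub>R p - q, 0) \<in> glued G" using LG L1_0 by blast
      from zsub_add[OF E.group this qd] have "((1/d) *\<^sub>R p, (1/d) *\<^sub>R y) \<in> glued G" by simp
      moreover have "(1/d) *\<^sub>R p = (1/d) *\<^sub>R y + (t/d) *\<^sub>R e0" by (simp add: py(3) scaleR_add_right)
      ultimately show ?thesis by (auto simp: I_def py(1))
    qed
    show "z = 0" if z: "z \<in> I" "\<And>a. a \<in> glued G \<Longrightarrow> bb a z = 0" for z
    proof -
      obtain p y where py: "z = (p, y)" by (cases z)
      have y: "B y e0 = 0" "B y f0 = 0" using z(1) by (auto simp: py I_def glued_def)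
      have "B p w = 0" if "w \<in> L" for w
        using z(2)[OF LG[OF that L1_0]] by (simp add: py bb_def sym)
      then have "p = 0" using e0_L f0_L by (intro orth_zero) (auto simp: L1_def)
      moreover have "y = 0"
      proof (rule orth_zero)
        show "B y w = 0" if "w \<in> L1" for w
          using z(2)[OF LG[OF L0 that]] by (simp add: py bb_def sym)
      qed (use y in auto)
      ultimately show ?thesis by (simp add: py zero_prod_def)
    qed
  qed (rule II)
  then obtain m e f where h: "E.hyperbolic_basis m e f" and fI: "\<And>i. i < m \<Longrightarrow> f i \<in> I" by blast
  \<comment> \<open>The number of planes is found by comparing traces with a second biorthogonal
    system for the real span of \<open>I\<close>. The \<open>y k\<close> may fail to generate
    \<open>I\<close> over the integers, but real expansions in both directions suffice.\<close>
  define y where "y k = (if k < r then (l k, l k) else (e0, 0))" for k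
  define d where "d k = (if k < r then (c k, 0 :: 'a) else (f0, 0))" for k
  have yI: "y k \<in> I" for k using lI l e0I by (simp add: y_def)
  have m: "m = Suc r"
  proof (rule pair.dual_bases_card)
    show "bb (e i) (f j) = (if i = j then 1 else 0)" if "i < m" "j < m" for i j
      using E.hyperbolic_basisD[OF h] that by blast
    show "bb (d i) (y j) = (if i = j then 1 else 0)" if "i < Suc r" "j < Suc r" for i j
      using that l c cl sym[of f0] by (auto simp: d_def y_def bb_def ef0 L1_def D1_def)
    show "f i = (\<Sum>k<Suc r. bb (d k) (f i) *\<^sub>R y k)" if im: "i < m" for i
    proof -
      obtain x t where xt: "f i = (x + t *\<^sub>R e0, x)" "B x e0 = 0" "B x f0 = 0"
        using fI[OF im] by (cases "f i") (auto simp: I_def glued_def)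
      have "(\<Sum>k<r. bb (d k) (f i) *\<^sub>R y k) = (\<Sum>k<r. (B (c k) x *\<^sub>R l k, B (c k) x *\<^sub>R l k))"
        using c by (intro sum.cong) (auto simp: d_def y_def bb_def xt D1_def)
      also have "\<dots> = (x, x)" using expand[OF xt(2,3)] by (simp add: prod_eq_iff fst_sum snd_sum)
      finally show ?thesis using xt sym[of f0 x] by (simp add: d_def y_def bb_def fe0)
    qed
    show "y k = (\<Sum>i<m. bb (e i) (y k) *\<^sub>R f i)" for k
    proof -
      have "y k \<in> glued G" using yI by (auto simp: I_def)
      from E.hyperbolic_basis_expand[OF h this]
      have "y k = (\<Sum>i<m. bb (y k) (f i) *\<^sub>R e i + bb (y k) (e i) *\<^sub>R f i)" .
      also have "\<dots> = (\<Sum>i<m. bb (e i) (y k) *\<^sub>R f i)"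
        using II[OF yI fI] by (intro sum.cong) (auto simp: pair.sym[of "y k" "e _"])
      finally show ?thesis .
    qed
  qed
  show ?thesis
  proof (rule E.primitive_normal_form)
    show "E.hyperbolic_basis (Suc r) e f" using h m by simp
    show "(0, l i) \<in> glued G" if "i < r" for i using LG[OF L0 l[OF that]] .
    show "\<exists>a\<in>glued G. (\<forall>k<i. bb a (0, l k) = 0) \<and> bb a (0, l i) = 1" if i: "i < r" for i
    proof -
      \<comment> \<open>The sign compensates for the minus sign of the second summand of
        \<open>bb\<close>.\<close>
      have "- c i \<in> L'" using c[OF i] zsub_minus[OF dual_subspace] by (auto simp: D1_def)
      then obtain p where "(p, - c i) \<in> G" using G1(4) by blast
      then have "(p, - c i) \<in> glued G" using c[OF i] by (simp add: glued_def D1_def)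
      then show ?thesis using cl i by (intro bexI[of _ "(p, - c i)"]) (auto simp: bb_def)
    qed
  qed auto
qed


text \<open>Coordinate functionals make the map between the bases linear on the whole of
  \<open>'a \<times> 'a\<close>, although it is an isometry only on the lattice. The last conclusion
  provides surjectivity.\<close>

lemma hyperbolic_basis_map:
  fixes m :: nat
  assumes "even_group bb \<Lambda>\<^sub>1" "even_group bb \<Lambda>\<^sub>2"
    and h1: "even_group.hyperbolic_basis bb \<Lambda>\<^sub>1 m e f" and h2: "even_group.hyperbolic_basis bb \<Lambda>\<^sub>2 m e' f'"
  defines "\<Psi> \<equiv> \<lambda>z. \<Sum>i<m. bb z (f i) *\<^sub>R e' i + bb z (e i) *\<^sub>R f' i"
    and "\<Psi>' \<equiv> \<lambda>z. \<Sum>i<m. bb z (f' i) *\<^sub>R e i + bb z (e' i) *\<^sub>R f i"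
  shows "linear \<Psi>" "\<And>z. z \<in> \<Lambda>\<^sub>1 \<Longrightarrow> \<Psi> z \<in> \<Lambda>\<^sub>2" "\<And>i. i < m \<Longrightarrow> \<Psi> (e i) = e' i" "\<And>i. i < m \<Longrightarrow> \<Psi> (f i) = f' i"
    "\<And>z w. z \<in> \<Lambda>\<^sub>1 \<Longrightarrow> w \<in> \<Lambda>\<^sub>1 \<Longrightarrow> bb (\<Psi> z) (\<Psi> w) = bb z w" "\<And>z. z \<in> \<Lambda>\<^sub>2 \<Longrightarrow> \<Psi> (\<Psi>' z) = z"
proof -
  interpret E1: even_group bb \<Lambda>\<^sub>1 by fact
  interpret E2: even_group bb \<Lambda>\<^sub>2 by fact
  note d1 = E1.hyperbolic_basisD[OF h1] and d2 = E2.hyperbolic_basisD[OF h2]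
  have delta: "(\<Sum>i<m. (if k = i then c else 0) *\<^sub>R v i) = c *\<^sub>R v k"
    "(\<Sum>i<m. (if i = k then c else 0) *\<^sub>R v i) = c *\<^sub>R v k" if "k < m" for k c and v :: "nat \<Rightarrow> 'a \<times> 'a"
    using that by (simp_all add: if_scaleR scaleR_zero_left cong: if_cong)
  show lin: "linear \<Psi>"
    unfolding \<Psi>_def by (rule linearI)
      (simp_all only: pair.form_simps scaleR_add_left sum.distrib scaleR_sum_right scaleR_add_right scaleR_scaleR add_ac)
  show "\<Psi> z \<in> \<Lambda>\<^sub>2" if "z \<in> \<Lambda>\<^sub>1" for z
    unfolding \<Psi>_def using d1 d2 that by (intro zsub_intros E2.group E1.integral) auto
  show e: "\<Psi> (e i) = e' i" if "i < m" for i
    using that delta[OF that, of 1 e'] by (simp add: \<Psi>_def d1 sum.distrib)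
  show f: "\<Psi> (f i) = f' i" if "i < m" for i
    using that delta[OF that, of 1 f'] by (simp add: \<Psi>_def d1 sum.distrib)
  have p: "bb (\<Psi> z) (f' i) = bb z (f i)" "bb (\<Psi> z) (e' i) = bb z (e i)" if "i < m" for z i
    using that by (simp_all add: \<Psi>_def pair.form_sum d2 if_distrib[of "(*) _"] cong: if_cong)
  show "bb (\<Psi> z) (\<Psi> w) = bb z w" if zw: "z \<in> \<Lambda>\<^sub>1" "w \<in> \<Lambda>\<^sub>1" for z w
  proof -
    have "bb (\<Psi> z) (\<Psi> w) = (\<Sum>i<m. bb w (f i) * bb z (e i) + bb w (e i) * bb z (f i))"
      by (subst (2) \<Psi>_def) (simp add: pair.form_sum p)
    also have "\<dots> = bb z (\<Sum>i<m. bb w (f i) *\<^sub>R e i + bb w (e i) *\<^sub>R f i)"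
      by (simp add: pair.form_sum)
    also have "\<dots> = bb z w"
      by (rule arg_cong[OF E1.hyperbolic_basis_expand[OF h1 zw(2), symmetric], of "bb z"])
    finally show ?thesis .
  qed
  show "\<Psi> (\<Psi>' z) = z" if z: "z \<in> \<Lambda>\<^sub>2" for z
  proof -
    have "\<Psi> (\<Psi>' z) = (\<Sum>i<m. bb z (f' i) *\<^sub>R e' i + bb z (e' i) *\<^sub>R f' i)"
      unfolding \<Psi>'_def by (simp add: linear_sum[OF lin] linear_add[OF lin] linear_scale[OF lin] e f)
    also have "\<dots> = z" by (rule E2.hyperbolic_basis_expand[OF h2 z, symmetric])
    finally show ?thesis .
  qed
qed

lemma glue_lift:
  assumes G: "glue G"
  shows "\<exists>g. linear g \<and> (\<forall>x y. B (g x) (g y) = B x y) \<and> g ` L = L \<and> (\<forall>x\<in>L'. (g x, x) \<in> G)"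
proof -
  obtain r :: nat and l c where lc: "\<forall>i<r. l i \<in> L1" "\<forall>i<r. c i \<in> D1"
    "\<forall>i<r. \<forall>j<r. B (c i) (l j) = (if i = j then 1 else 0)"
    "\<forall>x. B x e0 = 0 \<longrightarrow> B x f0 = 0 \<longrightarrow> x = (\<Sum>i<r. B (c i) x *\<^sub>R l i)"
    using L1_dual_basis by (elim exE conjE) (rule that)
  then have l: "\<And>i. i < r \<Longrightarrow> l i \<in> L1" and c: "\<And>i. i < r \<Longrightarrow> c i \<in> D1"
    and cl: "\<And>i j. i < r \<Longrightarrow> j < r \<Longrightarrow> B (c i) (l j) = (if i = j then 1 else 0)"
    and expand: "\<And>x. B x e0 = 0 \<Longrightarrow> B x f0 = 0 \<Longrightarrow> x = (\<Sum>i<r. B (c i) x *\<^sub>R l i)"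
    by blast+
  define Gd where "Gd = {(x, y). x \<in> L' \<and> y \<in> L' \<and> x - y \<in> L}"
  have Gd: "glue Gd" unfolding Gd_def by (rule glue_diagonal)
  let ?x = "\<lambda>i. (0 :: 'a, l i)"
  define nf where "nf e f \<longleftrightarrow> (\<forall>i<r. ?x i = e i + (\<Sum>k<i. bb (?x i) (?x k) *\<^sub>R f k) + (bb (?x i) (?x i) / 2) *\<^sub>R f i)"
    for e f :: "nat \<Rightarrow> 'a \<times> 'a"
  obtain e f where h1: "even_group.hyperbolic_basis bb (glued Gd) (Suc r) e f" and n1: "nf e f"
    using glued_basis[OF Gd l c cl expand] unfolding nf_def by blast
  obtain e' f' where h2: "even_group.hyperbolic_basis bb (glued G) (Suc r) e' f'" and n2: "nf e' f'"
    using glued_basis[OF G l c cl expand] unfolding nf_def by blast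
  have E1: "even_group bb (glued Gd)" and E2: "even_group bb (glued G)"
    by (rule glued_even_group, fact)+
  define P where "P z = (\<Sum>i<Suc r. bb z (f i) *\<^sub>R e' i + bb z (e i) *\<^sub>R f' i)" for z
  define Q where "Q z = (\<Sum>i<Suc r. bb z (f' i) *\<^sub>R e i + bb z (e' i) *\<^sub>R f i)" for z
  note hP = hyperbolic_basis_map[OF E1 E2 h1 h2, folded P_def Q_def]
  note hQ = hyperbolic_basis_map[OF E2 E1 h2 h1, folded P_def Q_def]
  \<comment> \<open>Both normal forms have the same coefficients, the Gram matrix of the
    \<open>l i\<close>, so a linear map matching the bases fixes these vectors. It is stated for a
    general \<open>R\<close> because \<open>P\<close> and \<open>Q\<close> both need it.\<close>
  have fixed: "R (?x i) = ?x i"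
    if R: "linear R" "\<And>i. i < Suc r \<Longrightarrow> R (u i) = u' i" "\<And>i. i < Suc r \<Longrightarrow> R (v i) = v' i"
      and n: "nf u v" "nf u' v'" and i: "i < r" for R i u v u' v'
  proof -
    have "?x i = u i + (\<Sum>k<i. bb (?x i) (?x k) *\<^sub>R v k) + (bb (?x i) (?x i) / 2) *\<^sub>R v i"
      using n(1) i unfolding nf_def by blast
    then have "R (?x i) = R (u i + (\<Sum>k<i. bb (?x i) (?x k) *\<^sub>R v k) + (bb (?x i) (?x i) / 2) *\<^sub>R v i)"
      by (rule arg_cong)
    also have "\<dots> = u' i + (\<Sum>k<i. bb (?x i) (?x k) *\<^sub>R v' k) + (bb (?x i) (?x i) / 2) *\<^sub>R v' i"
      using i by (simp add: linear_add[OF R(1)] linear_sum[OF R(1)] linear_scale[OF R(1)] R(2,3))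
    also have "\<dots> = ?x i" using n(2) i unfolding nf_def by (simp only:)
    finally show ?thesis .
  qed
  have xL: "?x i \<in> glued H" if "glue H" "i < r" for H i
    using that l zsub_0[OF L_subspace] by (auto simp: glue_def glued_def L1_def)
  have L0: "(v, 0) \<in> glued H" if "glue H" "v \<in> L" for H v
    using that zsub_0[OF L_subspace] by (auto simp: glue_def glued_def)
  \<comment> \<open>The image of \<open>(v, 0)\<close> is orthogonal to all \<open>(0, l i)\<close>,
    so its second component vanishes; the last clause of \<open>glue\<close> then puts its first
    component in \<open>L\<close>.\<close>
  have step: "\<exists>w\<in>L. R (v, 0) = (w, 0)"
    if R: "\<And>z. z \<in> glued H \<Longrightarrow> R z \<in> glued H'" "\<And>z w. z \<in> glued H \<Longrightarrow> w \<in> glued H \<Longrightarrow> bb (R z) (R w) = bb z w"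
      "\<And>i. i < r \<Longrightarrow> R (?x i) = ?x i" and H: "glue H" "glue H'" and v: "v \<in> L" for R H H' v
  proof -
    obtain p y where py: "R (v, 0) = (p, y)" by (cases "R (v, 0)")
    have pyH: "(p, y) \<in> glued H'" using R(1)[OF L0[OF H(1) v]] py by simp
    then have y: "B y e0 = 0" "B y f0 = 0" by (simp_all add: glued_def)
    have "B y (l i) = 0" if "i < r" for i
      using R(2)[OF L0[OF H(1) v] xL[OF H(1) that]] R(3)[OF that] py by (simp add: bb_def)
    then have yl: "B y (\<Sum>i<r. a i *\<^sub>R l i) = 0" for a by (simp add: form_sum)
    have "y = 0"
    proof (rule orth_zero[OF y])
      fix w assume "w \<in> L1"
      then have "w = (\<Sum>i<r. B (c i) w *\<^sub>R l i)" by (intro expand) (auto simp: L1_def)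
      then show "B y w = 0" by (rule ssubst) (rule yl)
    qed
    then show ?thesis using H(2) pyH py by (auto simp: glue_def glued_def)
  qed
  have P1: "\<exists>w\<in>L. P (v, 0) = (w, 0)" if "v \<in> L" for v
    by (rule step[OF hP(2,5) fixed[OF hP(1,3,4) n1 n2] Gd G that])
  have Q1: "\<exists>w\<in>L. Q (v, 0) = (w, 0)" if "v \<in> L" for v
    by (rule step[OF hQ(2,5) fixed[OF hQ(1,3,4) n2 n1] G Gd that])
  define g where "g v = fst (P (v, 0))" for v
  have linv: "linear (\<lambda>v. P (v, 0))"
    by (rule linear_compose[OF _ hP(1), unfolded o_def]) (auto intro: linearI)
  have lin: "linear g"
    unfolding g_def by (rule linear_compose[OF linv linear_fst, unfolded o_def])
  have "(\<lambda>v. snd (P (v, 0))) = (\<lambda>v. 0)"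
    by (rule linear_eq_on_L[OF linear_compose[OF linv linear_snd, unfolded o_def]])
      (use P1 in \<open>force intro: linearI\<close>)+
  then have Pg: "P (v, 0) = (g v, 0)" for v by (metis g_def prod.collapse)
  have gL: "g v \<in> L" if "v \<in> L" for v using P1[OF that] Pg by auto
  have "w \<in> g ` L" if "w \<in> L" for w
  proof -
    obtain v where v: "v \<in> L" "Q (w, 0) = (v, 0)" using Q1[OF \<open>w \<in> L\<close>] by blast
    have "P (Q (w, 0)) = (w, 0)" by (rule hP(6)[OF L0[OF G \<open>w \<in> L\<close>]])
    then show ?thesis using v Pg by auto
  qed
  with gL have gLL: "g ` L = L" by blast
  have isoL: "B (g x) (g y) = B x y" if "x \<in> L" "y \<in> L" for x y
    using hP(5)[OF L0[OF Gd that(1)] L0[OF Gd that(2)]] by (simp add: Pg bb_def)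
  have iso: "B (g x) (g y) = B x y" for x y by (rule isometry_on_L[OF lin isoL])
  \<comment> \<open>The diagonal vector \<open>(y, y)\<close> belongs to the gluing for the
    identity, and its image \<open>(g y, y)\<close> to that for \<open>G\<close>. Replacing
    \<open>x\<close> by its projection \<open>y\<close> costs only a vector of \<open>L\<close>, and
    \<open>G\<close> contains \<open>L \<times> L\<close>.\<close>
  have gG: "(g x, x) \<in> G" if x: "x \<in> L'" for x
  proof -
    define y where "y = pr x"
    have y: "y \<in> L'" "B y e0 = 0" "B y f0 = 0" "x - y \<in> L"
      using pr_dual[OF x] pr_diff_L[OF x] by (auto simp: y_def D1_def)
    have "(y, y) \<in> glued Gd" using y zsub_0[OF L_subspace] by (simp add: glued_def Gd_def)
    then have "P (y, y) \<in> G" using hP(2) by (auto simp: glued_def)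
    moreover have "P (0, y) = (0, y)"
    proof -
      have ye: "y = (\<Sum>i<r. B (c i) y *\<^sub>R l i)" using expand y by blast
      have "(0, \<Sum>i<r. B (c i) y *\<^sub>R l i) = (\<Sum>i<r. B (c i) y *\<^sub>R ?x i)"
        by (simp add: prod_eq_iff fst_sum snd_sum)
      moreover have "P (\<Sum>i<r. B (c i) y *\<^sub>R ?x i) = (\<Sum>i<r. B (c i) y *\<^sub>R ?x i)"
        using fixed[OF hP(1,3,4) n1 n2] by (simp add: linear_sum[OF hP(1)] linear_scale[OF hP(1)] del: scaleR_Pair)
      ultimately have "P (0, \<Sum>i<r. B (c i) y *\<^sub>R l i) = (0, \<Sum>i<r. B (c i) y *\<^sub>R l i)" by (simp only:)
      then show ?thesis unfolding ye[symmetric] .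
    qed
    moreover have "P (y, y) = P (y, 0) + P (0, y)" by (simp add: linear_add[OF hP(1), symmetric])
    ultimately have "(g y, y) \<in> G" by (simp add: Pg)
    moreover have "(g (x - y), x - y) \<in> G" using gL y(4) G by (auto simp: glue_def)
    moreover have "zmod.subspace G" using G by (simp add: glue_def)
    ultimately have "(g y, y) + (g (x - y), x - y) \<in> G" by (rule zsub_add[rotated])
    then show ?thesis by (simp add: linear_diff[OF lin])
  qed
  show ?thesis using lin iso gLL gG by blast
qed

end

section \<open>Quotient groups as sets of translates\<close>

lemma mult_additive_grp: "x \<otimes>\<^bsub>additive_grp A\<^esub> y = x + y"
  by (simp add: additive_grp_def)

lemma image_set_sum:
  assumes "linear g"
  shows "g ` {x + y | x y. x \<in> X \<and> y \<in> Y} = {x + y | x y. x \<in> g ` X \<and> y \<in> g ` Y}"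
proof
  show "g ` {x + y | x y. x \<in> X \<and> y \<in> Y} \<subseteq> {x + y | x y. x \<in> g ` X \<and> y \<in> g ` Y}"
    using linear_add[OF assms] by blast
  show "{x + y | x y. x \<in> g ` X \<and> y \<in> g ` Y} \<subseteq> g ` {x + y | x y. x \<in> X \<and> y \<in> Y}"
  proof
    fix z assume "z \<in> {x + y | x y. x \<in> g ` X \<and> y \<in> g ` Y}"
    then obtain x y where "x \<in> X" "y \<in> Y" "z = g (x + y)" using linear_add[OF assms] by auto
    then show "z \<in> g ` {x + y | x y. x \<in> X \<and> y \<in> Y}" by blast
  qed
qed

definition translate :: "'v::euclidean_space set \<Rightarrow> 'v \<Rightarrow> 'v set" where
  "translate N x = {t + x | t. t \<in> N}"

lemma r_coset_additive: "N #>\<^bsub>additive_grp A\<^esub> x = translate N x"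
  unfolding r_coset_def mult_additive_grp translate_def by blast

lemma carrier_quotient: "carrier (additive_grp A Mod N) = translate N ` A"
  unfolding FactGroup_def RCOSETS_def r_coset_additive by (auto simp: additive_grp_def)

lemma mult_quotient: "X \<otimes>\<^bsub>additive_grp A Mod N\<^esub> Y = {x + y | x y. x \<in> X \<and> y \<in> Y}"
  by (simp add: FactGroup_def set_mult_def mult_additive_grp) blast

lemma translate_self: "zmod.subspace N \<Longrightarrow> x \<in> translate N x"
  using zsub_0 by (force simp: translate_def)

lemma translate_eq_iff:
  assumes N: "zmod.subspace N"
  shows "translate N x = translate N y \<longleftrightarrow> x - y \<in> N"
proof
  assume "translate N x = translate N y"
  then have "x \<in> translate N y" using translate_self[OF N] by blast
  then show "x - y \<in> N" by (auto simp: translate_def)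
next
  have sub: "translate N x \<subseteq> translate N y" if "x - y \<in> N" for x y
  proof
    fix z assume "z \<in> translate N x"
    then obtain t where "z = t + x" "t \<in> N" by (auto simp: translate_def)
    then have "z = (t + (x - y)) + y" "t + (x - y) \<in> N" using that zsub_add[OF N] by auto
    then show "z \<in> translate N y" unfolding translate_def by blast
  qed
  assume "x - y \<in> N"
  moreover from this have "y - x \<in> N" using zsub_minus[OF N] by fastforce
  ultimately show "translate N x = translate N y" using sub by blast
qed

lemma translate_add:
  assumes N: "zmod.subspace N"
  shows "{u + v | u v. u \<in> translate N x \<and> v \<in> translate N y} = translate N (x + y)"
proof
  show "{u + v | u v. u \<in> translate N x \<and> v \<in> translate N y} \<subseteq> translate N (x + y)"
  proof
    fix z assume "z \<in> {u + v | u v. u \<in> translate N x \<and> v \<in> translate N y}"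
    then obtain s t where "z = (s + x) + (t + y)" "s \<in> N" "t \<in> N" by (auto simp: translate_def)
    then have "z = (s + t) + (x + y)" "s + t \<in> N" using zsub_add[OF N] by auto
    then show "z \<in> translate N (x + y)" unfolding translate_def by blast
  qed
  show "translate N (x + y) \<subseteq> {u + v | u v. u \<in> translate N x \<and> v \<in> translate N y}"
  proof
    fix z assume "z \<in> translate N (x + y)"
    then obtain s where "z = (s + x) + (0 + y)" "s \<in> N" by (auto simp: translate_def)
    then show "z \<in> {u + v | u v. u \<in> translate N x \<and> v \<in> translate N y}"
      using zsub_0[OF N] unfolding translate_def by blast
  qed
qed

lemma image_translate: "linear g \<Longrightarrow> g ` translate N x = translate (g ` N) (g x)"
  by (simp add: translate_def Setcompr_eq_image image_image linear_add)

section \<open>The discriminant group, \<open>O(L)\<close>, \<open>O(D)\<close> and the reduction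
  between them\<close>

context nondegenerate_lattice
begin

abbreviation dcoset :: "'v \<Rightarrow> 'v set" where "dcoset \<equiv> translate L"

lemmas dcoset_eq = translate_def[of L] and dcoset_eq_iff = translate_eq_iff[OF L_subspace]

lemma plane_type_eq: "plane_type B L U = dcoset ` (L' \<inter> U)"
  by (simp add: plane_type_def r_coset_additive)

lemma carrier_disc: "carrier (disc_group B L) = dcoset ` L'"
  by (simp add: disc_group_def carrier_quotient)

lemma mult_disc: "dcoset x \<otimes>\<^bsub>disc_group B L\<^esub> dcoset y = dcoset (x + y)"
  unfolding disc_group_def mult_quotient by (rule translate_add[OF L_subspace])

abbreviation "O_L \<equiv> carrier (OL B L)"
abbreviation "O_D \<equiv> carrier (OD B L)"

lemma disc_q_dcoset:
  assumes "x \<in> L'"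
  shows "disc_q B (dcoset x) = {r. r - B x x / 2 \<in> \<int>}"
proof -
  have "r - B (l + x) (l + x) / 2 \<in> \<int> \<longleftrightarrow> r - B x x / 2 \<in> \<int>" if "l \<in> L" for l r
  proof -
    have "r - B (l + x) (l + x) / 2 = (r - B x x / 2) - (B l l / 2 + B x l)"
      using sym[of l x] by (simp add: field_simps)
    moreover have "B l l / 2 + B x l \<in> \<int>"
      using L.half_integral[OF that] dual_pairing(1)[OF assms that] by (rule Ints_add)
    ultimately show ?thesis by (metis Ints_add Ints_diff diff_add_cancel)
  qed
  then show ?thesis using zsub_0[OF L_subspace] unfolding disc_q_def dcoset_eq by blast
qed

lemma disc_q_eq_iff:
  assumes "x \<in> L'" "y \<in> L'"
  shows "disc_q B (dcoset x) = disc_q B (dcoset y) \<longleftrightarrow> B x x / 2 - B y y / 2 \<in> \<int>"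
proof
  assume "disc_q B (dcoset x) = disc_q B (dcoset y)"
  moreover have "B x x / 2 \<in> disc_q B (dcoset x)" by (simp add: disc_q_dcoset assms)
  ultimately show "B x x / 2 - B y y / 2 \<in> \<int>" by (simp add: disc_q_dcoset assms)
next
  assume *: "B x x / 2 - B y y / 2 \<in> \<int>"
  have "r - B x x / 2 \<in> \<int> \<longleftrightarrow> r - B y y / 2 \<in> \<int>" for r
  proof -
    have "r - B y y / 2 = (r - B x x / 2) + (B x x / 2 - B y y / 2)" by simp
    then show ?thesis using * by (metis Ints_add Ints_diff add_diff_cancel_right')
  qed
  then show "disc_q B (dcoset x) = disc_q B (dcoset y)" by (simp add: disc_q_dcoset assms)
qed

lemma OL_iff: "f \<in> O_L \<longleftrightarrow> linear f \<and> (\<forall>x y. B (f x) (f y) = B x y) \<and> f ` L = L"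
  by (simp add: OL_def)

lemma OLD:
  assumes "f \<in> O_L"
  shows "linear f" "B (f x) (f y) = B x y" "f ` L = L" "bij f" "x \<in> L \<Longrightarrow> f x \<in> L" "f x \<in> L \<Longrightarrow> x \<in> L"
    "f ` L' = L'" "x \<in> L' \<Longrightarrow> f x \<in> L'"
proof -
  show f: "linear f" "\<And>x y. B (f x) (f y) = B x y" "f ` L = L" using assms by (auto simp: OL_iff)
  have "inj f"
  proof (subst linear_inj_iff_eq_0[OF f(1)], intro allI impI)
    fix x assume "f x = 0"
    then have "B x y = 0" for y using f(2)[of x y] by simp
    then show "x = 0" by (rule nondegenerate)
  qed
  then show bij: "bij f" using linear_inj_imp_surj[OF f(1)] by (simp add: bij_def)
  have mem: "f x \<in> f ` A \<longleftrightarrow> x \<in> A" for x A using bij by (simp add: bij_is_inj inj_image_mem_iff)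
  show "x \<in> L \<Longrightarrow> f x \<in> L" "f x \<in> L \<Longrightarrow> x \<in> L" for x using mem[of x L] f(3) by simp_all
  have dual: "f x \<in> L' \<longleftrightarrow> x \<in> L'" for x
  proof -
    have "(\<forall>y\<in>L. B (f x) y \<in> \<int>) \<longleftrightarrow> (\<forall>y\<in>f ` L. B (f x) y \<in> \<int>)" by (simp add: f(3))
    then show ?thesis by (simp add: dual_iff f(2))
  qed
  then show "x \<in> L' \<Longrightarrow> f x \<in> L'" for x by simp
  show "f ` L' = L'"
  proof
    show "f ` L' \<subseteq> L'" using dual by auto
    show "L' \<subseteq> f ` L'"
    proof
      fix y assume "y \<in> L'"
      obtain x where "y = f x" using bij by (metis bij_pointE)
      then show "y \<in> f ` L'" using dual \<open>y \<in> L'\<close> by auto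
    qed
  qed
qed

lemma OL_comp: "f \<in> O_L \<Longrightarrow> g \<in> O_L \<Longrightarrow> f \<circ> g \<in> O_L"
  unfolding OL_iff image_comp[symmetric] by (simp add: linear_compose)

lemma OL_id: "id \<in> O_L"
  by (simp add: OL_iff linear_id)

lemma OL_inv:
  assumes "f \<in> O_L"
  shows "inv_into UNIV f \<in> O_L"
proof -
  note f = OLD[OF assms]
  have i: "inv_into UNIV f (f x) = x" "f (inv_into UNIV f x) = x" for x
    using f(4) by (simp_all add: bij_is_inj bij_is_surj surj_f_inv_f)
  have "B (inv_into UNIV f x) (inv_into UNIV f y) = B x y" for x y
    using f(2)[of "inv_into UNIV f x" "inv_into UNIV f y"] i by simp
  moreover have "inv_into UNIV f ` L = L" by (metis f(3,4) bij_is_inj image_inv_f_f)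
  ultimately show ?thesis
    using f(1,4) by (simp add: OL_iff bij_is_inj bij_is_surj inj_linear_imp_inv_linear)
qed

lemma OL_inv_comp:
  assumes "f \<in> O_L"
  shows "inv_into UNIV f \<circ> f = id" "f \<circ> inv_into UNIV f = id"
  using OLD(4)[OF assms] by (simp_all add: bij_is_inj fun_eq_iff bij_is_surj surj_f_inv_f)

lemma OL_mult: "f \<otimes>\<^bsub>OL B L\<^esub> g = f \<circ> g" and OL_one: "\<one>\<^bsub>OL B L\<^esub> = id"
  by (simp_all add: OL_def)

lemma OL_group: "group (OL B L)"
proof (rule groupI)
  fix f assume f: "f \<in> O_L"
  show "\<exists>g\<in>O_L. g \<otimes>\<^bsub>OL B L\<^esub> f = \<one>\<^bsub>OL B L\<^esub>"
    using OL_inv[OF f] OL_inv_comp[OF f] by (auto simp: OL_mult OL_one)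
qed (auto simp: OL_mult OL_one OL_comp OL_id o_assoc)

lemma image_dcoset: "f \<in> O_L \<Longrightarrow> f ` dcoset x = dcoset (f x)"
  by (simp add: image_translate[OF OLD(1)] OLD(3))

lemma red_dcoset: "f \<in> O_L \<Longrightarrow> x \<in> L' \<Longrightarrow> red B L f (dcoset x) = dcoset (f x)"
  by (simp add: red_def carrier_disc image_dcoset)

lemma red_Bij:
  assumes "f \<in> O_L"
  shows "red B L f \<in> Bij (carrier (disc_group B L))"
proof -
  have "bij_betw (red B L f) (dcoset ` L') (dcoset ` L')"
  proof (rule bij_betwI')
    fix X Y assume "X \<in> dcoset ` L'" "Y \<in> dcoset ` L'"
    then obtain x y where xy: "x \<in> L'" "y \<in> L'" "X = dcoset x" "Y = dcoset y" by blast
    then show "red B L f X = red B L f Y \<longleftrightarrow> X = Y"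
      using OLD(5,6)[OF assms, of "x - y"]
      by (auto simp: red_dcoset[OF assms] dcoset_eq_iff linear_diff[OF OLD(1)[OF assms]])
    show "red B L f X \<in> dcoset ` L'" using xy OLD(8)[OF assms] by (simp add: red_dcoset[OF assms])
  next
    fix Y assume "Y \<in> dcoset ` L'"
    then obtain y where "y \<in> f ` L'" "Y = dcoset y" using OLD(7)[OF assms] by blast
    then show "\<exists>X\<in>dcoset ` L'. Y = red B L f X" using red_dcoset[OF assms] by auto
  qed
  then show ?thesis by (simp add: Bij_def carrier_disc red_def)
qed

lemma carrier_OD: "O_D = {f \<in> hom (disc_group B L) (disc_group B L) \<inter> Bij (carrier (disc_group B L)).
    \<forall>X\<in>carrier (disc_group B L). disc_q B (f X) = disc_q B X}"
  by (simp add: OD_def auto_def)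

lemma red_OD:
  assumes "f \<in> O_L"
  shows "red B L f \<in> O_D"
proof -
  have "red B L f \<in> hom (disc_group B L) (disc_group B L)"
    unfolding hom_def carrier_disc
    using OLD(8)[OF assms] zsub_add[OF dual_subspace]
    by (auto simp: red_dcoset[OF assms] mult_disc linear_add[OF OLD(1)[OF assms]])
  moreover have "disc_q B (red B L f (dcoset x)) = disc_q B (dcoset x)" if "x \<in> L'" for x
    using that OLD(8)[OF assms that] by (simp add: red_dcoset[OF assms] disc_q_eq_iff OLD(2)[OF assms])
  ultimately show ?thesis using red_Bij[OF assms] by (auto simp: carrier_OD carrier_disc)
qed

lemma OD_mult:
  assumes "\<sigma> \<in> O_D" "\<tau> \<in> O_D"
  shows "\<sigma> \<otimes>\<^bsub>OD B L\<^esub> \<tau> = compose (carrier (disc_group B L)) \<sigma> \<tau>"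
  using assms unfolding carrier_OD by (simp add: OD_def AutoGroup_def BijGroup_def)

lemma red_comp:
  assumes "f \<in> O_L" "g \<in> O_L"
  shows "red B L (f \<circ> g) = red B L f \<otimes>\<^bsub>OD B L\<^esub> red B L g"
  unfolding OD_mult[OF red_OD[OF assms(1)] red_OD[OF assms(2)]]
  using OLD(8)[OF assms(2)]
  by (auto simp: fun_eq_iff red_def compose_def carrier_disc image_dcoset[OF assms(2)] image_dcoset[OF assms(1)] image_comp[symmetric])

lemma red_one: "red B L id = \<one>\<^bsub>OD B L\<^esub>"
  by (simp add: red_def OD_def AutoGroup_def BijGroup_def)

lemma OD_dcoset_0:
  assumes "\<sigma> \<in> O_D"
  shows "\<sigma> (dcoset 0) = dcoset 0"
proof -
  have 0: "0 \<in> L'" using zsub_0[OF dual_subspace] .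
  have s: "\<sigma> \<in> hom (disc_group B L) (disc_group B L)" using assms by (simp add: carrier_OD)
  obtain u where u: "u \<in> L'" "\<sigma> (dcoset 0) = dcoset u"
    using s 0 unfolding hom_def carrier_disc by blast
  have "\<sigma> (dcoset 0 \<otimes>\<^bsub>disc_group B L\<^esub> dcoset 0) = \<sigma> (dcoset 0) \<otimes>\<^bsub>disc_group B L\<^esub> \<sigma> (dcoset 0)"
    using s 0 by (simp add: hom_def carrier_disc)
  then have "dcoset (u + u) = dcoset u" unfolding mult_disc u(2) by (simp add: u(2))
  then show ?thesis using u(2) by (simp add: dcoset_eq_iff)
qed

end

context hyperbolic_lattice
begin

text \<open>The pairs are ordered so that membership of \<open>(g x, x)\<close> means that
  \<open>g\<close> induces \<sigma> on the class of \<open>x\<close>. Preservation of the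
  discriminant quadratic form becomes evenness of \<open>bb\<close>.\<close>

lemma OD_glue:
  assumes \<sigma>: "\<sigma> \<in> O_D"
  shows "glue {(x, y). x \<in> L' \<and> y \<in> L' \<and> \<sigma> (dcoset y) = dcoset x}" (is "glue ?G")
proof -
  have hom: "\<sigma> (dcoset (x + y)) = dcoset (x' + y')"
    if "x \<in> L'" "y \<in> L'" "\<sigma> (dcoset x) = dcoset x'" "\<sigma> (dcoset y) = dcoset y'" for x y x' y'
    using \<sigma> that unfolding carrier_OD hom_def carrier_disc by (auto simp flip: mult_disc)
  have car: "\<exists>x\<in>L'. \<sigma> (dcoset y) = dcoset x" if "y \<in> L'" for y
    using \<sigma> that unfolding carrier_OD hom_def carrier_disc by blast
  have surj: "\<exists>y\<in>L'. \<sigma> (dcoset y) = dcoset x" if "x \<in> L'" for x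
  proof -
    have "\<sigma> ` dcoset ` L' = dcoset ` L'" using \<sigma> by (simp add: carrier_OD Bij_def bij_betw_def carrier_disc)
    then show ?thesis using that by (metis (no_types, lifting) imageE imageI)
  qed
  have q: "B x x / 2 - B y y / 2 \<in> \<int>" if "x \<in> L'" "y \<in> L'" "\<sigma> (dcoset y) = dcoset x" for x y
  proof -
    have "disc_q B (dcoset x) = disc_q B (dcoset y)" using \<sigma> that by (auto simp: carrier_OD carrier_disc)
    then show ?thesis using disc_q_eq_iff that by blast
  qed
  have zero: "\<sigma> (dcoset 0) = dcoset 0" by (rule OD_dcoset_0[OF \<sigma>])
  have sub: "zmod.subspace ?G"
  proof (rule zsubI)
    show "0 \<in> ?G" using zero zsub_0[OF dual_subspace] by (auto simp: zero_prod_def)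
    fix z w assume zw: "z \<in> ?G" "w \<in> ?G"
    obtain x y x' y' where e: "z = (x, y)" "w = (x', y')" by (metis prod.exhaust)
    with zw have L: "x \<in> L'" "y \<in> L'" "x' \<in> L'" "y' \<in> L'" "\<sigma> (dcoset y) = dcoset x" "\<sigma> (dcoset y') = dcoset x'" by auto
    have d: "y - y' \<in> L'" "x - x' \<in> L'" using L zsub_diff[OF dual_subspace] by auto
    obtain u where u: "u \<in> L'" "\<sigma> (dcoset (y - y')) = dcoset u" using car[OF d(1)] by blast
    from hom[OF d(1) L(4) u(2) L(6)] have "dcoset x = dcoset (u + x')" using L(5) by simp
    then have "dcoset (x - x') = dcoset u" by (simp add: dcoset_eq_iff algebra_simps)
    then show "z - w \<in> ?G" using u d by (simp add: e)
  qed
  have "L \<times> L \<subseteq> ?G"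
  proof
    fix z assume "z \<in> L \<times> L"
    then obtain x y where xy: "z = (x, y)" "x \<in> L" "y \<in> L" by blast
    then have "dcoset x = dcoset 0" "dcoset y = dcoset 0" by (simp_all add: dcoset_eq_iff)
    then show "z \<in> ?G" using zero xy L_sub_dual by auto
  qed
  moreover have "\<forall>z\<in>?G. bb z z / 2 \<in> \<int>" using q by (auto simp: bb_def diff_divide_distrib)
  moreover have "\<forall>x. (x, 0) \<in> ?G \<longrightarrow> x \<in> L"
    using zero dcoset_eq_iff[of _ 0] by (auto simp del: dcoset_eq_iff)
  moreover have "?G \<subseteq> L' \<times> L'" by auto
  moreover have "\<forall>y\<in>L'. \<exists>x. (x, y) \<in> ?G" "\<forall>x\<in>L'. \<exists>y. (x, y) \<in> ?G" using car surj by blast+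
  ultimately show ?thesis unfolding glue_def using sub by (intro conjI)
qed

theorem red_surj:
  assumes \<sigma>: "\<sigma> \<in> O_D"
  shows "\<exists>g\<in>O_L. red B L g = \<sigma>"
proof -
  obtain g where g: "linear g" "\<forall>x y. B (g x) (g y) = B x y" "g ` L = L"
    "\<forall>x\<in>L'. (g x, x) \<in> {(x, y). x \<in> L' \<and> y \<in> L' \<and> \<sigma> (dcoset y) = dcoset x}"
    using glue_lift[OF OD_glue[OF \<sigma>]] by (elim exE conjE) (rule that)
  then have g4: "\<sigma> (dcoset x) = dcoset (g x)" if "x \<in> L'" for x using that by blast
  have gO: "g \<in> O_L" using g by (simp add: OL_iff)
  have ext: "\<sigma> \<in> extensional (carrier (disc_group B L))" using \<sigma> by (simp add: carrier_OD Bij_def)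
  have "red B L g = \<sigma>"
  proof (rule extensionalityI[OF _ ext])
    show "red B L g \<in> extensional (carrier (disc_group B L))" by (simp add: red_def)
    show "red B L g X = \<sigma> X" if "X \<in> carrier (disc_group B L)" for X
      using that g4 red_dcoset[OF gO] by (auto simp: carrier_disc)
  qed
  then show ?thesis using gO by blast
qed

end

section \<open>Components of the period domain\<close>

lemma cscale_cscale: "cscale c (cscale d z) = cscale (c * d) z"
  by (simp add: cscale_def algebra_simps scaleR_scaleR)

lemma cline_cscale: "c \<noteq> 0 \<Longrightarrow> cline (cscale c z) = cline z"
proof -
  assume c: "c \<noteq> 0"
  have "cscale d z \<in> range (\<lambda>d. cscale (d * c) z)" for d
    using c by (intro image_eqI[of _ _ "d / c"]) auto
  then show ?thesis unfolding cline_def cscale_cscale by auto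
qed

lemma cscale_linear: "linear g \<Longrightarrow> map_prod g g (cscale c z) = cscale c (map_prod g g z)"
  by (cases z) (simp add: cscale_def linear_add linear_diff linear_scale)

lemma cline_linear: "linear g \<Longrightarrow> map_prod g g ` cline z = cline (map_prod g g z)"
  by (simp add: cline_def image_image cscale_linear)

lemma topspace_proj: "topspace proj_topology = (proj_space :: ('v \<times> 'v::euclidean_space) set set)"
proof -
  have "{z :: 'v \<times> 'v. z \<noteq> 0 \<and> cline z \<in> proj_space} = - {0}" by (auto simp: proj_space_def)
  then have "openin proj_topology (proj_space :: ('v \<times> 'v) set set)" by (simp add: openin_proj_topology open_Compl)
  then have "proj_space \<subseteq> topspace (proj_topology :: ('v \<times> 'v) set topology)" by (rule openin_subset)
  moreover have "topspace proj_topology \<subseteq> (proj_space :: ('v \<times> 'v) set set)"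
    using openin_topspace[of proj_topology] unfolding openin_proj_topology by (rule conjunct1)
  ultimately show ?thesis by simp
qed

lemma continuous_cline: "continuous_map (top_of_set (- {0})) proj_topology (cline :: 'v \<times> 'v::euclidean_space \<Rightarrow> _)"
  unfolding continuous_map_def topspace_proj
proof (intro conjI allI impI funcsetI)
  fix W :: "('v \<times> 'v) set set" assume "openin proj_topology W"
  then have "open {z. z \<noteq> 0 \<and> cline z \<in> W}" by (simp add: openin_proj_topology)
  moreover have "{z \<in> topspace (top_of_set (- {0})). cline z \<in> W} = - {0} \<inter> {z. z \<noteq> 0 \<and> cline z \<in> W}" by auto
  ultimately show "openin (top_of_set (- {0})) {z \<in> topspace (top_of_set (- {0})). cline z \<in> W}"
    unfolding openin_open by blast
qed (auto simp: proj_space_def)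

lemma continuous_proj_linear:
  assumes g: "linear (g :: 'v::euclidean_space \<Rightarrow> 'v)" "inj g"
  shows "continuous_map proj_topology proj_topology (\<lambda>p. map_prod g g ` p)"
  unfolding continuous_map_def topspace_proj
proof (intro conjI allI impI funcsetI)
  have g0: "map_prod g g z = 0 \<longleftrightarrow> z = 0" for z
    using linear_inj_iff_eq_0[OF g(1)] g(2) linear_0[OF g(1)] by (cases z) (auto simp: zero_prod_def)
  show "map_prod g g ` p \<in> proj_space" if p: "p \<in> proj_space" for p
  proof -
    obtain z where "z \<noteq> 0" "p = cline z" using p unfolding proj_space_def by blast
    then have "map_prod g g z \<noteq> 0" "map_prod g g ` p = cline (map_prod g g z)"
      by (simp_all only: g0 cline_linear[OF g(1)] not_False_eq_True)
    then show ?thesis unfolding proj_space_def by (intro image_eqI) auto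
  qed
  fix W :: "('v \<times> 'v) set set" assume "openin proj_topology W"
  then have "open {z. z \<noteq> 0 \<and> cline z \<in> W}" by (simp add: openin_proj_topology)
  moreover have "continuous_on UNIV (map_prod g g)"
    unfolding map_prod_def case_prod_unfold
    by (intro continuous_on_Pair linear_continuous_on_compose[OF _ g(1)] continuous_intros)
  ultimately have "open (map_prod g g -` {z. z \<noteq> 0 \<and> cline z \<in> W})"
    by (rule open_vimage)
  moreover have "map_prod g g -` {z. z \<noteq> 0 \<and> cline z \<in> W} =
      {z. z \<noteq> 0 \<and> cline z \<in> {p \<in> proj_space. map_prod g g ` p \<in> W}}"
    by (auto simp: g0 cline_linear[OF g(1)] proj_space_def)
  ultimately show "openin proj_topology {p \<in> proj_space. map_prod g g ` p \<in> W}"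
    by (simp add: openin_proj_topology)
qed

section \<open>Negative definite planes and the components of the period domain\<close>

context symmetric_bilinear
begin

lemma orthogonal_independent:
  assumes "finite A" "\<And>v. v \<in> A \<Longrightarrow> b v v \<noteq> 0" "\<And>v w. v \<in> A \<Longrightarrow> w \<in> A \<Longrightarrow> v \<noteq> w \<Longrightarrow> b v w = 0"
  shows "independent A"
  unfolding independent_explicit_module
proof (intro allI impI)
  fix t u v assume t: "finite t" "t \<subseteq> A" "(\<Sum>v\<in>t. u v *\<^sub>R v) = 0" "v \<in> t"
  have "0 = b v (\<Sum>v\<in>t. u v *\<^sub>R v)" by (simp add: t(3))
  also have "\<dots> = (\<Sum>w\<in>t. if w = v then u v * b v v else 0)"
    unfolding form_sum by (rule sum.cong) (use t assms(3)[of v] in auto)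
  also have "\<dots> = u v * b v v" using t by simp
  finally show "u v = 0" using assms(2) t by auto
qed

text \<open>The vectors \<open>x + iy\<close> above the period domain: \<open>x\<close> and
  \<open>y\<close> form an orthogonal basis of a negative definite plane with equal norms, so a
  point of the domain is such a plane with an orientation.\<close>

definition cone :: "('w \<times> 'w) set" where
  "cone = {(x, y). b x x = b y y \<and> b x y = 0 \<and> b x x < 0}"

lemma period_domain_eq: "period_domain b = cline ` cone"
proof -
  have "z \<noteq> 0 \<and> cform b z z = 0 \<and> Re (cform b z (cconj z)) < 0 \<longleftrightarrow> z \<in> cone" for z :: "'w \<times> 'w"
    using sym[of "snd z" "fst z"]
    by (cases z) (auto simp: cone_def cform_def cconj_def zero_prod_def complex_eq_iff)
  then show ?thesis unfolding period_domain_def by blast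
qed

lemma cone_nonzero: "z \<in> cone \<Longrightarrow> z \<noteq> 0"
  by (auto simp: cone_def zero_prod_def)

lemma isometry_cone: "(\<And>x y. b (g x) (g y) = b x y) \<Longrightarrow> map_prod g g z \<in> cone \<longleftrightarrow> z \<in> cone"
  by (cases z) (simp add: cone_def)

abbreviation "period_space \<equiv> subtopology proj_topology (period_domain b)"

lemma period_domain_subset: "period_domain b \<subseteq> proj_space"
  using cone_nonzero by (auto simp: period_domain_eq proj_space_def)

lemma topspace_period: "topspace period_space = period_domain b"
  using period_domain_subset by (auto simp: topspace_proj)

lemma isometry_component:
  assumes g: "linear g" "inj g" "\<And>x y. b (g x) (g y) = b x y"
    and "connected_component_of period_space p q"
  shows "connected_component_of period_space (map_prod g g ` p) (map_prod g g ` q)"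
proof -
  have "map_prod g g ` p \<in> period_domain b" if "p \<in> period_domain b" for p
    using that isometry_cone[OF g(3)] by (auto simp: period_domain_eq cline_linear[OF g(1)])
  then have "continuous_map period_space period_space (\<lambda>p. map_prod g g ` p)"
    using continuous_proj_linear[OF g(1,2)] topspace_period
    by (intro continuous_map_into_subtopology continuous_map_from_subtopology) auto
  then show ?thesis
    using assms(4) connectedin_continuous_map_image unfolding connected_component_of_def by fast
qed

lemma path_component:
  assumes \<gamma>: "continuous_on {0..1} \<gamma>" "\<And>t. t \<in> {0..1} \<Longrightarrow> \<gamma> t \<in> cone"
  shows "connected_component_of period_space (cline (\<gamma> (0::real))) (cline (\<gamma> 1))"
proof -
  have "continuous_map (top_of_set {0..1}) (top_of_set (- {0})) \<gamma>"
    using \<gamma> cone_nonzero by auto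
  from continuous_map_compose[OF this continuous_cline]
  have "continuous_map (top_of_set {0..1}) period_space (cline \<circ> \<gamma>)"
    using \<gamma>(2) by (intro continuous_map_into_subtopology) (auto simp: period_domain_eq)
  then have "connectedin period_space ((cline \<circ> \<gamma>) ` {0..1})"
    by (rule connectedin_continuous_map_image) (simp add: connectedin_subtopology)
  then show ?thesis
    unfolding connected_component_of_def by (intro exI[of _ "(cline \<circ> \<gamma>) ` {0..1}"]) auto
qed

text \<open>
  Shrinking the positive part of a negative definite plane keeps it negative definite, and
  Gram-Schmidt turns the resulting path of planes into a path in the period domain.
\<close>

lemma connected_to_base:
  assumes n: "b n1 n1 = -1" "b n2 n2 = -1" "b n1 n2 = 0"
    and pos: "\<And>p. b p n1 = 0 \<Longrightarrow> b p n2 = 0 \<Longrightarrow> b p p \<ge> 0"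
    and p: "p \<in> period_domain b"
  shows "connected_component_of period_space p (cline (n1, n2)) \<or>
    connected_component_of period_space p (cline (n1, - n2))"
proof -
  obtain x y where p': "p = cline (x, y)" and xy: "b x x = b y y" "b x y = 0" "b x x < 0"
    using p by (auto simp: period_domain_eq cone_def)
  have n21: "b n2 n1 = 0" using n sym by metis
  \<comment> \<open>\<open>N\<close> is the orthogonal projection to the span of \<open>n1\<close>
    and \<open>n2\<close>, the signs coming from their norm -1. \<open>T t\<close> scales by
    \<open>t\<close> the complementary part, on which \<open>b\<close> is nonnegative.\<close>
  define N where "N w = - b w n1 *\<^sub>R n1 - b w n2 *\<^sub>R n2" for w
  define T where "T t w = N w + t *\<^sub>R (w - N w)" for t :: real and w
  have linT: "linear (T t)" for t
    by (rule linearI) (simp_all add: T_def N_def algebra_simps)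
  have TT: "b (T t w) (T t w) = b (N w) (N w) + t^2 * b (w - N w) (w - N w)" for t w
    using n n21 sym[of n1 w] sym[of n2 w] by (simp add: T_def N_def algebra_simps power2_eq_square)
  have neg: "b (T t w) (T t w) < 0" if "b w w < 0" "t \<in> {0..1}" for t w
  proof -
    have "b (w - N w) (w - N w) \<ge> 0"
      using n n21 by (intro pos) (simp_all add: N_def)
    moreover have "t^2 \<le> 1" using that(2) by (simp add: power_le_one)
    ultimately have "b (T t w) (T t w) \<le> b (T 1 w) (T 1 w)"
      unfolding TT using mult_right_mono[of "t^2" 1] by (simp del: form_simps)
    also have "T 1 w = w" by (simp add: T_def)
    finally show ?thesis using that by simp
  qed
  define c where "c t = b (T t x) (T t y) / b (T t x) (T t x)" for t
  define v where "v t = T t (y - c t *\<^sub>R x)" for t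
  \<comment> \<open>Both norms are negative, so the quotient is positive; the factor gives the two
    vectors equal norms.\<close>
  define s where "s t = sqrt (b (T t x) (T t x) / b (v t) (v t))" for t
  define \<gamma> where "\<gamma> t = (T t x, s t *\<^sub>R v t)" for t
  have x_neg: "b (T t x) (T t x) < 0" if "t \<in> {0..1}" for t using neg xy that by blast
  have v_neg: "b (v t) (v t) < 0" if "t \<in> {0..1}" for t
  proof -
    have "b (y - c t *\<^sub>R x) (y - c t *\<^sub>R x) = (1 + (c t)^2) * b x x"
      using xy sym[of y x] by (simp add: algebra_simps power2_eq_square)
    also have "\<dots> < 0" using xy by (simp add: mult_pos_neg add_pos_nonneg)
    finally show ?thesis using neg that by (simp add: v_def)
  qed
  have xv: "b (T t x) (v t) = 0" if "t \<in> {0..1}" for t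
    using x_neg[OF that] by (simp add: v_def linear_diff[OF linT] linear_scale[OF linT] c_def)
  have cone: "\<gamma> t \<in> cone" if t: "t \<in> {0..1}" for t
  proof -
    have "(s t)^2 = b (T t x) (T t x) / b (v t) (v t)"
      using x_neg[OF t] v_neg[OF t] by (simp add: s_def divide_nonpos_neg)
    then have "s t * (s t * b (v t) (v t)) = b (T t x) (T t x)"
      using v_neg[OF t] by (simp add: power2_eq_square field_simps)
    then show ?thesis using x_neg[OF t] xv[OF t] by (simp add: \<gamma>_def cone_def)
  qed
  have contb: "continuous_on {0..1} (\<lambda>t. b (f t) (g t))"
    if "continuous_on {0..1} f" "continuous_on {0..1} g" for f g :: "real \<Rightarrow> 'w"
    by (rule bilinear_continuous_on_compose[OF that bilinear])
  have contT: "continuous_on {0..1} (\<lambda>t. T t w)" for w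
    unfolding T_def by (intro continuous_intros)
  have contc: "continuous_on {0..1} c"
    unfolding c_def using x_neg by (intro continuous_on_divide contb contT) force+
  have v_eq: "v t = T t y - c t *\<^sub>R T t x" for t
    by (simp add: v_def linear_diff[OF linT] linear_scale[OF linT])
  have contv: "continuous_on {0..1} v"
    unfolding v_eq by (intro continuous_intros contT contc)
  have "continuous_on {0..1} \<gamma>"
    unfolding \<gamma>_def s_def using v_neg
    by (intro continuous_on_Pair continuous_on_scaleR continuous_on_real_sqrt continuous_on_divide contb contT contv)
      force
  then have conn: "connected_component_of period_space (cline (\<gamma> 0)) (cline (\<gamma> 1))"
    using cone by (rule path_component)
  have "\<gamma> 1 = (x, y)"
    using xy by (simp add: \<gamma>_def s_def v_def c_def T_def)
  moreover have "cline (\<gamma> 0) = cline (n1, n2) \<or> cline (\<gamma> 0) = cline (n1, - n2)"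
  proof -
    define a1 a2 where "a1 = - b x n1" and "a2 = - b x n2"
    define d1 d2 where "d1 = - s 0 * b (y - c 0 *\<^sub>R x) n1" and "d2 = - s 0 * b (y - c 0 *\<^sub>R x) n2"
    have g0: "\<gamma> 0 = (a1 *\<^sub>R n1 + a2 *\<^sub>R n2, d1 *\<^sub>R n1 + d2 *\<^sub>R n2)"
      by (simp add: \<gamma>_def v_def T_def N_def a1_def a2_def d1_def d2_def scaleR_diff_right)
        (simp add: algebra_simps)
    have "a1^2 + a2^2 = d1^2 + d2^2" "a1 * d1 + a2 * d2 = 0" "a1^2 + a2^2 > 0"
      using cone[of 0] n n21 by (auto simp: g0 cone_def power2_eq_square algebra_simps)
    \<comment> \<open>In the plane of \<open>n1\<close> and \<open>n2\<close>, two orthogonal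
      vectors of equal norm differ by a quarter turn in one of the two directions; \<open>k\<close>
      is its sign. The two directions lead to the two base points.\<close>
    then have "(d1 = - a2 \<and> d2 = a1) \<or> (d1 = a2 \<and> d2 = - a1)"
    proof -
      assume h: "a1^2 + a2^2 = d1^2 + d2^2" "a1 * d1 + a2 * d2 = 0" "a1^2 + a2^2 > 0"
      define k where "k = (a1 * d2 - a2 * d1) / (a1^2 + a2^2)"
      have "d1 * (a1^2 + a2^2) = - (a1 * d2 - a2 * d1) * a2" "d2 * (a1^2 + a2^2) = (a1 * d2 - a2 * d1) * a1"
        using h(2) by algebra+
      moreover have "k * (a1^2 + a2^2) = a1 * d2 - a2 * d1" using h(3) by (simp add: k_def)
      ultimately have "d1 * (a1^2 + a2^2) = (- k * a2) * (a1^2 + a2^2)" "d2 * (a1^2 + a2^2) = (k * a1) * (a1^2 + a2^2)"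
        by algebra+
      moreover have nz: "a1^2 + a2^2 \<noteq> 0" using h(3) by linarith
      ultimately have "d1 = - k * a2" "d2 = k * a1" by (simp_all only: mult_right_cancel[OF nz])
      moreover from this have "k^2 * (a1^2 + a2^2) = a1^2 + a2^2"
        using h(1) by algebra
      then have "k^2 * (a1^2 + a2^2) = 1 * (a1^2 + a2^2)" by simp
      then have "k^2 = 1" by (simp only: mult_right_cancel[OF nz])
      then have "k = 1 \<or> k = -1" by (simp add: power2_eq_1_iff)
      ultimately show ?thesis by auto
    qed
    moreover have nz: "Complex a1 e \<noteq> 0" if "e = a2 \<or> e = - a2" for e
      using \<open>a1^2 + a2^2 > 0\<close> that by (auto simp: complex_eq_iff)
    ultimately consider "\<gamma> 0 = cscale (Complex a1 (- a2)) (n1, n2)" | "\<gamma> 0 = cscale (Complex a1 a2) (n1, - n2)"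
      by (auto simp: g0 cscale_def)
    then show ?thesis using nz cline_cscale by metis
  qed
  ultimately show ?thesis using conn p' connected_component_of_sym by metis
qed

text \<open>The base plane is adapted to the hyperbolic plane: \<open>n1\<close> lies in the span of
  \<open>e\<close> and \<open>f\<close> and \<open>n2\<close> is orthogonal to it, so that
  \<open>plane_reflection e f\<close> will reverse the orientation of the base plane.\<close>

lemma negative_plane:
  assumes sig: "signature b m 2 TYPE('w)" and ef: "b e e = 0" "b f f = 0" "b e f = 1"
  obtains n1 n2 where "b n1 n1 = -1" "b n2 n2 = -1" "b n1 n2 = 0"
    "n1 = (1 / sqrt 2) *\<^sub>R (e - f)" "b n2 e = 0" "b n2 f = 0"
    "\<And>p. b p n1 = 0 \<Longrightarrow> b p n2 = 0 \<Longrightarrow> b p p \<ge> 0"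
proof -
  have fe: "b f e = 1" using ef sym by metis
  obtain P M where PM0: "subspace P" "subspace M" "dim P = m" "dim M = 2"
    "\<forall>x\<in>P - {0}. b x x > 0" "\<forall>x\<in>M - {0}. b x x < 0"
    "{x + y | x y. x \<in> P \<and> y \<in> M} = UNIV"
    using sig unfolding signature_def by (elim exE conjE) (rule that)
  then have PM: "subspace P" "subspace M" "dim P = m" "dim M = 2"
    "\<And>x. x \<in> P \<Longrightarrow> x \<noteq> 0 \<Longrightarrow> b x x > 0" "\<And>x. x \<in> M \<Longrightarrow> x \<noteq> 0 \<Longrightarrow> b x x < 0"
    "{x + y | x y. x \<in> P \<and> y \<in> M} = UNIV"
    by simp_all
  have dimU: "dim (UNIV :: 'w set) \<le> m + 2"
    using dim_sums_Int[OF PM(1,2)] PM(3,4,7) by simp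
  obtain S where S: "S \<subseteq> M" "independent S" "card S = 2" using basis_exists[of M] PM(4) by metis
  then obtain a c where ac: "S = {a, c}" "a \<noteq> c" by (meson card_2_iff)
  have "\<exists>w\<in>M. w \<noteq> 0 \<and> b w (e - f) = 0"
  proof (cases "b a (e - f) = 0")
    case True
    then show ?thesis using S ac dependent_zero[of S] by (intro bexI[of _ a]) auto
  next
    case False
    define w where "w = b c (e - f) *\<^sub>R a - b a (e - f) *\<^sub>R c"
    have "w \<noteq> 0"
    proof
      assume "w = 0"
      then have "c = (b c (e - f) / b a (e - f)) *\<^sub>R a"
        using False by (simp add: w_def eq_vector_fraction_iff divide_simps del: form_simps)
      then have "c \<in> span {a}" by (metis span_breakdown_eq span_base span_scale singletonI)
      moreover have "independent (insert c {a})" using S ac by (simp add: insert_commute)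
      ultimately show False using ac by (simp only: independent_insert) (simp split: if_splits)
    qed
    moreover have "w \<in> M" unfolding w_def using S ac PM(2) by (intro subspace_diff subspace_scale) auto
    moreover have "b w (e - f) = 0" by (simp add: w_def algebra_simps)
    ultimately show ?thesis by blast
  qed
  then obtain w where w: "w \<in> M" "w \<noteq> 0" "b w e = b w f" by auto
  \<comment> \<open>Since \<open>b w e = b w f\<close>, removing the components of \<open>w\<close>
    in the hyperbolic plane lowers its norm by \<open>2 * (b w f)^2\<close>, so it stays
    negative.\<close>
  define w1 where "w1 = w - b w f *\<^sub>R e - b w e *\<^sub>R f"
  have w1: "b w1 e = 0" "b w1 f = 0" using ef fe by (simp_all add: w1_def)
  have "b w1 w1 = b w w - 2 * (b w f)^2"
    using ef fe w(3) sym[of e w] sym[of f w] by (simp add: w1_def power2_eq_square algebra_simps)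
  then have w1n: "b w1 w1 < 0" using PM(6)[OF w(1,2)] by (smt (verit) zero_le_power2)
  define n1 n2 where "n1 = (1 / sqrt 2) *\<^sub>R (e - f)" and "n2 = (1 / sqrt (- b w1 w1)) *\<^sub>R w1"
  have n1: "b n1 n1 = -1" using ef fe by (simp add: n1_def field_simps)
  have n2: "b n2 n2 = -1" "b n2 e = 0" "b n2 f = 0"
    using w1n w1 by (simp_all add: n2_def field_simps real_sqrt_mult_self)
  have n12: "b n1 n2 = 0" "b n2 n1 = 0" using n2 sym[of n1 n2] by (simp_all add: n1_def)
  have "b p p \<ge> 0" if p: "b p n1 = 0" "b p n2 = 0" for p
  proof (rule ccontr)
    assume "\<not> b p p \<ge> 0"
    then have pn: "b p p < 0" by simp
    have np: "b n1 p = 0" "b n2 p = 0" using p sym by metis+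
    have dist: "n1 \<noteq> n2" "n1 \<noteq> p" "n2 \<noteq> p" using n1 n2 n12 np pn by auto
    \<comment> \<open>A further negative vector would span with \<open>n1\<close> and
      \<open>n2\<close> a three-dimensional negative definite space, which meets the positive space
      \<open>P\<close> for dimension reasons.\<close>
    have "independent {n1, n2, p}"
      by (rule orthogonal_independent) (use n1 n2 n12 np p pn in auto)
    then have d3: "dim (span {n1, n2, p}) = 3" using dist by (simp add: dim_eq_card_independent)
    have "dim {x + y | x y. x \<in> P \<and> y \<in> span {n1, n2, p}} \<le> m + 2"
      by (rule order_trans[OF dim_subset[OF subset_UNIV] dimU])
    then have "dim (P \<inter> span {n1, n2, p}) > 0"
      using dim_sums_Int[OF PM(1) subspace_span, of "{n1, n2, p}"] d3 PM(3) by linarith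
    then obtain x where x: "x \<in> P" "x \<in> span {n1, n2, p}" "x \<noteq> 0"
      by (metis Int_iff dim_eq_0 insertI1 less_numeral_extra(3) subsetI)
    then obtain i j k where "x = i *\<^sub>R n1 + j *\<^sub>R n2 + k *\<^sub>R p"
      by (auto simp: span_insert span_singleton) (metis add.commute diff_add_cancel diff_diff_eq)
    then have "b x x = - (i^2) - j^2 + k^2 * b p p"
      using n1 n2 n12 np p by (simp add: power2_eq_square algebra_simps)
    also have "\<dots> \<le> 0" using pn by (smt (verit) mult_nonneg_nonpos zero_le_power2)
    finally show False using PM(5)[OF x(1,3)] by simp
  qed
  then show ?thesis using that[of n1 n2] n1 n2 n12 by (simp add: n1_def)
qed

text \<open>For isotropic \<open>e\<close> and \<open>f\<close> with pairing 1 this is -1 on their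
  span and the identity on its orthogonal complement.\<close>

definition plane_reflection :: "'w \<Rightarrow> 'w \<Rightarrow> 'w \<Rightarrow> 'w" where
  "plane_reflection e f x = x - (2 * b x f) *\<^sub>R e - (2 * b x e) *\<^sub>R f"

lemma plane_reflection:
  assumes ef: "b e e = 0" "b f f = 0" "b e f = 1"
  shows "linear (plane_reflection e f)" "b (plane_reflection e f x) (plane_reflection e f y) = b x y"
    "plane_reflection e f (plane_reflection e f x) = x"
  using ef sym[of f e] sym[of e x] sym[of f x] sym[of e y] sym[of f y]
  by (auto intro!: linearI simp: plane_reflection_def algebra_simps)

text \<open>Every point of the domain is joined to \<open>c1\<close> or \<open>c2\<close>, and the
  reflection interchanges these base points because it negates \<open>n1\<close> and fixes
  \<open>n2\<close>. If \<open>g\<close> carries the base point of \<open>H\<close> into the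
  component of the other one, composing with the reflection brings it back.\<close>

lemma component_swap:
  assumes sig: "signature b m 2 TYPE('w)" and ef: "b e e = 0" "b f f = 0" "b e f = 1"
    and H: "H \<in> period_components b"
    and g: "linear g" "bij g" "\<And>x y. b (g x) (g y) = b x y"
  shows "(\<lambda>p. map_prod g g ` p) ` H = H \<or>
    (\<lambda>p. map_prod (plane_reflection e f \<circ> g) (plane_reflection e f \<circ> g) ` p) ` H = H"
proof -
  obtain n1 n2 where n: "b n1 n1 = -1" "b n2 n2 = -1" "b n1 n2 = 0"
    "n1 = (1 / sqrt 2) *\<^sub>R (e - f)" "b n2 e = 0" "b n2 f = 0"
    "\<And>p. b p n1 = 0 \<Longrightarrow> b p n2 = 0 \<Longrightarrow> b p p \<ge> 0"
    using negative_plane[OF sig ef] by blast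
  let ?R = "connected_component_of period_space"
  let ?r = "plane_reflection e f"
  have fe: "b f e = 1" using ef sym by metis
  note r = plane_reflection[OF ef]
  have rinj: "inj ?r" using r(3) by (metis injI)
  have rn: "?r n1 = - n1" "?r n2 = n2"
  proof -
    have "?r (q *\<^sub>R (e - f)) = - (q *\<^sub>R (e - f))" for q
    proof -
      have "?r (q *\<^sub>R (e - f)) = q *\<^sub>R (e - f) - (2 * q) *\<^sub>R e + (2 * q) *\<^sub>R f"
        using ef fe by (simp add: plane_reflection_def)
      also have "\<dots> = - (q *\<^sub>R (e - f))"
        by (simp only: mult_2 scaleR_add_left scaleR_diff_right) simp
      finally show ?thesis .
    qed
    then show "?r n1 = - n1" unfolding n(4) .
    show "?r n2 = n2" using n(5,6) by (simp add: plane_reflection_def)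
  qed
  define c1 c2 where "c1 = cline (n1, n2)" and "c2 = cline (n1, - n2)"
  have "cline (- n1, n2) = c2" "cline (- n1, - n2) = c1"
    using cline_cscale[of "-1" "(n1, - n2)"] cline_cscale[of "-1" "(n1, n2)"]
    by (simp_all add: c1_def c2_def cscale_def)
  then have rc: "map_prod ?r ?r ` c1 = c2" "map_prod ?r ?r ` c2 = c1"
    by (simp_all add: c1_def c2_def cline_linear[OF r(1)] rn linear_neg[OF r(1)])
  have base: "?R p c1 \<or> ?R p c2" if "p \<in> period_domain b" for p
    unfolding c1_def c2_def by (rule connected_to_base[OF n(1,2,3,7) that])
  have comp: "(\<lambda>p. map_prod h h ` p) ` {q. ?R c q} = {q. ?R (map_prod h h ` c) q}"
    if h: "linear h" "bij h" "\<And>x y. b (h x) (h y) = b x y" for h c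
  proof
    show "(\<lambda>p. map_prod h h ` p) ` {q. ?R c q} \<subseteq> {q. ?R (map_prod h h ` c) q}"
      using isometry_component[OF h(1) bij_is_inj[OF h(2)] h(3)] by blast
    show "{q. ?R (map_prod h h ` c) q} \<subseteq> (\<lambda>p. map_prod h h ` p) ` {q. ?R c q}"
    proof
      define k where "k = inv_into UNIV h"
      have kh: "k (h x) = x" "h (k x) = x" for x
        using h(2) by (simp_all add: k_def bij_is_inj bij_is_surj surj_f_inv_f)
      have k: "linear k" "inj k" "b (k x) (k y) = b x y" for x y
        using h kh h(3)[of "k x" "k y"]
        by (simp_all add: k_def bij_is_inj bij_is_surj inj_linear_imp_inv_linear bij_imp_bij_inv)
      fix q assume "q \<in> {q. ?R (map_prod h h ` c) q}"
      then have "?R (map_prod k k ` map_prod h h ` c) (map_prod k k ` q)"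
        using isometry_component[OF k] by blast
      moreover have "map_prod k k ` map_prod h h ` c = c" "map_prod h h ` map_prod k k ` q = q"
        by (simp_all add: image_image map_prod.compositionality[unfolded o_def] prod.map_comp o_def kh prod.map_ident)
      ultimately show "q \<in> (\<lambda>p. map_prod h h ` p) ` {q. ?R c q}" by (metis image_eqI mem_Collect_eq)
    qed
  qed
  obtain p where p: "p \<in> period_domain b" "H = {q. ?R p q}"
    using H by (auto simp: period_components_def connected_components_of_def topspace_period)
  obtain c c' where c: "H = {q. ?R c q}" "?R p c" "{c, c'} = {c1, c2}"
  proof -
    have "H = {q. ?R c q}" if "?R p c" for c
      unfolding p(2) using that by (intro Collect_cong) (metis connected_component_of_trans connected_component_of_sym)
    then show ?thesis using base[OF p(1)] that[of c1 c2] that[of c2 c1] by blast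
  qed
  have "c \<in> period_domain b" using c(2) connected_component_of_equiv topspace_period by metis
  then have gc: "map_prod g g ` c \<in> period_domain b"
    using isometry_cone[OF g(3)] by (auto simp: period_domain_eq cline_linear[OF g(1)])
  have rc': "map_prod ?r ?r ` c' = c" using rc c(3) by (auto simp: doubleton_eq_iff)
  have eqH: "{q. ?R d q} = H" if "?R d c" for d
    unfolding c(1) using that by (intro Collect_cong) (metis connected_component_of_trans connected_component_of_sym)
  have "?R (map_prod g g ` c) c \<or> ?R (map_prod g g ` c) c'"
    using base[OF gc] c(3) by (auto simp: doubleton_eq_iff)
  then show ?thesis
  proof
    assume "?R (map_prod g g ` c) c"
    then show ?thesis using comp[OF g] eqH c(1) by metis
  next
    assume "?R (map_prod g g ` c) c'"
    then have "?R (map_prod ?r ?r ` map_prod g g ` c) c"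
      using isometry_component[OF r(1) rinj r(2)] rc' by metis
    then have "?R (map_prod (?r \<circ> g) (?r \<circ> g) ` c) c"
      by (simp add: image_image prod.map_comp)
    moreover have "bij ?r" by (rule o_bij[of ?r]) (simp_all add: fun_eq_iff r(3))
    then have "linear (?r \<circ> g)" "bij (?r \<circ> g)" "b ((?r \<circ> g) x) ((?r \<circ> g) y) = b x y" for x y
      using g r by (auto intro: linear_compose bij_comp)
    ultimately show ?thesis using comp[of "?r \<circ> g" c] eqH c(1) by metis
  qed
qed

end

section \<open>Splitting planes\<close>

lemma qsub_scale:
  assumes "qvec.subspace A" "c \<in> \<rat>" "x \<in> A"
  shows "c *\<^sub>R x \<in> A"
proof -
  obtain q where "c = of_rat q" using assms(2) by (auto elim: Rats_cases)
  then show ?thesis using qvec.subspace_scale[OF assms(1,3), of q] by (simp add: qscale_def)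
qed

lemma linear_q_hom: "linear g \<Longrightarrow> module_hom qscale qscale g"
  by standard (simp_all add: qscale_def linear_add linear_scale algebra_simps of_rat_add of_rat_mult)

lemma qspan_linear_image: "linear g \<Longrightarrow> g ` qvec.span A = qvec.span (g ` A)"
  by (rule module_hom.span_image[OF linear_q_hom, symmetric])

lemma qspan_pair: "x \<in> qvec.span {e1, e2} \<Longrightarrow> \<exists>p q. p \<in> \<rat> \<and> q \<in> \<rat> \<and> x = p *\<^sub>R e1 + q *\<^sub>R e2"
proof -
  assume "x \<in> qvec.span {e1, e2}"
  then obtain p q where "x - qscale p e1 - qscale q e2 = 0"
    by (auto simp: qvec.span_insert qvec.span_empty)
  then show ?thesis by (intro exI[of _ "of_rat p"] exI[of _ "of_rat q"]) (simp add: qscale_def algebra_simps)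
qed

lemma q_dim2_spanned:
  assumes "qvec.subspace U" "qvec.dim U = 2"
  shows "\<not> U \<subseteq> qvec.span {e1}"
    and "e1 \<in> U \<Longrightarrow> e2 \<in> U \<Longrightarrow> qvec.independent {e1, e2} \<Longrightarrow> e1 \<noteq> e2 \<Longrightarrow> U = qvec.span {e1, e2}"
proof -
  obtain S where S: "S \<subseteq> U" "qvec.independent S" "U \<subseteq> qvec.span S" "card S = 2"
    using qvec.basis_exists[of U] assms(2) by metis
  have fin: "finite S" using S(4) by (metis card.infinite zero_neq_numeral)
  show "\<not> U \<subseteq> qvec.span {e1}"
  proof
    assume "U \<subseteq> qvec.span {e1}"
    then have "S \<subseteq> qvec.span {e1}" using S(1) by blast
    then have "card S \<le> card {e1}" using qvec.independent_span_bound[of "{e1}" S] S(2) by blast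
    then show False using S(4) by simp
  qed
  assume e: "e1 \<in> U" "e2 \<in> U" "qvec.independent {e1, e2}" "e1 \<noteq> e2"
  have "qvec.span {e1, e2} \<subseteq> U" using e assms(1) by (intro qvec.span_minimal) auto
  moreover have "u \<in> qvec.span {e1, e2}" if "u \<in> U" for u
  proof (rule ccontr)
    assume u: "u \<notin> qvec.span {e1, e2}"
    then have "qvec.independent (insert u {e1, e2})" using e(3) by (rule qvec.independent_insertI)
    moreover have "insert u {e1, e2} \<subseteq> qvec.span S" using e that S(3) by auto
    ultimately have "card (insert u {e1, e2}) \<le> card S" using qvec.independent_span_bound[OF fin] by blast
    moreover have "u \<noteq> e1" "u \<noteq> e2" using u qvec.span_base[of _ "{e1, e2}"] by auto
    ultimately show False using e(4) S(4) by simp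
  qed
  ultimately show "U = qvec.span {e1, e2}" by blast
qed

context symmetric_bilinear
begin

text \<open>One step of the Smith normal form, phrased without bases: a least positive value of the
  pairing divides its row, its column and all that remains once both are cleared.\<close>

lemma minimal_pairing:
  assumes A: "zmod.subspace A" "zmod.subspace A'" and int: "\<forall>x\<in>A. \<forall>y\<in>A'. b x y \<in> \<int>"
    and nz: "\<exists>x\<in>A. \<exists>y\<in>A'. b x y \<noteq> 0"
  shows "\<exists>e\<in>A. \<exists>f\<in>A'. b e f > 0 \<and> (\<forall>y\<in>A'. b e y / b e f \<in> \<int>) \<and> (\<forall>x\<in>A. b x f / b e f \<in> \<int>) \<and>
    (\<forall>x\<in>A. \<forall>y\<in>A'. b x f = 0 \<longrightarrow> b e y = 0 \<longrightarrow> b x y / b e f \<in> \<int>)"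
proof -
  define V where "V = {b x y | x y. x \<in> A \<and> y \<in> A'}"
  have neg: "- v \<in> V" if v: "v \<in> V" for v
  proof -
    obtain x y where "v = b x y" "x \<in> A" "y \<in> A'" using v unfolding V_def by blast
    then have "- v = b (- x) y" "- x \<in> A" using zsub_minus[OF A(1)] by auto
    then show ?thesis unfolding V_def using \<open>y \<in> A'\<close> by blast
  qed
  have V: "V \<subseteq> \<int>" using int by (auto simp: V_def)
  obtain x y where "b x y \<in> V" "b x y \<noteq> 0" using nz unfolding V_def by blast
  then have V0: "\<not> V \<subseteq> {0}" by blast
  obtain n where n: "n \<in> V" "n > 0" "\<And>k. k \<in> \<int> \<Longrightarrow> (\<And>q. q \<in> \<int> \<Longrightarrow> k - q * n \<in> V) \<Longrightarrow> k / n \<in> \<int>"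
    using least_positive_value[OF V neg V0] by blast
  have key: "k / n \<in> \<int>" if "k \<in> \<int>" "\<And>q. q \<in> \<int> \<Longrightarrow> \<exists>x\<in>A. \<exists>y\<in>A'. b x y = k - q * n" for k
  proof (rule n(3)[OF that(1)])
    show "k - q * n \<in> V" if "q \<in> \<int>" for q
      using \<open>\<And>q. q \<in> \<int> \<Longrightarrow> \<exists>x\<in>A. \<exists>y\<in>A'. b x y = k - q * n\<close>[OF that] unfolding V_def by (metis (mono_tags, lifting) mem_Collect_eq)
  qed
  obtain e f where ef: "e \<in> A" "f \<in> A'" "b e f = n" "n > 0" using n(1,2) unfolding V_def by blast
  have "b e y / n \<in> \<int>" if "y \<in> A'" for y
  proof (rule key)
    fix q :: real assume "q \<in> \<int>"
    then have "y - q *\<^sub>R f \<in> A'" using that ef A by (intro zsub_intros)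
    then show "\<exists>x\<in>A. \<exists>z\<in>A'. b x z = b e y - q * n" using ef by (intro bexI[of _ e] bexI[of _ "y - q *\<^sub>R f"]) auto
  qed (use int ef that in auto)
  moreover have "b x f / n \<in> \<int>" if "x \<in> A" for x
  proof (rule key)
    fix q :: real assume "q \<in> \<int>"
    then have "x - q *\<^sub>R e \<in> A" using that ef A by (intro zsub_intros)
    then show "\<exists>z\<in>A. \<exists>y\<in>A'. b z y = b x f - q * n" using ef by (intro bexI[of _ "x - q *\<^sub>R e"] bexI[of _ f]) auto
  qed (use int ef that in auto)
  moreover have "b x y / n \<in> \<int>" if xy: "x \<in> A" "y \<in> A'" "b x f = 0" "b e y = 0" for x y
  proof (rule key)
    fix q :: real assume "q \<in> \<int>"
    \<comment> \<open>The vectors \<open>e + x\<close> and \<open>y - q *\<^sub>R f\<close> have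
      pairing \<open>b x y - q * n\<close>, because the mixed terms \<open>b e y\<close> and
      \<open>b x f\<close> vanish.\<close>
    then have "y - q *\<^sub>R f \<in> A'" "e + x \<in> A" using that ef A by (auto intro: zsub_intros)
    then show "\<exists>u\<in>A. \<exists>v\<in>A'. b u v = b x y - q * n"
      using ef xy by (intro bexI[of _ "e + x"] bexI[of _ "y - q *\<^sub>R f"]) auto
  qed (use int that in auto)
  ultimately show ?thesis using ef by (intro bexI[of _ e] bexI[of _ f]) auto
qed

end

context nondegenerate_lattice
begin

lemma ratspace_rational: "x \<in> ratspace L \<Longrightarrow> y \<in> ratspace L \<Longrightarrow> B x y \<in> \<rat>"
proof -
  assume "x \<in> ratspace L" "y \<in> ratspace L"
  then obtain N K where NK: "N > 0" "of_nat N *\<^sub>R x \<in> L" "K > 0" "of_nat K *\<^sub>R y \<in> L"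
    using qspan_multiple[OF L_subspace] unfolding ratspace_def by metis
  have "of_nat N * (of_nat K * B x y) \<in> \<int>" using L.integral[OF NK(2,4)] by (simp add: mult.left_commute)
  then have "of_nat N * (of_nat K * B x y) \<in> \<rat>" using Ints_subset_Rats by blast
  then have "of_nat N * (of_nat K * B x y) / of_nat (N * K) \<in> \<rat>"
    by (rule Rats_divide) simp
  moreover have "of_nat N * (of_nat K * B x y) / of_nat (N * K) = B x y" using NK(1,3) by simp
  ultimately show ?thesis by simp
qed

lemma ratspace_multiple: "x \<in> ratspace L \<Longrightarrow> \<exists>N>0. of_nat N *\<^sub>R x \<in> L"
  using qspan_multiple[OF L_subspace] unfolding ratspace_def .

lemma ratspace_subspace: "qvec.subspace (ratspace L)"
  unfolding ratspace_def by (rule qvec.subspace_span)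

lemma L_ratspace: "x \<in> L \<Longrightarrow> x \<in> ratspace L"
  unfolding ratspace_def by (rule qvec.span_base)

text \<open>Smith normal form of the pairing of \<open>L \<inter> U\<close> with a dual isotropic plane of \<open>L\<close>.\<close>

definition frame :: "'v set \<Rightarrow> real \<Rightarrow> real \<Rightarrow> 'v \<Rightarrow> 'v \<Rightarrow> 'v \<Rightarrow> 'v \<Rightarrow> bool" where
  "frame U a b e1 e2 f1 f2 \<longleftrightarrow>
    a > 0 \<and> b > 0 \<and> a \<in> \<int> \<and> b \<in> \<int> \<and> b / a \<in> \<int> \<and> e1 \<in> L \<and> e2 \<in> L \<and> f1 \<in> L \<and> f2 \<in> L \<and>
    B e1 e1 = 0 \<and> B e1 e2 = 0 \<and> B e2 e2 = 0 \<and> B f1 f1 = 0 \<and> B f1 f2 = 0 \<and> B f2 f2 = 0 \<and>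
    B e1 f1 = a \<and> B e1 f2 = 0 \<and> B e2 f1 = 0 \<and> B e2 f2 = b \<and> U = qvec.span {e1, e2} \<and>
    (\<forall>l\<in>L. B l e1 / a \<in> \<int> \<and> B l f1 / a \<in> \<int> \<and> B l e2 / b \<in> \<int> \<and> B l f2 / b \<in> \<int>)"

text \<open>\<open>minimal_pairing\<close> is applied twice, to \<open>L \<inter> U\<close> against
  \<open>L \<inter> V\<close> and then to what is orthogonal to the first pair; its last clause
  makes \<open>b / a\<close> integral. The splitting of \<open>L\<close> extends the divisibility
  from these planes to pairings with all of \<open>L\<close>.\<close>

lemma frame_exists:
  assumes U: "U \<in> isotropic_planes B L" and spl: "plane_splits B L U"
  shows "\<exists>a b e1 e2 f1 f2. frame U a b e1 e2 f1 f2"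
proof -
  have U1: "U \<subseteq> ratspace L" "qvec.subspace U" "qvec.dim U = 2" and UU: "\<And>x y. x \<in> U \<Longrightarrow> y \<in> U \<Longrightarrow> B x y = 0"
    using U by (auto simp: isotropic_planes_def isotropic_def)
  obtain V M where V: "V \<subseteq> ratspace L" "qvec.subspace V" and VV: "isotropic B V" and dual: "dual_subspaces B U V"
    and M: "orth_direct_sum B L M {x + y | x y. x \<in> L \<inter> U \<and> y \<in> L \<inter> V}"
    using spl unfolding plane_splits_def by (elim exE conjE) (rule that)
  have VV: "B x y = 0" if "x \<in> V" "y \<in> V" for x y using VV that by (simp add: isotropic_def)
  have qz: "zmod.subspace A" if "qvec.subspace A" for A :: "'v set"
    using qvec.subspace_0[OF that] qvec.subspace_diff[OF that] by (intro zsubI)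
  define S S' where "S = L \<inter> U" and "S' = L \<inter> V"
  have S: "zmod.subspace S" "zmod.subspace S'"
    using qz[OF U1(2)] qz[OF V(2)] L_subspace unfolding S_def S'_def by (simp_all add: zmod.subspace_inter)
  have multS: "\<exists>N>0. of_nat N *\<^sub>R x \<in> S" if "x \<in> U" for x
    using ratspace_multiple[of x] U1 that qsub_scale[OF U1(2)] unfolding S_def by (metis IntI Rats_of_nat subsetD)
  have multS': "\<exists>N>0. of_nat N *\<^sub>R x \<in> S'" if "x \<in> V" for x
    using ratspace_multiple[of x] V that qsub_scale[OF V(2)] unfolding S'_def by (metis IntI Rats_of_nat subsetD)
  have SS': "\<forall>x\<in>S. \<forall>y\<in>S'. B x y \<in> \<int>" using L.integral by (auto simp: S_def S'_def)
  have dualU: "\<exists>y\<in>V. B x y \<noteq> 0" if "x \<in> U" "x \<noteq> 0" for x using dual that by (auto simp: dual_subspaces_def)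
  have "\<exists>x\<in>S. \<exists>y\<in>S'. B x y \<noteq> 0"
  proof -
    have "\<not> U \<subseteq> qvec.span {0}" by (rule q_dim2_spanned(1)[OF U1(2,3)])
    then obtain u where u: "u \<in> U" "u \<noteq> 0" using qvec.span_zero by blast
    obtain y where y: "y \<in> V" "B u y \<noteq> 0" using dualU u by blast
    obtain N K where "N > 0" "of_nat N *\<^sub>R u \<in> S" "K > 0" "of_nat K *\<^sub>R y \<in> S'" using multS multS' u y by metis
    then show ?thesis using y by (intro bexI[of _ "of_nat N *\<^sub>R u"] bexI[of _ "of_nat K *\<^sub>R y"]) auto
  qed
  from minimal_pairing[OF S SS' this] obtain e1 f1 where e1: "e1 \<in> S" "f1 \<in> S'" "B e1 f1 > 0"
    "\<forall>y\<in>S'. B e1 y / B e1 f1 \<in> \<int>" "\<forall>x\<in>S. B x f1 / B e1 f1 \<in> \<int>"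
    "\<forall>x\<in>S. \<forall>y\<in>S'. B x f1 = 0 \<longrightarrow> B e1 y = 0 \<longrightarrow> B x y / B e1 f1 \<in> \<int>"
    by (elim bexE conjE) (rule that)
  define a where "a = B e1 f1"
  define S1 S1' where "S1 = {x\<in>S. B x f1 = 0}" and "S1' = {y\<in>S'. B e1 y = 0}"
  have e1U: "e1 \<in> U" "e1 \<in> L" "f1 \<in> V" "f1 \<in> L" using e1 by (auto simp: S_def S'_def)
  have S1: "zmod.subspace S1" "zmod.subspace S1'"
    unfolding S1_def S1'_def using S by (auto intro!: zsubI intro: zsub_intros)
  have S1i: "\<forall>x\<in>S1. \<forall>y\<in>S1'. B x y \<in> \<int>" using SS' by (auto simp: S1_def S1'_def)
  have "\<exists>x\<in>S1. \<exists>y\<in>S1'. B x y \<noteq> 0"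
  proof -
    \<comment> \<open>A vector of \<open>U\<close> off the line of \<open>e1\<close>, made
      orthogonal to \<open>f1\<close>, still pairs nontrivially with some \<open>y\<close>. Making
      \<open>y\<close> orthogonal to \<open>e1\<close> keeps that pairing because \<open>x\<close>
      is orthogonal to \<open>f1\<close>.\<close>
    obtain u where u: "u \<in> U" "u \<notin> qvec.span {e1}" using q_dim2_spanned(1)[OF U1(2,3)] by blast
    have aQ: "a \<in> \<rat>" unfolding a_def using ratspace_rational e1U L_ratspace by blast
    define x where "x = u - (B u f1 / a) *\<^sub>R e1"
    have c: "B u f1 / a \<in> \<rat>" using aQ ratspace_rational[of u f1] u U1(1) e1U L_ratspace by (intro Rats_divide) auto
    have xU: "x \<in> U" unfolding x_def using u e1U c by (intro qvec.subspace_diff U1 qsub_scale)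
    have "x \<noteq> 0"
    proof
      assume "x = 0"
      then have "u = (B u f1 / a) *\<^sub>R e1" by (simp add: x_def)
      also have "\<dots> \<in> qvec.span {e1}" using c by (intro qsub_scale qvec.subspace_span) (auto intro: qvec.span_base)
      finally show False using u by simp
    qed
    then obtain y where y: "y \<in> V" "B x y \<noteq> 0" using dualU xU by blast
    have xf: "B x f1 = 0" using e1(3) by (simp add: x_def a_def)
    define z where "z = y - (B e1 y / a) *\<^sub>R f1"
    have "B e1 y / a \<in> \<rat>" using aQ ratspace_rational[of e1 y] y V(1) e1U L_ratspace by (intro Rats_divide) auto
    then have zV: "z \<in> V" unfolding z_def using y e1U by (intro qvec.subspace_diff V qsub_scale)
    have z: "B e1 z = 0" "B x z \<noteq> 0" using e1(3) y xf by (simp_all add: z_def a_def)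
    obtain N K where NK: "N > 0" "of_nat N *\<^sub>R x \<in> S" "K > 0" "of_nat K *\<^sub>R z \<in> S'" using multS multS' xU zV by metis
    then show ?thesis using z xf
      by (intro bexI[of _ "of_nat N *\<^sub>R x"] bexI[of _ "of_nat K *\<^sub>R z"]) (auto simp: S1_def S1'_def)
  qed
  from minimal_pairing[OF S1 S1i this] obtain e2 f2 where e2: "e2 \<in> S1" "f2 \<in> S1'" "B e2 f2 > 0"
    "\<forall>y\<in>S1'. B e2 y / B e2 f2 \<in> \<int>" "\<forall>x\<in>S1. B x f2 / B e2 f2 \<in> \<int>"
    by (elim bexE conjE) (rule that)
  define b where "b = B e2 f2"
  have e2U: "e2 \<in> U" "e2 \<in> L" "f2 \<in> V" "f2 \<in> L" "e2 \<in> S" "f2 \<in> S'" "B e2 f1 = 0" "B e1 f2 = 0"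
    using e2 by (auto simp: S1_def S1'_def S_def S'_def)
  have span: "U = qvec.span {e1, e2}"
  proof -
    have "e1 \<noteq> 0" using e1(3) by auto
    have "e2 \<notin> qvec.span {e1}"
    proof
      assume "e2 \<in> qvec.span {e1}"
      then have "e2 \<in> qvec.span {e1, e1}" by simp
      then obtain p q where "e2 = p *\<^sub>R e1 + q *\<^sub>R e1" using qspan_pair by blast
      then have "B e2 f2 = (p + q) * B e1 f2" by (simp add: algebra_simps)
      then show False using e2(3) e2U(8) by simp
    qed
    moreover have "qvec.independent {e1}" using \<open>e1 \<noteq> 0\<close> by simp
    ultimately have "qvec.independent {e2, e1}" by (rule qvec.independent_insertI)
    moreover have "e1 \<noteq> e2" using \<open>e2 \<notin> qvec.span {e1}\<close> qvec.span_base[of e1 "{e1}"] by auto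
    ultimately show ?thesis using q_dim2_spanned(2)[OF U1(2,3) e1U(1) e2U(1)] by (simp add: insert_commute)
  qed
  have dvd: "B l e1 / a \<in> \<int> \<and> B l f1 / a \<in> \<int> \<and> B l e2 / b \<in> \<int> \<and> B l f2 / b \<in> \<int>" if lL: "l \<in> L" for l
  proof -
    have "L = {x + y | x y. x \<in> M \<and> y \<in> {x + y | x y. x \<in> L \<inter> U \<and> y \<in> L \<inter> V}}"
      using M unfolding orth_direct_sum_def by blast
    then obtain m s t where l: "l = m + (s + t)" "m \<in> M" "s \<in> S" "t \<in> S'"
      using lL unfolding S_def S'_def by blast
    have Mo: "B m (x + y) = 0" if "x \<in> S" "y \<in> S'" for x y
      using M l(2) that unfolding orth_direct_sum_def S_def S'_def by blast
    have m: "B m x = 0" "B m y = 0" if "x \<in> S" "y \<in> S'" for x y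
      using Mo[OF that(1) zsub_0[OF S(2)]] Mo[OF zsub_0[OF S(1)] that(2)] by simp_all
    have st: "s \<in> U" "t \<in> V" using l by (auto simp: S_def S'_def)
    have vals: "B l e1 = B e1 t" "B l e2 = B e2 t" "B l f1 = B s f1" "B l f2 = B s f2"
      using m[OF e1(1,2)] m[OF e2U(5,6)] UU[OF st(1) e1U(1)] UU[OF st(1) e2U(1)] VV[OF st(2) e1U(3)] VV[OF st(2) e2U(3)]
        sym[of t] by (simp_all add: l(1))
    \<comment> \<open>The second step controls pairings only on \<open>S1\<close> and
      \<open>S1'\<close>. Clearing the first coordinate moves \<open>t\<close> and \<open>s\<close>
      there, and \<open>B e2 f1 = B e1 f2 = 0\<close> keeps their pairings with \<open>e2\<close>
      and \<open>f2\<close>.\<close>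
    have "t - (B e1 t / a) *\<^sub>R f1 \<in> S1'"
      unfolding S1'_def using e1 l(4) by (auto intro!: zsub_intros S simp: a_def)
    moreover have "s - (B s f1 / a) *\<^sub>R e1 \<in> S1"
      unfolding S1_def using e1 l(3) by (auto intro!: zsub_intros S simp: a_def)
    ultimately have "B e2 (t - (B e1 t / a) *\<^sub>R f1) / b \<in> \<int>" "B (s - (B s f1 / a) *\<^sub>R e1) f2 / b \<in> \<int>"
      using e2(4,5) unfolding b_def by blast+
    then show ?thesis unfolding vals using e1(4,5) l(3,4) e2U(7,8) by (simp add: a_def)
  qed
  have "b / a \<in> \<int>" unfolding a_def b_def using e1(6) e2U by blast
  moreover have "a \<in> \<int>" "b \<in> \<int>" unfolding a_def b_def using e1U e2U L.integral by blast+
  ultimately have "frame U a b e1 e2 f1 f2"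
    unfolding frame_def using e1U e2U e1(3) e2(3) UU VV span dvd
    by (intro conjI ballI) (simp_all add: a_def b_def)
  then show ?thesis by blast
qed

end

context nondegenerate_lattice
begin

lemma OL_extend:
  assumes diff: "\<And>x y. x \<in> L \<Longrightarrow> y \<in> L \<Longrightarrow> \<phi>0 (x - y) = \<phi>0 x - \<phi>0 y"
    and form: "\<And>x y. x \<in> L \<Longrightarrow> y \<in> L \<Longrightarrow> B (\<phi>0 x) (\<phi>0 y) = B x y"
    and onto: "\<phi>0 ` L = L"
  shows "\<exists>\<phi>\<in>O_L. \<forall>x\<in>L. \<phi> x = \<phi>0 x"
proof -
  obtain S where S: "independent S" "L = zmod.span S" using lat by (auto simp: is_lattice_def)
  obtain \<phi> where \<phi>: "linear \<phi>" "\<forall>x\<in>S. \<phi> x = \<phi>0 x" using linear_independent_extend[OF S(1)] by blast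
  have SL: "S \<subseteq> L" using S(2) by (auto intro: zmod.span_base)
  have "zmod.subspace {x\<in>L. \<phi> x = \<phi>0 x}"
  proof (rule zsubI)
    have "\<phi>0 0 = 0" using diff[OF zsub_0[OF L_subspace] zsub_0[OF L_subspace]] by simp
    then show "0 \<in> {x\<in>L. \<phi> x = \<phi>0 x}" using zsub_0[OF L_subspace] linear_0[OF \<phi>(1)] by simp
    show "x - y \<in> {x\<in>L. \<phi> x = \<phi>0 x}" if "x \<in> {x\<in>L. \<phi> x = \<phi>0 x}" "y \<in> {x\<in>L. \<phi> x = \<phi>0 x}" for x y
      using that zsub_diff[OF L_subspace] diff linear_diff[OF \<phi>(1)] by auto
  qed
  moreover have "S \<subseteq> {x\<in>L. \<phi> x = \<phi>0 x}" using \<phi>(2) SL by auto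
  ultimately have "L \<subseteq> {x\<in>L. \<phi> x = \<phi>0 x}" unfolding S(2) using zmod.span_minimal by blast
  then have eq: "\<phi> x = \<phi>0 x" if "x \<in> L" for x using that by blast
  have isoL: "B (\<phi> x) (\<phi> y) = B x y" if "x \<in> L" "y \<in> L" for x y using form[OF that] eq that by simp
  have iso: "B (\<phi> x) (\<phi> y) = B x y" for x y by (rule isometry_on_L[OF \<phi>(1) isoL])
  have "\<phi> ` L = \<phi>0 ` L" using eq by (rule image_cong[OF refl])
  then have "\<phi> ` L = L" using onto by simp
  then have "\<phi> \<in> O_L" using \<phi>(1) iso by (simp add: OL_iff)
  then show ?thesis using eq by blast
qed

end

section \<open>Coordinates of \<open>L\<close> relative to a frame\<close>

locale framed_plane = nondegenerate_lattice B L for B :: "'v::euclidean_space \<Rightarrow> 'v \<Rightarrow> real" and L +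
  fixes U :: "'v set" and a b :: real and e1 e2 f1 f2 :: 'v
  assumes frame: "frame U a b e1 e2 f1 f2"
begin

lemma ab: "a > 0" "b > 0" "a \<in> \<int>" "b \<in> \<int>" "b / a \<in> \<int>"
  and inL: "e1 \<in> L" "e2 \<in> L" "f1 \<in> L" "f2 \<in> L"
  and U_span: "U = qvec.span {e1, e2}"
  and dvd: "l \<in> L \<Longrightarrow> B l e1 / a \<in> \<int>" "l \<in> L \<Longrightarrow> B l f1 / a \<in> \<int>" "l \<in> L \<Longrightarrow> B l e2 / b \<in> \<int>" "l \<in> L \<Longrightarrow> B l f2 / b \<in> \<int>"
  using frame unfolding frame_def by blast+

lemma pairings [simp]:
  "B e1 e1 = 0" "B e1 e2 = 0" "B e2 e1 = 0" "B e2 e2 = 0" "B f1 f1 = 0" "B f1 f2 = 0" "B f2 f1 = 0" "B f2 f2 = 0"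
  "B e1 f1 = a" "B e1 f2 = 0" "B e2 f1 = 0" "B e2 f2 = b" "B f1 e1 = a" "B f2 e1 = 0" "B f1 e2 = 0" "B f2 e2 = b"
  using frame sym[of e2 e1] sym[of f2 f1] sym[of f1 e1] sym[of f2 e1] sym[of f1 e2] sym[of f2 e2]
  unfolding frame_def by simp_all

definition proj :: "'v \<Rightarrow> 'v" where
  "proj x = x - (B x f1 / a) *\<^sub>R e1 - (B x e1 / a) *\<^sub>R f1 - (B x f2 / b) *\<^sub>R e2 - (B x e2 / b) *\<^sub>R f2"

text \<open>The orthogonal complement of the frame in \<open>L\<close>, a concrete copy of the
  associated lattice: by \<open>carrier_assoc\<close> and \<open>kcoset_inj\<close> its elements
  represent the cosets of \<open>T\<close> uniquely.\<close>

definition C :: "'v set" where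
  "C = {x\<in>L. B x e1 = 0 \<and> B x e2 = 0 \<and> B x f1 = 0 \<and> B x f2 = 0}"

definition comb :: "real \<Rightarrow> real \<Rightarrow> real \<Rightarrow> real \<Rightarrow> 'v" where
  "comb p q r s = p *\<^sub>R e1 + q *\<^sub>R f1 + r *\<^sub>R e2 + s *\<^sub>R f2"

lemma proj_decomp: "x = proj x + comb (B x f1 / a) (B x e1 / a) (B x f2 / b) (B x e2 / b)"
  by (simp add: proj_def comb_def)

lemma proj_diff: "proj (x - y) = proj x - proj y"
  by (simp add: proj_def diff_divide_distrib scaleR_diff_left)

lemma C_subspace: "zmod.subspace C"
  unfolding C_def by (rule zsubI) (auto intro: zsub_intros L_subspace)

lemma proj_C: "x \<in> L \<Longrightarrow> proj x \<in> C"
  unfolding C_def using ab by (auto simp: proj_def intro!: zsub_intros L_subspace inL dvd)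

lemma comb_L: "p \<in> \<int> \<Longrightarrow> q \<in> \<int> \<Longrightarrow> r \<in> \<int> \<Longrightarrow> s \<in> \<int> \<Longrightarrow> comb p q r s \<in> L"
  unfolding comb_def by (intro zsub_intros L_subspace inL)

lemma comb_diff: "comb (p - p') (q - q') (r - r') (s - s') = comb p q r s - comb p' q' r' s'"
  by (simp add: comb_def scaleR_diff_left)

lemma comb_coords:
  assumes "c \<in> C"
  shows "B (c + comb p q r s) f1 = a * p" "B (c + comb p q r s) e1 = a * q"
    "B (c + comb p q r s) f2 = b * r" "B (c + comb p q r s) e2 = b * s" "proj (c + comb p q r s) = c"
proof -
  show co: "B (c + comb p q r s) f1 = a * p" "B (c + comb p q r s) e1 = a * q"
    "B (c + comb p q r s) f2 = b * r" "B (c + comb p q r s) e2 = b * s"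
    using assms by (simp_all add: C_def comb_def)
  show "proj (c + comb p q r s) = c"
    unfolding proj_def co using ab by (simp add: comb_def)
qed

lemma comb_form:
  assumes "c \<in> C" "c' \<in> C"
  shows "B (c + comb p q r s) (c' + comb p' q' r' s') = B c c' + a * (p * q' + q * p') + b * (r * s' + s * r')"
  using assms sym[of e1 c'] sym[of e2 c'] sym[of f1 c'] sym[of f2 c']
  by (simp add: C_def comb_def algebra_simps)

definition T :: "'v set" where "T = L' \<inter> U"

lemma U_mem: "u \<in> U \<Longrightarrow> u = (B u f1 / a) *\<^sub>R e1 + (B u f2 / b) *\<^sub>R e2"
proof -
  assume "u \<in> U"
  then obtain p q where "u = p *\<^sub>R e1 + q *\<^sub>R e2" using qspan_pair unfolding U_span by blast
  then show ?thesis using ab by simp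
qed

lemma e_U: "e1 \<in> U" "e2 \<in> U" and U_qsub: "qvec.subspace U"
  unfolding U_span by (auto intro: qvec.span_base)

lemma U_orth: "u \<in> U \<Longrightarrow> B x e1 = 0 \<Longrightarrow> B x e2 = 0 \<Longrightarrow> B x u = 0"
  using U_mem[of u] by (metis form_simps(2,4) add.right_neutral mult_zero_right)

lemma T_iff: "t \<in> T \<longleftrightarrow> (\<exists>i\<in>\<int>. \<exists>j\<in>\<int>. t = (i / a) *\<^sub>R e1 + (j / b) *\<^sub>R e2)"
proof
  assume t: "t \<in> T"
  then have "t = (B t f1 / a) *\<^sub>R e1 + (B t f2 / b) *\<^sub>R e2" using U_mem by (simp add: T_def)
  moreover have "B t f1 \<in> \<int>" "B t f2 \<in> \<int>" using t inL dual_pairing by (auto simp: T_def)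
  ultimately show "\<exists>i\<in>\<int>. \<exists>j\<in>\<int>. t = (i / a) *\<^sub>R e1 + (j / b) *\<^sub>R e2" by blast
next
  assume "\<exists>i\<in>\<int>. \<exists>j\<in>\<int>. t = (i / a) *\<^sub>R e1 + (j / b) *\<^sub>R e2"
  then obtain i j where ij: "i \<in> \<int>" "j \<in> \<int>" "t = (i / a) *\<^sub>R e1 + (j / b) *\<^sub>R e2" by blast
  have "i / a \<in> \<rat>" "j / b \<in> \<rat>" using ij ab Ints_subset_Rats by (auto intro!: Rats_divide)
  then have "t \<in> U" unfolding ij(3) using U_qsub e_U by (intro qvec.subspace_add qsub_scale)
  moreover have "B t l \<in> \<int>" if "l \<in> L" for l
  proof -
    have "B t l = i * (B l e1 / a) + j * (B l e2 / b)" by (simp add: ij(3) sym[of _ l])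
    then show ?thesis using ij dvd[OF that] by (simp del: times_divide_eq_right)
  qed
  ultimately show "t \<in> T" by (simp add: T_def dual_iff)
qed

lemma T_subspace: "zmod.subspace T"
  unfolding T_def using dual_subspace qvec.subspace_0[OF U_qsub] qvec.subspace_diff[OF U_qsub]
  by (intro zsubI) (auto intro: zsub_intros)

lemma T_mem_L: "(i / a) *\<^sub>R e1 + (j / b) *\<^sub>R e2 \<in> L \<longleftrightarrow> i / a \<in> \<int> \<and> j / b \<in> \<int>"
proof
  assume l: "(i / a) *\<^sub>R e1 + (j / b) *\<^sub>R e2 \<in> L"
  show "i / a \<in> \<int> \<and> j / b \<in> \<int>" using dvd(2,4)[OF l] ab by simp
qed (auto intro!: zsub_intros L_subspace inL)

text \<open>By \<open>T_iff\<close> the group \<open>T\<close> is generated by \<open>e1\<close>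
  divided by \<open>a\<close> and \<open>e2\<close> divided by \<open>b\<close>. As \<open>a\<close>
  divides \<open>b\<close>, the exponent of \<open>T\<close> modulo \<open>L\<close> is
  \<open>b\<close>.\<close>

lemma T_exponent: "k \<in> \<int> \<Longrightarrow> (\<forall>t\<in>T. k *\<^sub>R t \<in> L) \<longleftrightarrow> k / b \<in> \<int>"
proof
  assume k: "k \<in> \<int>"
  {
    assume h: "\<forall>t\<in>T. k *\<^sub>R t \<in> L"
    have "(0 / a) *\<^sub>R e1 + (1 / b) *\<^sub>R e2 \<in> T" unfolding T_iff by (intro bexI[of _ 0] bexI[of _ 1]) auto
    then have "(0 / a) *\<^sub>R e1 + (k / b) *\<^sub>R e2 \<in> L" using h by force
    then show "k / b \<in> \<int>" unfolding T_mem_L by blast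
  next
    assume h: "k / b \<in> \<int>"
    show "\<forall>t\<in>T. k *\<^sub>R t \<in> L"
    proof
      fix t assume "t \<in> T"
      then obtain i j where ij: "i \<in> \<int>" "j \<in> \<int>" "t = (i / a) *\<^sub>R e1 + (j / b) *\<^sub>R e2" by (auto simp: T_iff)
      have "k *\<^sub>R t = ((k * i) / a) *\<^sub>R e1 + ((k * j) / b) *\<^sub>R e2" by (simp add: ij(3) scaleR_add_right)
      moreover have "k * i / a = (k / b) * (b / a) * i" "k * j / b = (k / b) * j" using ab by simp_all
      then have "k * i / a \<in> \<int>" "k * j / b \<in> \<int>" using h ij ab by (simp_all del: times_divide_eq_left times_divide_eq_right divide_divide_eq_left)
      ultimately show "k *\<^sub>R t \<in> L" using T_mem_L by simp
    qed
  }
qed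

text \<open>The type is a product of cyclic groups of orders \<open>a\<close> and \<open>b\<close>;
  with the exponent \<open>b\<close> known, its order recovers \<open>a\<close>.\<close>

lemma card_type: "real (card (plane_type B L U)) = a * b"
proof -
  obtain A N where AN: "a = real A" "b = real N" "A > 0" "N > 0"
  proof -
    obtain i j where "a = of_int i" "b = of_int j" using ab by (auto elim!: Ints_cases)
    then show ?thesis using that[of "nat i" "nat j"] ab by simp
  qed
  define h where "h = (\<lambda>(i::nat, j::nat). dcoset ((real i / a) *\<^sub>R e1 + (real j / b) *\<^sub>R e2))"
  have key: "dcoset ((i / a) *\<^sub>R e1 + (j / b) *\<^sub>R e2) = dcoset ((i' / a) *\<^sub>R e1 + (j' / b) *\<^sub>R e2) \<longleftrightarrow>
      (i - i') / a \<in> \<int> \<and> (j - j') / b \<in> \<int>" for i j i' j' :: real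
  proof -
    have "((i / a) *\<^sub>R e1 + (j / b) *\<^sub>R e2) - ((i' / a) *\<^sub>R e1 + (j' / b) *\<^sub>R e2) =
        ((i - i') / a) *\<^sub>R e1 + ((j - j') / b) *\<^sub>R e2"
      by (simp add: diff_divide_distrib scaleR_diff_left)
    then show ?thesis unfolding dcoset_eq_iff using T_mem_L by simp
  qed
  have small: "i = i'" if asm: "(real i - real i') / real n \<in> \<int>" "i < n" "i' < n" for i i' n :: nat
  proof -
    obtain k where k: "(real i - real i') / real n = of_int k" using asm(1) by (auto elim: Ints_cases)
    then have "real_of_int (int i - int i') = of_int (k * int n)" using asm by (simp add: field_simps)
    then have "int i - int i' = k * int n" by linarith
    then have "int i mod int n = int i' mod int n" by (simp add: mod_eq_dvd_iff)
    then show ?thesis using asm by simp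
  qed
  have "inj_on h ({..<A} \<times> {..<N})"
    unfolding inj_on_def h_def by (auto simp: key intro: small[of _ _ A, folded AN(1)] small[of _ _ N, folded AN(2)])
  moreover have "h ` ({..<A} \<times> {..<N}) = plane_type B L U"
  proof
    show "h ` ({..<A} \<times> {..<N}) \<subseteq> plane_type B L U"
    proof
      fix X assume "X \<in> h ` ({..<A} \<times> {..<N})"
      then obtain i j :: nat where "X = dcoset ((real i / a) *\<^sub>R e1 + (real j / b) *\<^sub>R e2)" by (auto simp: h_def)
      moreover have "(real i / a) *\<^sub>R e1 + (real j / b) *\<^sub>R e2 \<in> T" unfolding T_iff by (metis Ints_of_nat)
      ultimately show "X \<in> plane_type B L U" unfolding plane_type_eq T_def by blast
    qed
    show "plane_type B L U \<subseteq> h ` ({..<A} \<times> {..<N})"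
    proof
      fix X assume "X \<in> plane_type B L U"
      then obtain t where t: "t \<in> T" "X = dcoset t" unfolding plane_type_eq T_def by blast
      then obtain i j where ij: "X = dcoset ((of_int i / a) *\<^sub>R e1 + (of_int j / b) *\<^sub>R e2)"
        unfolding T_iff by (metis Ints_cases)
      have red: "(of_int i - real (nat (i mod int n))) / real n \<in> \<int>" "nat (i mod int n) < n" if "n > 0" for i n
      proof -
        have "of_int i - real (nat (i mod int n)) = real_of_int (i - i mod int n)" using that by simp
        also have "\<dots> = real n * of_int (i div int n)" by (simp add: minus_mod_eq_mult_div)
        finally show "(of_int i - real (nat (i mod int n))) / real n \<in> \<int>" using that by simp
        show "nat (i mod int n) < n" using that by (simp add: nat_less_iff)
      qed
      have "X = h (nat (i mod int A), nat (j mod int N))"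
        unfolding ij h_def prod.case key using red(1)[OF AN(3), of i] red(1)[OF AN(4), of j] by (simp add: AN(1,2))
      then show "X \<in> h ` ({..<A} \<times> {..<N})" using red(2)[OF AN(3), of i] red(2)[OF AN(4), of j] by blast
    qed
  qed
  ultimately have "card (plane_type B L U) = A * N"
    using card_image[of h "{..<A} \<times> {..<N}"] by (simp add: card_cartesian_product)
  then show ?thesis by (simp add: AN(1,2))
qed

abbreviation kcoset :: "'v \<Rightarrow> 'v set" where "kcoset \<equiv> translate T"

lemma overlattice_U: "overlattice B L U \<inter> U = T"
proof
  show "overlattice B L U \<inter> U \<subseteq> T"
  proof
    fix x assume "x \<in> overlattice B L U \<inter> U"
    then obtain t l where x: "x = t + l" "t \<in> T" "l \<in> L" "x \<in> U" by (auto simp: overlattice_def T_def)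
    then have "x - t \<in> U" using qvec.subspace_diff[OF U_qsub, of x t] by (simp add: T_def)
    then have "l \<in> T" using x(1,3) L_sub_dual by (auto simp: T_def)
    then show "x \<in> T" using x zsub_add[OF T_subspace] by simp
  qed
  show "T \<subseteq> overlattice B L U \<inter> U" using zsub_0[OF L_subspace] by (force simp: overlattice_def T_def)
qed

lemma overlattice_perp: "overlattice B L U \<inter> perp B L U = {t + c | t c. t \<in> T \<and> c \<in> C}"
proof
  show "overlattice B L U \<inter> perp B L U \<subseteq> {t + c | t c. t \<in> T \<and> c \<in> C}"
  proof
    fix x assume "x \<in> overlattice B L U \<inter> perp B L U"
    then obtain t l where x: "x = t + l" "t \<in> T" "l \<in> L" "B x e1 = 0" "B x e2 = 0"
      using e_U by (auto simp: overlattice_def T_def perp_def)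
    have "B e1 t = 0" "B e2 t = 0" using x(2) U_orth[of t] by (simp_all add: T_def)
    then have l: "B l e1 = 0" "B l e2 = 0" using x sym[of t] by auto
    \<comment> \<open>\<open>l\<close> is orthogonal to \<open>U\<close>, so in the frame it has
      only components along \<open>e1\<close> and \<open>e2\<close>, which lie in \<open>T\<close>,
      besides its projection to \<open>C\<close>.\<close>
    have tt: "t + ((B l f1 / a) *\<^sub>R e1 + (B l f2 / b) *\<^sub>R e2) \<in> T"
      using dvd[OF x(3)] x(2) L_sub_dual inL e_U
      by (intro zsub_add[OF T_subspace] zsub_scale[OF T_subspace]) (auto simp: T_def)
    have "x = (t + ((B l f1 / a) *\<^sub>R e1 + (B l f2 / b) *\<^sub>R e2)) + proj l"
      unfolding x(1) proj_def l by simp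
    then show "x \<in> {t + c | t c. t \<in> T \<and> c \<in> C}" using tt proj_C[OF x(3)] by blast
  qed
  show "{t + c | t c. t \<in> T \<and> c \<in> C} \<subseteq> overlattice B L U \<inter> perp B L U"
  proof
    fix x assume "x \<in> {t + c | t c. t \<in> T \<and> c \<in> C}"
    then obtain t c where x: "x = t + c" "t \<in> T" "c \<in> C" by blast
    have "x \<in> overlattice B L U" using x by (auto simp: overlattice_def T_def C_def)
    moreover have "B t e1 = 0" "B t e2 = 0" using x(2) U_orth[of t] sym[of t] by (simp_all add: T_def)
    then have "B x u = 0" if "u \<in> U" for u using that x(1,3) U_orth[of u x] by (simp add: C_def)
    moreover have "x \<in> ratspace L"
      using x qvec.subspace_add[OF ratspace_subspace] L_ratspace by (auto simp: T_def C_def dual_lattice_def)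
    ultimately show "x \<in> overlattice B L U \<inter> perp B L U" by (simp add: perp_def)
  qed
qed

lemma carrier_assoc: "carrier (assoc_lattice B L U) = kcoset ` C"
proof -
  have "kcoset (t + c) = kcoset c" if "t \<in> T" for t c using that by (simp add: translate_eq_iff[OF T_subspace])
  moreover have "C \<subseteq> {t + c | t c. t \<in> T \<and> c \<in> C}" using zsub_0[OF T_subspace] by force
  ultimately show ?thesis
    unfolding assoc_lattice_def overlattice_U overlattice_perp carrier_quotient by blast
qed

lemma mult_assoc: "kcoset x \<otimes>\<^bsub>assoc_lattice B L U\<^esub> kcoset y = kcoset (x + y)"
  unfolding assoc_lattice_def overlattice_U mult_quotient by (rule translate_add[OF T_subspace])

lemma T_orth: "t \<in> T \<Longrightarrow> c \<in> C \<Longrightarrow> B c t = 0" "t \<in> T \<Longrightarrow> s \<in> T \<Longrightarrow> B s t = 0"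
proof -
  show "B c t = 0" if "t \<in> T" "c \<in> C" using that U_orth[of t c] by (simp add: T_def C_def)
  assume st: "t \<in> T" "s \<in> T"
  have "B s e1 = 0" "B s e2 = 0" using st(2) U_orth[of s] sym[of s] by (simp_all add: T_def)
  then show "B s t = 0" using st(1) U_orth[of t s] by (simp add: T_def)
qed

lemma coset_form_kcoset:
  assumes "x \<in> C" "y \<in> C"
  shows "coset_form B (kcoset x) (kcoset y) = B x y"
  unfolding coset_form_def
proof (rule the_equality)
  show "\<forall>u\<in>kcoset x. \<forall>v\<in>kcoset y. B u v = B x y"
    using assms T_orth sym[of _ y] by (auto simp: translate_def)
  have "x \<in> kcoset x" "y \<in> kcoset y" by (rule translate_self[OF T_subspace])+
  then show "r = B x y" if "\<forall>u\<in>kcoset x. \<forall>v\<in>kcoset y. B u v = r" for r using that by metis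
qed

lemma kcoset_inj: "x \<in> C \<Longrightarrow> y \<in> C \<Longrightarrow> kcoset x = kcoset y \<Longrightarrow> x = y"
proof -
  assume xy: "x \<in> C" "y \<in> C" "kcoset x = kcoset y"
  then obtain t where t: "x = t + y" "t \<in> T" by (metis translate_eq_iff[OF T_subspace] diff_add_cancel)
  then have "B t f1 = 0" "B t f2 = 0" using xy(1,2) by (auto simp: C_def)
  then have "t = 0" using U_mem[of t] t(2) by (simp add: T_def)
  then show "x = y" using t by simp
qed

end

text \<open>On either side \<open>L\<close> is the orthogonal sum of \<open>C\<close> and the span
  of the frame. The isometry of associated lattices is transported to the complements, and the
  frames have the same Gram matrix because \<open>a\<close> and \<open>b\<close> agree.\<close>

lemma (in nondegenerate_lattice) framed_planes_isometric:
  assumes F1: "frame U a b e1 e2 f1 f2" and F2: "frame V a b e1' e2' f1' f2'"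
    and iso: "lattice_isometric B (assoc_lattice B L U) (assoc_lattice B L V)"
  shows "\<exists>\<phi>\<in>O_L. \<phi> ` U = V"
proof -
  interpret P: framed_plane B L U a b e1 e2 f1 f2 by standard (rule F1)
  interpret Q: framed_plane B L V a b e1' e2' f1' f2' by standard (rule F2)
  obtain h where h: "h \<in> iso (assoc_lattice B L U) (assoc_lattice B L V)"
    and hform: "\<forall>X\<in>carrier (assoc_lattice B L U). \<forall>Y\<in>carrier (assoc_lattice B L U). coset_form B (h X) (h Y) = coset_form B X Y"
    using iso unfolding lattice_isometric_def by blast
  have hhom: "h \<in> hom (assoc_lattice B L U) (assoc_lattice B L V)"
    and hbij: "bij_betw h (P.kcoset ` P.C) (Q.kcoset ` Q.C)"
    using h by (auto simp: iso_def P.carrier_assoc Q.carrier_assoc)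
  have "\<exists>d\<in>Q.C. h (P.kcoset c) = Q.kcoset d" if "c \<in> P.C" for c
    using bij_betwE[OF hbij] that by blast
  then obtain \<mu> where \<mu>: "\<And>c. c \<in> P.C \<Longrightarrow> \<mu> c \<in> Q.C" "\<And>c. c \<in> P.C \<Longrightarrow> h (P.kcoset c) = Q.kcoset (\<mu> c)"
    by metis
  have \<mu>_add: "\<mu> (c + d) = \<mu> c + \<mu> d" if cd: "c \<in> P.C" "d \<in> P.C" for c d
  proof (rule Q.kcoset_inj)
    have "Q.kcoset (\<mu> (c + d)) = h (P.kcoset c \<otimes>\<^bsub>assoc_lattice B L U\<^esub> P.kcoset d)"
      using \<mu>(2) zsub_add[OF P.C_subspace cd] by (simp add: P.mult_assoc)
    also have "\<dots> = h (P.kcoset c) \<otimes>\<^bsub>assoc_lattice B L V\<^esub> h (P.kcoset d)"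
      using hhom cd by (auto simp: hom_def P.carrier_assoc)
    finally show "Q.kcoset (\<mu> (c + d)) = Q.kcoset (\<mu> c + \<mu> d)" using cd by (simp add: \<mu>(2) Q.mult_assoc)
  qed (use \<mu>(1) cd zsub_add[OF P.C_subspace] zsub_add[OF Q.C_subspace] in auto)
  have \<mu>_diff: "\<mu> (c - d) = \<mu> c - \<mu> d" if cd: "c \<in> P.C" "d \<in> P.C" for c d
    using \<mu>_add[OF zsub_diff[OF P.C_subspace cd] cd(2)] by simp
  have \<mu>_form: "B (\<mu> c) (\<mu> d) = B c d" if "c \<in> P.C" "d \<in> P.C" for c d
    using hform that \<mu> by (simp add: P.carrier_assoc flip: P.coset_form_kcoset Q.coset_form_kcoset)
  have \<mu>_surj: "\<exists>c\<in>P.C. \<mu> c = d" if "d \<in> Q.C" for d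
  proof -
    have "Q.kcoset d \<in> h ` P.kcoset ` P.C" using hbij that by (auto simp: bij_betw_def)
    then obtain c where c: "c \<in> P.C" "Q.kcoset d = Q.kcoset (\<mu> c)" using \<mu>(2) by auto
    then have "d = \<mu> c" using Q.kcoset_inj that \<mu>(1) by blast
    then show ?thesis using c(1) by blast
  qed
  define \<phi>0 where "\<phi>0 x = \<mu> (P.proj x) + Q.comb (B x f1 / a) (B x e1 / a) (B x f2 / b) (B x e2 / b)" for x
  have \<phi>0_comb: "\<phi>0 (c + P.comb p q r s) = \<mu> c + Q.comb p q r s" if "c \<in> P.C" for c p q r s
    unfolding \<phi>0_def P.comb_coords[OF that] using P.ab by simp
  have "\<exists>\<phi>\<in>O_L. \<forall>x\<in>L. \<phi> x = \<phi>0 x"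
  proof (rule OL_extend)
    show "\<phi>0 (x - y) = \<phi>0 x - \<phi>0 y" if "x \<in> L" "y \<in> L" for x y
      unfolding \<phi>0_def P.proj_diff \<mu>_diff[OF P.proj_C[OF that(1)] P.proj_C[OF that(2)]] form_simps diff_divide_distrib Q.comb_diff
      by simp
    show "B (\<phi>0 x) (\<phi>0 y) = B x y" if "x \<in> L" "y \<in> L" for x y
    proof -
      have c: "P.proj x \<in> P.C" "P.proj y \<in> P.C" using P.proj_C that by auto
      have "B (\<phi>0 x) (\<phi>0 y) = B (P.proj x + P.comb (B x f1 / a) (B x e1 / a) (B x f2 / b) (B x e2 / b))
          (P.proj y + P.comb (B y f1 / a) (B y e1 / a) (B y f2 / b) (B y e2 / b))"
        unfolding \<phi>0_def P.comb_form[OF c] Q.comb_form[OF \<mu>(1)[OF c(1)] \<mu>(1)[OF c(2)]] \<mu>_form[OF c] ..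
      then show ?thesis unfolding P.proj_decomp[symmetric] .
    qed
    show "\<phi>0 ` L = L"
    proof
      show "\<phi>0 ` L \<subseteq> L"
      proof
        fix y assume "y \<in> \<phi>0 ` L"
        then obtain x where x: "x \<in> L" "y = \<phi>0 x" by blast
        have "\<mu> (P.proj x) \<in> L" using \<mu>(1)[OF P.proj_C[OF x(1)]] by (simp add: Q.C_def)
        then show "y \<in> L" unfolding x(2) \<phi>0_def using P.dvd[OF x(1)] by (intro zsub_add[OF L_subspace] Q.comb_L)
      qed
      show "L \<subseteq> \<phi>0 ` L"
      proof
        fix y assume y: "y \<in> L"
        obtain c where c: "c \<in> P.C" "\<mu> c = Q.proj y" using \<mu>_surj[OF Q.proj_C[OF y]] by blast
        define x where "x = c + P.comb (B y f1' / a) (B y e1' / a) (B y f2' / b) (B y e2' / b)"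
        have "x \<in> L" unfolding x_def using c Q.dvd[OF y] by (intro zsub_add[OF L_subspace] P.comb_L) (auto simp: P.C_def)
        moreover have "\<phi>0 x = y" unfolding x_def \<phi>0_comb[OF c(1)] c(2) by (rule Q.proj_decomp[symmetric])
        ultimately show "y \<in> \<phi>0 ` L" by blast
      qed
    qed
  qed
  then obtain \<phi> where \<phi>: "\<phi> \<in> O_L" "\<And>x. x \<in> L \<Longrightarrow> \<phi> x = \<phi>0 x" by blast
  have z: "0 \<in> P.C" using zsub_0[OF P.C_subspace] .
  have "\<mu> 0 = 0" using \<mu>_diff[OF z z] by simp
  then have "\<phi>0 e1 = e1'" "\<phi>0 e2 = e2'"
    using \<phi>0_comb[OF z, of 1 0 0 0] \<phi>0_comb[OF z, of 0 0 1 0] by (simp_all add: P.comb_def Q.comb_def)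
  then have "\<phi> ` {e1, e2} = {e1', e2'}" using \<phi>(2) P.inL by simp
  then have "\<phi> ` U = V" unfolding P.U_span Q.U_span using qspan_linear_image[OF OLD(1)[OF \<phi>(1)], of "{e1, e2}"] by simp
  then show ?thesis using \<phi>(1) by blast
qed

section \<open>Invariance of the cusp data\<close>

context nondegenerate_lattice
begin

lemma OL_image_Int: "g \<in> O_L \<Longrightarrow> g ` (A \<inter> A') = g ` A \<inter> g ` A'"
  using OLD(4) by (simp add: bij_is_inj image_Int)

lemma OL_image_ratspace: "g \<in> O_L \<Longrightarrow> g ` ratspace L = ratspace L"
  unfolding ratspace_def using qspan_linear_image[OF OLD(1)] OLD(3) by metis

lemma OL_image_qsubspace: "g \<in> O_L \<Longrightarrow> qvec.subspace A \<Longrightarrow> qvec.subspace (g ` A)"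
  by (rule module_hom.subspace_image[OF linear_q_hom[OF OLD(1)]])

lemma OL_isotropic_plane:
  assumes g: "g \<in> O_L" and U: "U \<in> isotropic_planes B L"
  shows "g ` U \<in> isotropic_planes B L"
proof -
  have U': "U \<subseteq> ratspace L" "qvec.subspace U" "qvec.dim U = 2" "isotropic B U"
    using U by (auto simp: isotropic_planes_def)
  obtain S where S: "S \<subseteq> U" "qvec.independent S" "U \<subseteq> qvec.span S" "card S = 2"
    using qvec.basis_exists[of U] U'(3) by metis
  have inj: "inj g" using OLD(4)[OF g] by (rule bij_is_inj)
  have "qvec.independent (g ` S)"
    using module_hom.dependent_inj_imageD[OF linear_q_hom[OF OLD(1)[OF g]], of S] S(2) inj by (auto intro: inj_on_subset)
  moreover have "g ` U = qvec.span (g ` S)"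
  proof -
    have "U = qvec.span S" using S(1,3) qvec.span_minimal[OF S(1) U'(2)] by blast
    then show ?thesis using qspan_linear_image[OF OLD(1)[OF g]] by metis
  qed
  ultimately have "qvec.dim (g ` U) = card (g ` S)"
    by (simp add: qvec.dim_eq_card_independent)
  also have "\<dots> = 2" using S(4) inj by (metis card_image inj_on_subset subset_UNIV)
  finally have "qvec.dim (g ` U) = 2" .
  moreover have "g ` U \<subseteq> ratspace L" using U'(1) OL_image_ratspace[OF g] by blast
  ultimately show ?thesis
    using OL_image_qsubspace[OF g U'(2)] U'(4) OLD(2)[OF g] by (auto simp: isotropic_planes_def isotropic_def)
qed

lemma OL_image_zsub: "g \<in> O_L \<Longrightarrow> zmod.subspace A \<Longrightarrow> zmod.subspace (g ` A)"
proof (rule zsubI)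
  assume g: "g \<in> O_L" and A: "zmod.subspace A"
  show "0 \<in> g ` A" using zsub_0[OF A] linear_0[OF OLD(1)[OF g]] by force
  show "x - y \<in> g ` A" if xy: "x \<in> g ` A" "y \<in> g ` A" for x y
  proof -
    obtain u v where "u \<in> A" "v \<in> A" "x = g u" "y = g v" using xy by blast
    then have "u - v \<in> A" "x - y = g (u - v)" using zsub_diff[OF A] linear_diff[OF OLD(1)[OF g]] by auto
    then show ?thesis by blast
  qed
qed

lemma OL_plane_splits:
  assumes g: "g \<in> O_L" and U: "plane_splits B L U"
  shows "plane_splits B L (g ` U)"
proof -
  obtain V M where V: "V \<subseteq> ratspace L" "qvec.subspace V" "isotropic B V" "dual_subspaces B U V"
    and M: "even_on B M" "\<forall>x\<in>M - {0}. B x x > 0"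
    and ds: "orth_direct_sum B L M {x + y | x y. x \<in> L \<inter> U \<and> y \<in> L \<inter> V}"
    using U unfolding plane_splits_def by (elim exE conjE) (rule that)
  note gD = OLD(1,2,3)[OF g]
  have g0: "g x = 0 \<longleftrightarrow> x = 0" for x
    using linear_inj_iff_eq_0[OF gD(1)] bij_is_inj[OF OLD(4)[OF g]] linear_0[OF gD(1)] by metis
  have "g ` V \<subseteq> ratspace L" using V(1) OL_image_ratspace[OF g] by blast
  moreover have "qvec.subspace (g ` V)" by (rule OL_image_qsubspace[OF g V(2)])
  moreover have "isotropic B (g ` V)" using V(3) gD(2) by (auto simp: isotropic_def)
  moreover have "dual_subspaces B (g ` U) (g ` V)" using V(4) gD(2) g0 by (auto simp: dual_subspaces_def)
  moreover have "even_on B (g ` M)" using M(1) gD(2) by (auto simp: even_on_def)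
  moreover have "\<forall>x\<in>g ` M - {0}. B x x > 0" using M(2) gD(2) g0 by auto
  moreover have "orth_direct_sum B L (g ` M) {x + y | x y. x \<in> L \<inter> g ` U \<and> y \<in> L \<inter> g ` V}"
  proof -
    let ?N = "{x + y | x y. x \<in> L \<inter> U \<and> y \<in> L \<inter> V}"
    have N: "{x + y | x y. x \<in> L \<inter> g ` U \<and> y \<in> L \<inter> g ` V} = g ` ?N"
      using OL_image_Int[OF g, of L] gD(3) image_set_sum[OF gD(1), of "L \<inter> U" "L \<inter> V"] by simp
    have d: "zmod.subspace M" "zmod.subspace ?N" "M \<inter> ?N = {0}" "\<forall>x\<in>M. \<forall>y\<in>?N. B x y = 0"
      "L = {x + y | x y. x \<in> M \<and> y \<in> ?N}"
      using ds unfolding orth_direct_sum_def by blast+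
    have "g ` M \<inter> g ` ?N = {0}" using OL_image_Int[OF g, of M ?N] d(3) linear_0[OF gD(1)] by simp
    moreover have "L = {x + y | x y. x \<in> g ` M \<and> y \<in> g ` ?N}"
      using image_set_sum[OF gD(1), of M ?N] d(5) gD(3) by (simp only:)
    moreover have "\<forall>x\<in>g ` M. \<forall>y\<in>g ` ?N. B x y = 0" using d(4) by (simp only: ball_simps gD(2))
    ultimately show ?thesis
      unfolding N orth_direct_sum_def using OL_image_zsub[OF g d(1)] OL_image_zsub[OF g d(2)] by (intro conjI)
  qed
  ultimately show ?thesis unfolding plane_splits_def by (intro exI[of _ "g ` V"] exI[of _ "g ` M"] conjI)
qed

lemma plane_type_subset: "plane_type B L U \<subseteq> carrier (disc_group B L)"
  by (auto simp: plane_type_eq carrier_disc)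

lemma OL_plane_type:
  assumes g: "g \<in> O_L"
  shows "plane_type B L (g ` U) = red B L g ` plane_type B L U"
proof -
  have "L' \<inter> g ` U = g ` (L' \<inter> U)" using OL_image_Int[OF g] OLD(7)[OF g] by simp
  then have "plane_type B L (g ` U) = (\<lambda>x. dcoset (g x)) ` (L' \<inter> U)" by (simp add: plane_type_eq image_image)
  also have "\<dots> = red B L g ` plane_type B L U"
    unfolding plane_type_eq image_image by (rule image_cong) (simp_all add: red_dcoset[OF g])
  finally show ?thesis .
qed

lemma card_plane_type_OL: "g \<in> O_L \<Longrightarrow> card (plane_type B L (g ` U)) = card (plane_type B L U)"
  unfolding OL_plane_type using red_Bij[of g] plane_type_subset
  by (intro card_image) (auto simp: Bij_def bij_betw_def intro: inj_on_subset)

lemma OL_overlattice: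
  assumes g: "g \<in> O_L"
  shows "overlattice B L (g ` U) = g ` overlattice B L U" "perp B L (g ` U) = g ` perp B L U"
proof -
  have "L' \<inter> g ` U = g ` (L' \<inter> U)" using OL_image_Int[OF g] OLD(7)[OF g] by simp
  then show "overlattice B L (g ` U) = g ` overlattice B L U"
    unfolding overlattice_def using image_set_sum[OF OLD(1)[OF g], of "L' \<inter> U" L] OLD(3)[OF g] by simp
  show "perp B L (g ` U) = g ` perp B L U"
  proof
    show "g ` perp B L U \<subseteq> perp B L (g ` U)"
      using OL_image_ratspace[OF g] OLD(2)[OF g] by (auto simp: perp_def)
    show "perp B L (g ` U) \<subseteq> g ` perp B L U"
    proof
      fix y assume y: "y \<in> perp B L (g ` U)"
      then have "y \<in> g ` ratspace L" using OL_image_ratspace[OF g] by (simp add: perp_def)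
      then obtain x where "y = g x" "x \<in> ratspace L" by (rule imageE)
      then show "y \<in> g ` perp B L U" using y OLD(2)[OF g] by (auto simp: perp_def)
    qed
  qed
qed

lemma OL_assoc_lattice:
  assumes g: "g \<in> O_L"
  shows "lattice_isometric B (assoc_lattice B L U) (assoc_lattice B L (g ` U))"
proof -
  define A N where "A = overlattice B L U \<inter> perp B L U" and "N = overlattice B L U \<inter> U"
  note gD = OLD(1,2)[OF g]
  have gi: "inj g" using OLD(4)[OF g] by (rule bij_is_inj)
  have AN: "overlattice B L (g ` U) \<inter> perp B L (g ` U) = g ` A" "overlattice B L (g ` U) \<inter> g ` U = g ` N"
    by (simp_all add: A_def N_def OL_overlattice[OF g] OL_image_Int[OF g])
  note gk = image_translate[OF gD(1)]
  have "image g \<in> iso (assoc_lattice B L U) (assoc_lattice B L (g ` U))"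
  proof -
    have "image g \<in> hom (additive_grp A Mod N) (additive_grp (g ` A) Mod (g ` N))"
      unfolding hom_def mem_Collect_eq
    proof (intro conjI ballI)
      show "image g \<in> carrier (additive_grp A Mod N) \<rightarrow> carrier (additive_grp (g ` A) Mod (g ` N))"
        by (auto simp: carrier_quotient gk)
      show "g ` (X \<otimes>\<^bsub>additive_grp A Mod N\<^esub> Y) = g ` X \<otimes>\<^bsub>additive_grp (g ` A) Mod (g ` N)\<^esub> g ` Y" for X Y
        unfolding mult_quotient by (rule image_set_sum[OF gD(1)])
    qed
    moreover have "bij_betw (image g) (translate N ` A) (translate (g ` N) ` g ` A)"
      unfolding bij_betw_def image_image gk using gi by (auto simp: inj_on_def inj_image_eq_iff)
    ultimately show ?thesis
      unfolding iso_def assoc_lattice_def AN A_def[symmetric] N_def[symmetric] by (simp add: carrier_quotient)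
  qed
  moreover have "coset_form B (g ` X) (g ` Y) = coset_form B X Y" for X Y
    unfolding coset_form_def by (simp add: gD(2))
  ultimately show ?thesis unfolding lattice_isometric_def by blast
qed

text \<open>This puts the annihilator condition in a form that depends on \<open>U\<close> only
  through its type, so that equal types can be substituted.\<close>

lemma type_exponent:
  assumes k: "k \<in> \<int>"
  shows "(\<forall>t\<in>L' \<inter> U. k *\<^sub>R t \<in> L) \<longleftrightarrow> (\<forall>X\<in>plane_type B L U. \<forall>x\<in>X. k *\<^sub>R x \<in> L)"
proof
  assume h: "\<forall>t\<in>L' \<inter> U. k *\<^sub>R t \<in> L"
  show "\<forall>X\<in>plane_type B L U. \<forall>x\<in>X. k *\<^sub>R x \<in> L"
  proof (intro ballI)
    fix X x assume "X \<in> plane_type B L U" "x \<in> X"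
    then obtain t l where "t \<in> L' \<inter> U" "l \<in> L" "x = l + t" by (auto simp: plane_type_eq dcoset_eq)
    then show "k *\<^sub>R x \<in> L"
      using h zsub_add[OF L_subspace zsub_scale[OF L_subspace k \<open>l \<in> L\<close>]] by (simp add: scaleR_add_right)
  qed
next
  assume h: "\<forall>X\<in>plane_type B L U. \<forall>x\<in>X. k *\<^sub>R x \<in> L"
  show "\<forall>t\<in>L' \<inter> U. k *\<^sub>R t \<in> L"
  proof
    fix t assume "t \<in> L' \<inter> U"
    then have "dcoset t \<in> plane_type B L U" by (simp add: plane_type_eq)
    moreover have "t \<in> dcoset t" using zsub_0[OF L_subspace] by (force simp: dcoset_eq)
    ultimately show "k *\<^sub>R t \<in> L" using h by blast
  qed
qed

text \<open>The exponent and the order of the type are invariant under isometries of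
  \<open>L\<close>. The same integers are multiples of \<open>b\<close> and of \<open>b'\<close>, so
  these divide each other; the orders \<open>a * b\<close> and \<open>a' * b'\<close> then give
  \<open>a = a'\<close>.\<close>

lemma frame_invariants:
  assumes F1: "frame U a b e1 e2 f1 f2" and F2: "frame V a' b' e1' e2' f1' f2'"
    and g: "g \<in> O_L" and type: "plane_type B L V = plane_type B L (g ` U)"
  shows "a = a'" "b = b'"
proof -
  interpret P: framed_plane B L U a b e1 e2 f1 f2 by standard (rule F1)
  interpret Q: framed_plane B L V a' b' e1' e2' f1' f2' by standard (rule F2)
  have "k / b \<in> \<int> \<longleftrightarrow> k / b' \<in> \<int>" if k: "k \<in> \<int>" for k
  proof -
    have "L' \<inter> g ` U = g ` (L' \<inter> U)" using OL_image_Int[OF g] OLD(7)[OF g] by simp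
    then have "(\<forall>t\<in>L' \<inter> g ` U. k *\<^sub>R t \<in> L) \<longleftrightarrow> (\<forall>t\<in>L' \<inter> U. g (k *\<^sub>R t) \<in> L)"
      by (simp add: linear_scale[OF OLD(1)[OF g]])
    also have "\<dots> \<longleftrightarrow> (\<forall>t\<in>L' \<inter> U. k *\<^sub>R t \<in> L)" using OLD(5,6)[OF g] by blast
    finally have "(\<forall>t\<in>L' \<inter> V. k *\<^sub>R t \<in> L) \<longleftrightarrow> (\<forall>t\<in>L' \<inter> U. k *\<^sub>R t \<in> L)"
      unfolding type_exponent[OF k] type .
    then show ?thesis using P.T_exponent[OF k] Q.T_exponent[OF k] by (simp add: P.T_def Q.T_def)
  qed
  from this[of b] this[of b'] have "b / b' \<in> \<int>" "b' / b \<in> \<int>" using P.ab Q.ab by simp_all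
  then obtain i j where ij: "b / b' = of_int i" "b' / b = of_int j" by (auto elim!: Ints_cases)
  then have "real_of_int (i * j) = 1" using P.ab Q.ab by (simp flip: ij)
  then have "i * j = 1" by linarith
  moreover have "i > 0" using ij(1) P.ab Q.ab by (metis divide_pos_pos of_int_0_less_iff)
  ultimately have "i = 1" using zmult_eq_1_iff[of i j] by auto
  then show b: "b = b'" using ij(1) Q.ab by (simp add: field_simps)
  have "a * b = a' * b'" using P.card_type Q.card_type card_plane_type_OL[OF g] type by metis
  then show "a = a'" using b P.ab by simp
qed

lemma reflection_OL:
  assumes ef: "B e e = 0" "B f f = 0" "B e f = 1"
    and L: "\<And>x. x \<in> L \<Longrightarrow> plane_reflection e f x \<in> L"
  shows "plane_reflection e f \<in> O_L"
proof -
  note r = plane_reflection[OF ef]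
  have "plane_reflection e f ` L = L"
  proof
    show "plane_reflection e f ` L \<subseteq> L" using L by blast
    show "L \<subseteq> plane_reflection e f ` L" using L r(3) by (metis imageI subsetI)
  qed
  then show ?thesis using r by (simp add: OL_iff)
qed

end

section \<open>Isometries preserving the component and transitivity on splitting planes\<close>

locale period_lattice = hyperbolic_lattice B L e0 f0 for B :: "'v::euclidean_space \<Rightarrow> 'v \<Rightarrow> real" and L e0 f0 +
  fixes n :: nat and \<H> :: "('v \<times> 'v) set set"
  assumes sig: "signature B n 2 TYPE('v)" and component: "\<H> \<in> period_components B"
begin

abbreviation "O_plus \<equiv> OL_plus B L \<H>"

lemma OL_plus_iff: "f \<in> O_plus \<longleftrightarrow> f \<in> O_L \<and> (\<lambda>p. map_prod f f ` p) ` \<H> = \<H>"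
  by (simp add: OL_plus_def)

lemma OL_plus_id: "id \<in> O_plus"
  using OL_id by (simp add: OL_plus_iff prod.map_id)

lemma act_comp: "(\<lambda>p. map_prod (f \<circ> g) (f \<circ> g) ` p) ` \<H> = (\<lambda>p. map_prod f f ` p) ` (\<lambda>p. map_prod g g ` p) ` \<H>"
  by (simp add: image_image prod.map_comp)

lemma OL_plus_comp: "f \<in> O_plus \<Longrightarrow> g \<in> O_plus \<Longrightarrow> f \<circ> g \<in> O_plus"
  unfolding OL_plus_iff act_comp by (simp add: OL_comp)

lemma OL_plus_inv:
  assumes "f \<in> O_plus"
  shows "inv_into UNIV f \<in> O_plus"
proof -
  have f: "f \<in> O_L" "(\<lambda>p. map_prod f f ` p) ` \<H> = \<H>" using assms by (auto simp: OL_plus_iff)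
  have "(\<lambda>p. map_prod (inv_into UNIV f) (inv_into UNIV f) ` p) ` \<H> =
      (\<lambda>p. map_prod (inv_into UNIV f \<circ> f) (inv_into UNIV f \<circ> f) ` p) ` \<H>"
    unfolding act_comp f(2) ..
  also have "\<dots> = \<H>" unfolding OL_inv_comp[OF f(1)] by (simp add: prod.map_id)
  finally show ?thesis using OL_inv[OF f(1)] by (simp add: OL_plus_iff)
qed

lemma OL_plus_sub: "f \<in> O_plus \<Longrightarrow> f \<in> O_L"
  by (simp add: OL_plus_iff)

lemma plus_or_reflected:
  assumes g: "g \<in> O_L" and ef: "B e e = 0" "B f f = 0" "B e f = 1"
    and r: "plane_reflection e f \<in> O_L"
  shows "g \<in> O_plus \<or> plane_reflection e f \<circ> g \<in> O_plus"
  using component_swap[OF sig ef component OLD(1,4)[OF g] OLD(2)[OF g]] g OL_comp[OF r g]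
  by (auto simp: OL_plus_iff)

text \<open>Surjectivity of the reduction turns the abstract orbit under \<open>O(D)\<close> into
  the types of actual planes.\<close>

lemma OD_orbit_plane_type: "OD_orbit B L (plane_type B L U) = (\<lambda>\<phi>. plane_type B L (\<phi> ` U)) ` O_L"
proof -
  have "O_D = red B L ` O_L" using red_surj red_OD by blast
  then show ?thesis unfolding OD_orbit_def image_image by (auto simp: OL_plane_type)
qed

lemma OD_orbit_invariant:
  assumes g: "g \<in> O_L"
  shows "OD_orbit B L (plane_type B L (g ` U)) = OD_orbit B L (plane_type B L U)"
proof -
  have "(\<lambda>\<phi>. plane_type B L (\<phi> ` g ` U)) ` O_L = (\<lambda>\<phi>. plane_type B L (\<phi> ` U)) ` (\<lambda>\<phi>. \<phi> \<circ> g) ` O_L"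
    by (simp add: image_image image_comp)
  moreover have "(\<lambda>\<phi>. \<phi> \<circ> g) ` O_L = O_L"
  proof
    show "(\<lambda>\<phi>. \<phi> \<circ> g) ` O_L \<subseteq> O_L" using OL_comp g by blast
    show "O_L \<subseteq> (\<lambda>\<phi>. \<phi> \<circ> g) ` O_L"
    proof
      fix \<psi> assume "\<psi> \<in> O_L"
      then have "\<psi> \<circ> inv_into UNIV g \<in> O_L" using OL_comp OL_inv[OF g] by blast
      moreover have "\<psi> = (\<psi> \<circ> inv_into UNIV g) \<circ> g" using OL_inv_comp(1)[OF g] by (simp add: comp_assoc)
      ultimately show "\<psi> \<in> (\<lambda>\<phi>. \<phi> \<circ> g) ` O_L" by blast
    qed
  qed
  ultimately show ?thesis unfolding OD_orbit_plane_type by simp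
qed

text \<open>As \<open>e0\<close> and \<open>f0\<close> lie in \<open>L\<close>, their reflection
  moves vectors of \<open>L'\<close> by elements of \<open>L\<close>. It acts trivially on
  \<open>L'/L\<close> and corrects the component without changing the reduction.\<close>

lemma red_surj_plus:
  assumes "\<sigma> \<in> O_D"
  shows "\<exists>g\<in>O_plus. red B L g = \<sigma>"
proof -
  let ?r = "plane_reflection e0 f0"
  obtain g where g: "g \<in> O_L" "red B L g = \<sigma>" using red_surj[OF assms] by blast
  have diff: "x - ?r x \<in> L" if "x \<in> L'" for x
    using that dual_pairing(1)[OF that e0_L] dual_pairing(1)[OF that f0_L] e0_L f0_L
    by (auto simp: plane_reflection_def intro!: zsub_intros L_subspace)
  have r: "?r \<in> O_L"
  proof (rule reflection_OL[OF ee0 ff0 ef0])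
    fix x assume x: "x \<in> L"
    then have "x - (x - ?r x) \<in> L" using diff[of x] L_sub_dual zsub_diff[OF L_subspace] by blast
    then show "?r x \<in> L" by simp
  qed
  have "red B L (?r \<circ> g) = red B L g"
    unfolding red_def
  proof (rule restrict_ext)
    fix X assume "X \<in> carrier (disc_group B L)"
    then obtain x where x: "x \<in> L'" "X = dcoset x" by (auto simp: carrier_disc)
    have "g x \<in> L'" using OLD(8)[OF g(1) x(1)] .
    from diff[OF this] have "dcoset (?r (g x)) = dcoset (g x)" by (metis dcoset_eq_iff)
    then show "(?r \<circ> g) ` X = g ` X"
      unfolding x(2) image_comp[symmetric] image_dcoset[OF g(1)] image_dcoset[OF r] .
  qed
  then show ?thesis using plus_or_reflected[OF g(1) ee0 ff0 ef0 r] g(2) by metis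
qed

theorem splitting_planes_equivalent:
  assumes U: "U \<in> isotropic_planes B L" "plane_splits B L U"
    and V: "V \<in> isotropic_planes B L" "plane_splits B L V"
    and type: "OD_orbit B L (plane_type B L U) = OD_orbit B L (plane_type B L V)"
    and iso: "lattice_isometric B (assoc_lattice B L U) (assoc_lattice B L V)"
  shows "\<exists>\<phi>\<in>O_plus. \<phi> ` U = V"
proof -
  obtain a b e1 e2 f1 f2 where F1: "frame U a b e1 e2 f1 f2" using frame_exists[OF U] by blast
  obtain a' b' e1' e2' f1' f2' where F2: "frame V a' b' e1' e2' f1' f2'" using frame_exists[OF V] by blast
  interpret P: framed_plane B L U a b e1 e2 f1 f2 by standard (rule F1)
  have "plane_type B L (id ` V) \<in> OD_orbit B L (plane_type B L V)"
    unfolding OD_orbit_plane_type using OL_id by (rule imageI)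
  then have "plane_type B L V \<in> OD_orbit B L (plane_type B L U)" by (simp add: type)
  then obtain g where g: "g \<in> O_L" "plane_type B L V = plane_type B L (g ` U)"
    unfolding OD_orbit_plane_type by blast
  have "a = a'" "b = b'" using frame_invariants[OF F1 F2 g] .
  then obtain \<phi> where \<phi>: "\<phi> \<in> O_L" "\<phi> ` U = V"
    using framed_planes_isometric[OF F1 _ iso] F2 by blast
  \<comment> \<open>\<open>f\<close> lies in \<open>L'\<close> but in general not in
    \<open>L\<close>. The reflection still preserves \<open>L\<close> because \<open>a\<close>
    divides all pairings of \<open>L\<close> with \<open>e1\<close> and \<open>f1\<close>.\<close>
  define f where "f = (1 / a) *\<^sub>R f1"
  let ?r = "plane_reflection e1 f"
  have ef: "B e1 e1 = 0" "B f f = 0" "B e1 f = 1" using P.ab by (simp_all add: f_def)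
  have r: "?r \<in> O_L"
  proof (rule reflection_OL[OF ef])
    fix x assume x: "x \<in> L"
    have "?r x = x - (2 * (B x f1 / a)) *\<^sub>R e1 - (2 * (B x e1 / a)) *\<^sub>R f1"
      by (simp add: plane_reflection_def f_def)
    also have "\<dots> \<in> L" using x P.dvd[OF x] P.inL by (intro zsub_intros L_subspace Ints_mult) auto
    finally show "?r x \<in> L" .
  qed
  have rU: "?r x \<in> U" if x: "x \<in> U" for x
  proof -
    obtain p q where pq: "p \<in> \<rat>" "q \<in> \<rat>" "x = p *\<^sub>R e1 + q *\<^sub>R e2" using qspan_pair x P.U_span by blast
    have "?r x = x - (2 * p) *\<^sub>R e1" using P.ab by (simp add: plane_reflection_def f_def pq(3))
    then show ?thesis
      using qvec.subspace_diff[OF P.U_qsub x] qsub_scale[OF P.U_qsub _ P.e_U(1), of "2 * p"] pq(1) by simp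
  qed
  have rUU: "?r ` U = U"
    using rU plane_reflection(3)[OF ef] by (metis image_subset_iff subsetI imageI subset_antisym)
  \<comment> \<open>\<open>plus_or_reflected\<close> composes with the reflection on the left.
    Therefore the inverse, from \<open>V\<close> to \<open>U\<close>, is corrected: the reflection
    then acts on \<open>U\<close>, which it preserves.\<close>
  define \<psi> where "\<psi> = inv_into UNIV \<phi>"
  have \<psi>: "\<psi> \<in> O_L" "\<phi> \<circ> \<psi> = id" "\<psi> \<circ> \<phi> = id"
    using OL_inv[OF \<phi>(1)] OL_inv_comp[OF \<phi>(1)] by (simp_all add: \<psi>_def)
  have \<psi>V: "\<psi> ` V = U" using \<psi>(3) by (simp add: \<phi>(2)[symmetric] image_comp)
  obtain \<eta> where \<eta>: "\<eta> \<in> O_plus" "\<eta> ` V = U"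
    using plus_or_reflected[OF \<psi>(1) ef r]
  proof
    assume "?r \<circ> \<psi> \<in> O_plus"
    moreover have "(?r \<circ> \<psi>) ` V = U" unfolding image_comp[symmetric] \<psi>V rUU ..
    ultimately show ?thesis using that by blast
  qed (use \<psi>V that in blast)
  have "inv_into UNIV \<eta> ` U = V"
    using OL_inv_comp(1)[OF OL_plus_sub[OF \<eta>(1)]] by (simp add: \<eta>(2)[symmetric] image_comp)
  then show ?thesis using OL_plus_inv[OF \<eta>(1)] by blast
qed

end

section \<open>Cusps and double cosets\<close>

lemma bij_betw_factor:
  assumes "\<And>x y. x \<in> X \<Longrightarrow> y \<in> X \<Longrightarrow> p x = p y \<longleftrightarrow> q x = q y"
  shows "\<exists>F. bij_betw F (p ` X) (q ` X) \<and> (\<forall>x\<in>X. F (p x) = q x)"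
proof -
  define F where "F z = q (inv_into X p z)" for z
  have F: "F (p x) = q x" if "x \<in> X" for x
    using assms[of "inv_into X p (p x)" x] that by (simp add: F_def inv_into_into f_inv_into_f)
  have "inj_on F (p ` X)" by (rule inj_onI) (auto simp: F assms)
  moreover have "F ` p ` X = q ` X" by (simp add: image_image F)
  ultimately show ?thesis using F unfolding bij_betw_def by blast
qed

context nondegenerate_lattice
begin

lemma qspan_Int_L:
  assumes "V \<in> isotropic_planes B L"
  shows "qvec.span (L \<inter> V) = V"
proof
  have V: "V \<subseteq> ratspace L" "qvec.subspace V" using assms by (auto simp: isotropic_planes_def)
  then show "qvec.span (L \<inter> V) \<subseteq> V" by (intro qvec.span_minimal) auto
  show "V \<subseteq> qvec.span (L \<inter> V)"
  proof
    fix x assume x: "x \<in> V"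
    then obtain N where N: "N > 0" "of_nat N *\<^sub>R x \<in> L" using ratspace_multiple V(1) by blast
    have "of_nat N *\<^sub>R x \<in> V" using qsub_scale[OF V(2) _ x, of "of_nat N"] by simp
    with N(2) have "(1 / of_nat N) *\<^sub>R (of_nat N *\<^sub>R x) \<in> qvec.span (L \<inter> V)"
      by (intro qsub_scale[OF qvec.subspace_span _ qvec.span_base]) auto
    then show "x \<in> qvec.span (L \<inter> V)" using N(1) by simp
  qed
qed

end

locale cusp_setting = period_lattice B L e0 f0 n \<H>
  for B :: "'v::euclidean_space \<Rightarrow> 'v \<Rightarrow> real" and L e0 f0 n \<H> +
  fixes \<Gamma> :: "('v \<Rightarrow> 'v) set" and U :: "'v set"
  assumes \<Gamma>_subgroup: "subgroup \<Gamma> (OL B L)" and \<Gamma>_kernel: "disc_kernel B L \<subseteq> \<Gamma>"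
    and U_plane: "U \<in> isotropic_planes B L" and U_splits: "plane_splits B L U"
begin

abbreviation "\<Gamma>p \<equiv> \<Gamma> \<inter> O_plus"
abbreviation "stab \<equiv> stab_plus B L \<H> (L \<inter> U)"
abbreviation "dc \<phi> \<equiv> double_coset (OD B L) (red B L ` \<Gamma>) (red B L ` stab) (red B L \<phi>)"
abbreviation "cusp \<phi> \<equiv> cusp_of \<Gamma>p (\<phi> ` U)"

lemma \<Gamma>_OL: "\<gamma> \<in> \<Gamma> \<Longrightarrow> \<gamma> \<in> O_L"
  using subgroup.mem_carrier[OF \<Gamma>_subgroup] .

lemma \<Gamma>_id: "id \<in> \<Gamma>"
  using subgroup.one_closed[OF \<Gamma>_subgroup] by (simp add: OL_one)

lemma \<Gamma>_comp: "\<gamma> \<in> \<Gamma> \<Longrightarrow> \<delta> \<in> \<Gamma> \<Longrightarrow> \<gamma> \<circ> \<delta> \<in> \<Gamma>"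
  using subgroup.m_closed[OF \<Gamma>_subgroup] by (simp add: OL_mult)

lemma \<Gamma>_inv: "\<gamma> \<in> \<Gamma> \<Longrightarrow> inv_into UNIV \<gamma> \<in> \<Gamma>"
proof -
  assume \<gamma>: "\<gamma> \<in> \<Gamma>"
  have "inv\<^bsub>OL B L\<^esub> \<gamma> = inv_into UNIV \<gamma>"
    by (rule group.inv_equality[OF OL_group])
      (simp_all add: OL_mult OL_one OL_inv_comp(1)[OF \<Gamma>_OL[OF \<gamma>]] \<Gamma>_OL[OF \<gamma>] OL_inv[OF \<Gamma>_OL[OF \<gamma>]])
  then show ?thesis using subgroup.m_inv_closed[OF \<Gamma>_subgroup \<gamma>] by simp
qed

lemma inv_comp_left: "f \<in> O_L \<Longrightarrow> inv_into UNIV f (f x) = x"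
  and inv_comp_right: "f \<in> O_L \<Longrightarrow> f (inv_into UNIV f x) = x"
  using OL_inv_comp[of f] by (auto simp: fun_eq_iff)

lemma stab_iff: "f \<in> stab \<longleftrightarrow> f \<in> O_plus \<and> f ` U = U"
proof
  assume f: "f \<in> stab"
  then have f': "f \<in> O_plus" "f ` (L \<inter> U) = L \<inter> U" by (auto simp: stab_plus_def)
  have "f ` U = f ` qvec.span (L \<inter> U)" by (simp add: qspan_Int_L[OF U_plane])
  also have "\<dots> = qvec.span (L \<inter> U)"
    unfolding qspan_linear_image[OF OLD(1)[OF OL_plus_sub[OF f'(1)]]] f'(2) ..
  also have "\<dots> = U" by (rule qspan_Int_L[OF U_plane])
  finally show "f \<in> O_plus \<and> f ` U = U" using f' by blast
next
  assume f: "f \<in> O_plus \<and> f ` U = U"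
  then have "f ` (L \<inter> U) = L \<inter> U" using OL_image_Int[OF OL_plus_sub] OLD(3)[OF OL_plus_sub] by metis
  then show "f \<in> stab" using f by (simp add: stab_plus_def)
qed

lemma stab_id: "id \<in> stab" and stab_comp: "f \<in> stab \<Longrightarrow> g \<in> stab \<Longrightarrow> f \<circ> g \<in> stab"
  unfolding stab_iff image_comp[symmetric] by (simp_all add: OL_plus_id OL_plus_comp)

lemma dc_eq:
  assumes "\<phi> \<in> O_L"
  shows "dc \<phi> = {red B L (\<gamma> \<circ> \<phi> \<circ> s) | \<gamma> s. \<gamma> \<in> \<Gamma> \<and> s \<in> stab}"
proof -
  have eq: "red B L \<gamma> \<otimes>\<^bsub>OD B L\<^esub> red B L \<phi> \<otimes>\<^bsub>OD B L\<^esub> red B L s = red B L (\<gamma> \<circ> \<phi> \<circ> s)"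
    if "\<gamma> \<in> \<Gamma>" "s \<in> stab" for \<gamma> s
    using that assms \<Gamma>_OL OL_plus_sub OL_comp by (simp add: red_comp stab_iff)
  show ?thesis
    unfolding double_coset_def
  proof (intro equalityI subsetI)
    fix X assume "X \<in> {c \<otimes>\<^bsub>OD B L\<^esub> red B L \<phi> \<otimes>\<^bsub>OD B L\<^esub> d | c d. c \<in> red B L ` \<Gamma> \<and> d \<in> red B L ` stab}"
    then show "X \<in> {red B L (\<gamma> \<circ> \<phi> \<circ> s) | \<gamma> s. \<gamma> \<in> \<Gamma> \<and> s \<in> stab}" using eq by blast
  next
    fix X assume "X \<in> {red B L (\<gamma> \<circ> \<phi> \<circ> s) | \<gamma> s. \<gamma> \<in> \<Gamma> \<and> s \<in> stab}"
    then obtain \<gamma> s where "X = red B L (\<gamma> \<circ> \<phi> \<circ> s)" "\<gamma> \<in> \<Gamma>" "s \<in> stab" by blast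
    then show "X \<in> {c \<otimes>\<^bsub>OD B L\<^esub> red B L \<phi> \<otimes>\<^bsub>OD B L\<^esub> d | c d. c \<in> red B L ` \<Gamma> \<and> d \<in> red B L ` stab}"
      using eq[of \<gamma> s, symmetric] by blast
  qed
qed

lemma dc_subset:
  assumes "\<phi> \<in> O_L" "\<psi> \<in> O_L" "\<gamma> \<in> \<Gamma>" "s \<in> stab" "\<phi> = \<gamma> \<circ> \<psi> \<circ> s"
  shows "dc \<phi> \<subseteq> dc \<psi>"
proof
  fix X assume "X \<in> dc \<phi>"
  then obtain \<gamma>' s' where X: "X = red B L (\<gamma>' \<circ> \<phi> \<circ> s')" "\<gamma>' \<in> \<Gamma>" "s' \<in> stab" unfolding dc_eq[OF assms(1)] by blast
  have "\<gamma>' \<circ> \<phi> \<circ> s' = (\<gamma>' \<circ> \<gamma>) \<circ> \<psi> \<circ> (s \<circ> s')" by (simp add: assms(5) comp_assoc)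
  then have "X = red B L ((\<gamma>' \<circ> \<gamma>) \<circ> \<psi> \<circ> (s \<circ> s'))" by (simp only: X(1))
  then show "X \<in> dc \<psi>" unfolding dc_eq[OF assms(2)]
    using \<Gamma>_comp[OF X(2) assms(3)] stab_comp[OF assms(4) X(3)] by blast
qed

lemma \<Gamma>p_comp: "f \<in> \<Gamma>p \<Longrightarrow> g \<in> \<Gamma>p \<Longrightarrow> f \<circ> g \<in> \<Gamma>p" and \<Gamma>p_inv: "f \<in> \<Gamma>p \<Longrightarrow> inv_into UNIV f \<in> \<Gamma>p" and \<Gamma>p_id: "id \<in> \<Gamma>p"
  using \<Gamma>_comp OL_plus_comp \<Gamma>_inv OL_plus_inv \<Gamma>_id OL_plus_id by auto

lemma cusp_of_eq:
  assumes "\<gamma> \<in> \<Gamma>p"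
  shows "cusp_of \<Gamma>p (\<gamma> ` V) = cusp_of \<Gamma>p V"
proof
  have sub: "cusp_of \<Gamma>p (\<gamma> ` V) \<subseteq> cusp_of \<Gamma>p V" if "\<gamma> \<in> \<Gamma>p" for \<gamma> V
    unfolding cusp_of_def
  proof (rule image_subsetI)
    fix f assume "f \<in> \<Gamma>p"
    then have "f \<circ> \<gamma> \<in> \<Gamma>p" using that by (rule \<Gamma>p_comp)
    then show "f ` \<gamma> ` V \<in> (\<lambda>f. f ` V) ` \<Gamma>p" unfolding image_comp by (rule imageI)
  qed
  show "cusp_of \<Gamma>p (\<gamma> ` V) \<subseteq> cusp_of \<Gamma>p V" by (rule sub[OF assms])
  have "inv_into UNIV \<gamma> ` \<gamma> ` V = V" using OL_inv_comp(1)[of \<gamma>] assms \<Gamma>_OL by (simp add: image_comp)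
  then show "cusp_of \<Gamma>p V \<subseteq> cusp_of \<Gamma>p (\<gamma> ` V)" using sub[OF \<Gamma>p_inv[OF assms], of "\<gamma> ` V"] by simp
qed

lemma cusp_of_self: "V \<in> cusp_of \<Gamma>p V"
  unfolding cusp_of_def using \<Gamma>p_id by (intro image_eqI[of _ _ id]) simp_all

text \<open>
  An isometry taking \<open>\<phi>2(U)\<close> to \<open>\<phi>1(U)\<close> up to the discriminant kernel lies in \<open>\<Gamma>\<close>, and it
  preserves the chosen component because all other factors do.
\<close>

lemma dc_eq_iff_cusp_eq:
  assumes p1: "\<phi>1 \<in> O_plus" and p2: "\<phi>2 \<in> O_plus"
  shows "dc \<phi>1 = dc \<phi>2 \<longleftrightarrow> cusp \<phi>1 = cusp \<phi>2"
proof
  note c1 = OL_plus_sub[OF p1] and c2 = OL_plus_sub[OF p2]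
  assume "dc \<phi>1 = dc \<phi>2"
  moreover have "red B L (id \<circ> \<phi>1 \<circ> id) \<in> dc \<phi>1" unfolding dc_eq[OF c1] using \<Gamma>_id stab_id by blast
  ultimately obtain \<gamma> s where gs: "red B L \<phi>1 = red B L (\<gamma> \<circ> \<phi>2 \<circ> s)" "\<gamma> \<in> \<Gamma>" "s \<in> stab"
    unfolding dc_eq[OF c2] by auto
  define \<psi> where "\<psi> = \<gamma> \<circ> \<phi>2 \<circ> s"
  have sp: "s \<in> O_plus" "s ` U = U" using gs(3) by (auto simp: stab_iff)
  have \<psi>: "\<psi> \<in> O_L" unfolding \<psi>_def using gs \<Gamma>_OL sp OL_plus_sub c2 OL_comp by metis
  \<comment> \<open>\<phi>1 and \<psi> have the same reduction, so \<kappa> lies in the discriminant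
    kernel. It absorbs the difference between an equality in \<open>O(D)\<close> and one in
    \<open>O(L)\<close>.\<close>
  define \<kappa> where "\<kappa> = \<phi>1 \<circ> inv_into UNIV \<psi>"
  have \<kappa>: "\<kappa> \<in> O_L" unfolding \<kappa>_def using c1 OL_inv[OF \<psi>] OL_comp by blast
  have "red B L \<kappa> = red B L (\<psi> \<circ> inv_into UNIV \<psi>)"
    unfolding \<kappa>_def red_comp[OF c1 OL_inv[OF \<psi>]] red_comp[OF \<psi> OL_inv[OF \<psi>]] gs(1) \<psi>_def[symmetric] ..
  then have "red B L \<kappa> = \<one>\<^bsub>OD B L\<^esub>" unfolding OL_inv_comp(2)[OF \<psi>] red_one .
  then have "\<kappa> \<in> \<Gamma>" using \<kappa> \<Gamma>_kernel by (auto simp: disc_kernel_def kernel_def)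
  then have kg: "\<kappa> \<circ> \<gamma> \<in> \<Gamma>" using gs(2) \<Gamma>_comp by blast
  have k: "\<kappa> (\<psi> x) = \<phi>1 x" for x unfolding \<kappa>_def by (simp add: inv_comp_left[OF \<psi>])
  have e: "\<phi>1 = (\<kappa> \<circ> \<gamma>) \<circ> \<phi>2 \<circ> s" using k by (auto simp: \<psi>_def fun_eq_iff)
  \<comment> \<open>The factors \<kappa> and \<gamma> may each exchange the components, but their
    product is composed of \<phi>1 and the inverses of \<open>s\<close> and \<phi>2, which preserve
    \<H>.\<close>
  have "\<kappa> \<circ> \<gamma> = \<phi>1 \<circ> (inv_into UNIV s \<circ> inv_into UNIV \<phi>2)"
    by (subst e) (simp add: fun_eq_iff inv_comp_right[OF c2] inv_comp_right[OF OL_plus_sub[OF sp(1)]])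
  then have "\<kappa> \<circ> \<gamma> \<in> O_plus"
    using OL_plus_comp[OF p1 OL_plus_comp[OF OL_plus_inv[OF sp(1)] OL_plus_inv[OF p2]]] by simp
  then have "cusp_of \<Gamma>p ((\<kappa> \<circ> \<gamma>) ` (\<phi>2 ` U)) = cusp \<phi>2" using kg by (intro cusp_of_eq) blast
  moreover have "\<phi>1 ` U = (\<kappa> \<circ> \<gamma>) ` (\<phi>2 ` U)"
    by (subst e) (simp only: image_comp[symmetric] sp(2))
  ultimately show "cusp \<phi>1 = cusp \<phi>2" by simp
next
  note c1 = OL_plus_sub[OF p1] and c2 = OL_plus_sub[OF p2]
  have sub: "dc \<phi>1 \<subseteq> dc \<phi>2" if p1: "\<phi>1 \<in> O_plus" and p2: "\<phi>2 \<in> O_plus" and eq: "cusp \<phi>1 = cusp \<phi>2" for \<phi>1 \<phi>2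
  proof -
    note c1 = OL_plus_sub[OF p1] and c2 = OL_plus_sub[OF p2]
    have "\<phi>1 ` U \<in> cusp \<phi>2" using cusp_of_self[of "\<phi>1 ` U"] eq by simp
    then obtain \<gamma> where \<gamma>: "\<gamma> \<in> \<Gamma>p" "\<phi>1 ` U = \<gamma> ` \<phi>2 ` U" unfolding cusp_of_def by blast
    have gc: "\<gamma> \<in> O_L" using \<gamma>(1) \<Gamma>_OL by blast
    define s where "s = inv_into UNIV \<phi>2 \<circ> (inv_into UNIV \<gamma> \<circ> \<phi>1)"
    have "s ` U = inv_into UNIV \<phi>2 ` inv_into UNIV \<gamma> ` \<gamma> ` \<phi>2 ` U" unfolding s_def image_comp[symmetric] \<gamma>(2) ..
    also have "\<dots> = U" by (simp add: image_image inv_comp_left[OF gc] inv_comp_left[OF c2])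
    finally have "s \<in> stab"
      unfolding stab_iff s_def using OL_plus_comp[OF OL_plus_inv[OF p2] OL_plus_comp[OF OL_plus_inv p1]] \<gamma>(1) by blast
    moreover have "\<phi>1 = \<gamma> \<circ> \<phi>2 \<circ> s"
      by (simp add: s_def fun_eq_iff inv_comp_right[OF c2] inv_comp_right[OF gc])
    ultimately show ?thesis using dc_subset[OF c1 c2] \<gamma>(1) by blast
  qed
  assume "cusp \<phi>1 = cusp \<phi>2"
  then show "dc \<phi>1 = dc \<phi>2" using sub[OF p1 p2] sub[OF p2 p1] by simp
qed

text \<open>The double quotient runs over all of \<open>O(D)\<close>; by
  \<open>red_surj_plus\<close> each of its classes has a lift in \<open>OL_plus\<close>.\<close>

lemma dc_image: "dc ` O_plus = double_quotient (OD B L) (red B L ` \<Gamma>) (red B L ` stab)"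
proof -
  have "red B L ` O_plus = O_D" using red_surj_plus red_OD OL_plus_sub by blast
  then show ?thesis unfolding double_quotient_def by (metis image_image)
qed

text \<open>One inclusion is the invariance of the three data under isometries, for every plane of
  the cusp. The other is \<open>splitting_planes_equivalent\<close>: a plane with these data is an
  image of \<open>U\<close> under \<open>OL_plus\<close>.\<close>

lemma cusp_image:
  "cusp ` O_plus =
    splitting_cusps B L \<Gamma>p (OD_orbit B L (plane_type B L U)) (assoc_lattice B L U)" (is "_ = ?R")
proof
  show "cusp ` O_plus \<subseteq> ?R"
  proof
    fix c assume "c \<in> cusp ` O_plus"
    then obtain \<phi> where \<phi>: "\<phi> \<in> O_plus" "c = cusp \<phi>" by blast
    have "c \<in> cusps1 B L \<Gamma>p"
      unfolding cusps1_def \<phi>(2) using OL_isotropic_plane[OF OL_plus_sub[OF \<phi>(1)] U_plane] by blast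
    moreover have "plane_splits B L V \<and> OD_orbit B L (plane_type B L V) = OD_orbit B L (plane_type B L U) \<and>
        lattice_isometric B (assoc_lattice B L V) (assoc_lattice B L U)" if V: "V \<in> c" for V
    proof -
      obtain \<gamma> where "\<gamma> \<in> \<Gamma>p" "V = \<gamma> ` \<phi> ` U" using V unfolding \<phi>(2) cusp_of_def by blast
      then have g: "\<gamma> \<circ> \<phi> \<in> O_L" "V = (\<gamma> \<circ> \<phi>) ` U"
        using OL_plus_comp[OF _ \<phi>(1)] OL_plus_sub by (auto simp: image_comp)
      have "inv_into UNIV (\<gamma> \<circ> \<phi>) ` V = U" unfolding g(2) image_comp OL_inv_comp(1)[OF g(1)] by simp
      then have "lattice_isometric B (assoc_lattice B L V) (assoc_lattice B L U)"
        using OL_assoc_lattice[OF OL_inv[OF g(1)], of V] by simp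
      then show ?thesis using OL_plane_splits[OF g(1) U_splits] OD_orbit_invariant[OF g(1), of U] g(2) by simp
    qed
    ultimately show "c \<in> ?R" unfolding splitting_cusps_def by blast
  qed
  show "?R \<subseteq> cusp ` O_plus"
  proof
    fix c assume c: "c \<in> ?R"
    then obtain V where V: "V \<in> isotropic_planes B L" "c = cusp_of \<Gamma>p V"
      by (auto simp: splitting_cusps_def cusps1_def)
    then have "V \<in> c" using cusp_of_self by simp
    then have V': "plane_splits B L V" "OD_orbit B L (plane_type B L V) = OD_orbit B L (plane_type B L U)"
      "lattice_isometric B (assoc_lattice B L V) (assoc_lattice B L U)"
      using c by (auto simp: splitting_cusps_def)
    obtain \<phi> where \<phi>: "\<phi> \<in> O_plus" "\<phi> ` V = U"
      using splitting_planes_equivalent[OF V(1) V'(1) U_plane U_splits V'(2,3)] by blast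
    have "inv_into UNIV \<phi> ` U = V"
      unfolding \<phi>(2)[symmetric] image_comp OL_inv_comp(1)[OF OL_plus_sub[OF \<phi>(1)]] by simp
    then have "c = cusp (inv_into UNIV \<phi>)" unfolding V(2) by simp
    then show "c \<in> cusp ` O_plus" using OL_plus_inv[OF \<phi>(1)] by blast
  qed
qed

lemma qspan_image: "\<phi> \<in> O_plus \<Longrightarrow> qvec.span (\<phi> ` (L \<inter> U)) = \<phi> ` U"
  using qspan_linear_image[OF OLD(1)[OF OL_plus_sub], symmetric] qspan_Int_L[OF U_plane] by metis

lemma primitive_image: "\<phi> \<in> O_plus \<Longrightarrow> primitive_isotropic_plane B L (\<phi> ` (L \<inter> U))"
  unfolding primitive_isotropic_plane_def
  using OL_isotropic_plane[OF OL_plus_sub U_plane] OL_image_Int[OF OL_plus_sub, of _ L U] OLD(3)[OF OL_plus_sub] by metis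

end

theorem theorem6p6:
  fixes B :: "'v::euclidean_space \<Rightarrow> 'v \<Rightarrow> real"
    and L S :: "'v set"
    and n :: nat
    and \<H> :: "('v \<times> 'v) set set"
    and \<Gamma> \<Gamma>p :: "('v \<Rightarrow> 'v) set"
    and H :: "'v set set"
    and K :: "'v set monoid"
  defines "\<Gamma>p \<equiv> \<Gamma> \<inter> OL_plus B L \<H>"
  assumes "even_lattice B L"
    and "signature B n 2 TYPE('v)"
    and "n > 2"
    and "splits_hyperbolic_plane B L"
    and "\<H> \<in> period_components B"
    and "subgroup \<Gamma> (OL B L)"
    and "disc_kernel B L \<subseteq> \<Gamma>"
    and "primitive_isotropic_plane B L S"
    and "plane_splits B L (qvec.span S)"
    and "H = plane_type B L (qvec.span S)"
    and "K = assoc_lattice B L (qvec.span S)"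
  shows
    "(\<forall>R. double_coset_reps (OD B L) (red B L ` \<Gamma>) (red B L ` stab_plus B L \<H> S) R \<longrightarrow>
        (\<exists>\<Phi> \<subseteq> OL_plus B L \<H>. bij_betw (red B L) \<Phi> R) \<and>
        (\<forall>\<Phi> \<subseteq> OL_plus B L \<H>. bij_betw (red B L) \<Phi> R \<longrightarrow>
           (\<forall>\<phi>\<in>\<Phi>. primitive_isotropic_plane B L (\<phi> ` S)) \<and>
           bij_betw (\<lambda>\<phi>. cusp_of \<Gamma>p (qvec.span (\<phi> ` S))) \<Phi>
             (splitting_cusps B L \<Gamma>p (OD_orbit B L H) K))) \<and>
     (\<exists>F. bij_betw F
            (double_quotient (OD B L) (red B L ` \<Gamma>) (red B L ` stab_plus B L \<H> S))
            (splitting_cusps B L \<Gamma>p (OD_orbit B L H) K) \<and>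
          (\<forall>\<phi>\<in>OL_plus B L \<H>.
             F (double_coset (OD B L) (red B L ` \<Gamma>) (red B L ` stab_plus B L \<H> S) (red B L \<phi>)) =
             cusp_of \<Gamma>p (qvec.span (\<phi> ` S))))"
proof -
  interpret symmetric_bilinear B
    using assms(2) by unfold_locales (auto simp: even_lattice_def)
  obtain e0 f0 M where ef: "B e0 e0 = 0" "B f0 f0 = 0" "B e0 f0 = 1"
    and ds: "orth_direct_sum B L (zmod.span {e0, f0}) M"
    using assms(5) unfolding splits_hyperbolic_plane_def by (elim exE conjE) (rule that)
  have efL: "e0 \<in> L" "f0 \<in> L"
  proof -
    have L: "L = {x + y | x y. x \<in> zmod.span {e0, f0} \<and> y \<in> M}" and M: "0 \<in> M"
      using ds zsub_0 unfolding orth_direct_sum_def by blast+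
    have "e0 + 0 \<in> L" "f0 + 0 \<in> L" unfolding L using M zmod.span_base[of _ "{e0, f0}"] by blast+
    then show "e0 \<in> L" "f0 \<in> L" by simp_all
  qed
  obtain U where U: "U \<in> isotropic_planes B L" "S = L \<inter> U"
    using assms(9) by (auto simp: primitive_isotropic_plane_def)
  interpret nondegenerate_lattice B L
  proof
    show "is_lattice L" "even_on B L" using assms(2) by (auto simp: even_lattice_def)
    show "x = 0" if "\<And>y. B x y = 0" for x
      by (rule signature_nondegenerate[OF symmetric_bilinear_axioms assms(3) that])
  qed
  interpret period_lattice B L e0 f0 n \<H>
    by unfold_locales (rule efL ef assms(3,6))+
  have Us: "qvec.span S = U"
    unfolding U(2) by (rule qspan_Int_L[OF U(1)])
  interpret cusp_setting B L e0 f0 n \<H> \<Gamma> U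
    by (intro cusp_setting.intro cusp_setting_axioms.intro period_lattice_axioms assms(7,8) U(1) assms(10)[unfolded Us])
  let ?DQ = "double_quotient (OD B L) (red B L ` \<Gamma>) (red B L ` stab)"
  let ?SC = "splitting_cusps B L (\<Gamma> \<inter> OL_plus B L \<H>) (OD_orbit B L H) K"
  have SC: "cusp ` OL_plus B L \<H> = ?SC" unfolding cusp_image assms(11,12) Us ..
  \<comment> \<open>On \<open>OL_plus\<close> the double coset and the cusp have the same fibres by
    \<open>dc_eq_iff_cusp_eq\<close>, so their images are in bijection.\<close>
  obtain F where F: "bij_betw F (dc ` OL_plus B L \<H>) (cusp ` OL_plus B L \<H>)" "\<And>\<phi>. \<phi> \<in> OL_plus B L \<H> \<Longrightarrow> F (dc \<phi>) = cusp \<phi>"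
    using bij_betw_factor[of "OL_plus B L \<H>" dc cusp] dc_eq_iff_cusp_eq by blast
  have F': "bij_betw F ?DQ ?SC" using F(1) unfolding dc_image SC .
  have reps: "(\<exists>\<Phi> \<subseteq> OL_plus B L \<H>. bij_betw (red B L) \<Phi> R) \<and>
        (\<forall>\<Phi> \<subseteq> OL_plus B L \<H>. bij_betw (red B L) \<Phi> R \<longrightarrow>
           (\<forall>\<phi>\<in>\<Phi>. primitive_isotropic_plane B L (\<phi> ` S)) \<and>
           bij_betw (\<lambda>\<phi>. cusp_of (\<Gamma> \<inter> OL_plus B L \<H>) (qvec.span (\<phi> ` S))) \<Phi> ?SC)"
    if R: "double_coset_reps (OD B L) (red B L ` \<Gamma>) (red B L ` stab) R" for R
  proof (intro conjI allI impI)
    have R': "R \<subseteq> carrier (OD B L)" "bij_betw (double_coset (OD B L) (red B L ` \<Gamma>) (red B L ` stab)) R ?DQ"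
      using R by (auto simp: double_coset_reps_def)
    then have "R \<subseteq> red B L ` OL_plus B L \<H>" using red_surj_plus by blast
    then show "\<exists>\<Phi> \<subseteq> OL_plus B L \<H>. bij_betw (red B L) \<Phi> R"
      \<comment> \<open>\<open>subset_image_inj\<close> selects exactly one lift for each
        representative.\<close>
      unfolding subset_image_inj bij_betw_def by blast
    fix \<Phi> assume \<Phi>: "\<Phi> \<subseteq> OL_plus B L \<H>" "bij_betw (red B L) \<Phi> R"
    show "\<forall>\<phi>\<in>\<Phi>. primitive_isotropic_plane B L (\<phi> ` S)" using primitive_image \<Phi>(1) U(2) by blast
    have "bij_betw (F \<circ> (double_coset (OD B L) (red B L ` \<Gamma>) (red B L ` stab) \<circ> red B L)) \<Phi> ?SC"
      using bij_betw_trans[OF bij_betw_trans[OF \<Phi>(2) R'(2)] F'] .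
    then show "bij_betw (\<lambda>\<phi>. cusp_of (\<Gamma> \<inter> OL_plus B L \<H>) (qvec.span (\<phi> ` S))) \<Phi> ?SC"
    proof (rule bij_betw_cong[THEN iffD1, rotated])
      fix \<phi> assume "\<phi> \<in> \<Phi>"
      then have "\<phi> \<in> OL_plus B L \<H>" using \<Phi>(1) by blast
      then show "(F \<circ> (double_coset (OD B L) (red B L ` \<Gamma>) (red B L ` stab) \<circ> red B L)) \<phi> =
          cusp_of (\<Gamma> \<inter> OL_plus B L \<H>) (qvec.span (\<phi> ` S))"
        using F(2) qspan_image U(2) by simp
    qed
  qed
  have "F (dc \<phi>) = cusp_of (\<Gamma> \<inter> OL_plus B L \<H>) (qvec.span (\<phi> ` S))" if "\<phi> \<in> OL_plus B L \<H>" for \<phi>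
    using F(2) qspan_image that U(2) by simp
  then show ?thesis unfolding \<Gamma>p_def using reps F' U(2) by blast
qed

end
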